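(* There exist constants $h_*>0$ and $C>0$, independent of the mesh size $h$, of the position of the interface relative to the mesh, and of the coefficients $\beta^\pm$, such that whenever $h<h_*$, for every interface element $K\in\mathcal T_h$, $$\|\beta\nabla\phi\|_{L^2(\partial K)}\le C\,\frac{\beta^+}{\sqrt{\beta^-}}\,h^{-1/2}\,\|\sqrt{\beta}\,\nabla\phi\|_{L^2(K)}\qquad\text{for all }\phi\in\mathcal V^m_\beta(K).$$
   Context: Geometry. $\Omega\subset\mathbb R^2$ is a rectangle and $\Gamma\subset\Omega$ is a Jordan curve splitting $\Omega$ into subdomains $\Omega^+,\Omega^-$ with $\partial\Omega^+\cap\partial\Omega^-=\Gamma$. Fix an integer $m\ge1$. $\Gamma$ is parametrized by a regular $C^{m+1}$ curve $\mathbf g:[\xi_s,\xi_e]\to\Omega$ ($\mathbf g'\neq0$, $\mathbf g(\xi_s)=\mathbf g(\xi_e)$, injective on $[\xi_s,\xi_e)$), extended periodically where needed. Put $\boldsymbol\tau=\mathbf g'/\|\mathbf g'\|$, $\mathbf n=\begin{pmatrix}0&1\\-1&0\end{pmatrix}\boldsymbol\tau$ (pointing from $\Omega^-$ to $\Omega^+$), $\kappa=\det(\mathbf g',\mathbf g'')/\|\mathbf g'\|^3$, and $P(\eta,\xi)=\mathbf g(\xi)+\eta\,\mathbf n(\xi)$. Let $\epsilon>0$ be such that $P$ is injective on $(-\epsilon,\epsilon)\times[\xi_s,\xi_e)$, and let $R=P^{-1}$ there. Mesh. $\mathcal T_h$ is a uniform rectangular mesh of $\Omega$ (congruent rectangles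 of diameter $h$, fixed aspect ratio as $h$ varies), independent of $\Gamma$, with $h<\epsilon/2$ and $h\max|\kappa|\le\frac12$. An element $K$ is an interface element if its interior meets $\Gamma$; then $K^\pm=K\cap\Omega^\pm$. To each interface element $K$ is associated an interval $[\xi_0,\xi_1]$ with $K\subset K_F:=P([-h,h]\times[\xi_0,\xi_1])$ and $\xi_1-\xi_0\simeq h$ (two-sided bound with constants independent of $h$ and $K$). Set $\widehat K=R(K)\subset\widehat K_F:=[-h,h]\times[\xi_0,\xi_1]$, $\widehat K^\pm=R(K^\pm)$, $\widehat\Gamma_{K_F}=\{0\}\times[\xi_0,\xi_1]$. Coefficients and spaces. $\beta|_{\Omega^\pm}=\beta^\pm$ are constants with $\beta^+\ge\beta^->0$; $\widehat\beta=\beta\circ P$ (equal to $\beta^\pm$ for $\pm\eta>0$). $\mathscr L$ is the differential operator in $(\eta,\xi)$ with $\mathscr L(u\circ P)=(\Delta u)\circ P$; explicitly, with $J=\|\mathbf g'\|(1+\eta\kappa)$, $\mathscr L(v)=v_{\eta\eta}+\frac{\kappa}{1+\eta\kappa}v_\eta+\frac1J\partial_\xi\big(\frac1J v_\xi\big)$. $Q^m$ denotes tensor-product polynomials of degree at most $m$ in each variable, $\mathcal P^m(\widehat\Gamma_{K_F})$ univariate polynomials of degree at most $m$ in $\xi$. $[\![v]\!]$ is the jump $v^+-v^-$ across $\widehat\Gamma_{K_F}$, where the polynomial pieces are extended as polynomials. $\widehat{\mathcal V}^m_\beta(\widehat K)$ is the space of piecewise polynomials $\widehat\phi$ with $\widehat\phi|_{\widehat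 K^\pm}\in Q^m(\widehat K^\pm)$, $[\![\widehat\phi]\!]=[\![\widehat\beta\,\widehat\phi_\eta]\!]=0$ on $\widehat\Gamma_{K_F}$, and $\int_{\widehat\Gamma_{K_F}}[\![\widehat\beta\,\partial_\eta^j\mathscr L(\widehat\phi)]\!]\,v=0$ for all $v\in\mathcal P^m(\widehat\Gamma_{K_F})$, $0\le j\le m-2$. The local Frenet IFE space is $\mathcal V^m_\beta(K)=\{\widehat\phi\circ R|_K:\widehat\phi\in\widehat{\mathcal V}^m_\beta(\widehat K)\}$. Gradients of such functions are taken piecewise on $K^\pm$. *)

theory Defs
  imports "HOL-Analysis.Analysis"
begin

text \<open>
  The physical variables \<open>(x, y)\<close> and the Frenet variables \<open>(\<eta>, \<xi>)\<close> are both elements of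
  \<^typ>\<open>real \<times> real\<close>, with its Euclidean norm and Lebesgue measure.
\<close>

type_synonym plane = "real \<times> real"

subsection \<open>The interface curve and its Frenet coordinates\<close>

definition vderiv :: "(real \<Rightarrow> 'a::real_normed_vector) \<Rightarrow> real \<Rightarrow> 'a" where
  "vderiv f = (\<lambda>t. vector_derivative f (at t))"

definition C_k :: "nat \<Rightarrow> (real \<Rightarrow> 'a::real_normed_vector) \<Rightarrow> bool" where
  "C_k k f \<longleftrightarrow>
     (\<forall>j<k. \<forall>t. ((vderiv ^^ j) f) differentiable (at t)) \<and> continuous_on UNIV ((vderiv ^^ k) f)"

text \<open>
  A closed curve of class \<open>C\<^sup>k\<close> on \<open>[\<xi>s, \<xi>e]\<close> is given together with its periodic extension,
  so that its derivatives up to order \<open>k\<close> match at the closing point.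
\<close>

definition regular_closed_curve :: "nat \<Rightarrow> (real \<Rightarrow> plane) \<Rightarrow> real \<Rightarrow> real \<Rightarrow> bool" where
  "regular_closed_curve k g \<xi>s \<xi>e \<longleftrightarrow>
     \<xi>s < \<xi>e \<and> C_k k g \<and> (\<forall>t. g (t + (\<xi>e - \<xi>s)) = g t) \<and> (\<forall>t. vderiv g t \<noteq> 0) \<and>
     inj_on g {\<xi>s..<\<xi>e}"

definition tangent :: "(real \<Rightarrow> plane) \<Rightarrow> real \<Rightarrow> plane" where
  "tangent g t = (1 / norm (vderiv g t)) *\<^sub>R vderiv g t"

definition normal_vec :: "(real \<Rightarrow> plane) \<Rightarrow> real \<Rightarrow> plane" where
  "normal_vec g t = (snd (tangent g t), - fst (tangent g t))"

definition det2 :: "plane \<Rightarrow> plane \<Rightarrow> real" where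
  "det2 u v = fst u * snd v - snd u * fst v"

definition curvature :: "(real \<Rightarrow> plane) \<Rightarrow> real \<Rightarrow> real" where
  "curvature g t = det2 (vderiv g t) (vderiv (vderiv g) t) / norm (vderiv g t) ^ 3"

definition frenet :: "(real \<Rightarrow> plane) \<Rightarrow> plane \<Rightarrow> plane" where
  "frenet g = (\<lambda>(\<eta>, \<xi>). g \<xi> + \<eta> *\<^sub>R normal_vec g \<xi>)"

text \<open>
  The inverse \<open>R\<close> of the Frenet map \<open>P\<close> on the strip of half-width \<open>\<epsilon>\<close>.  The parameter window of
  one period \<open>L\<close> may start at any \<open>\<xi>0\<close>, so that an element meeting the closing point of the curve
  needs no special treatment.
\<close>

definition frenet_inv :: "(real \<Rightarrow> plane) \<Rightarrow> real \<Rightarrow> real \<Rightarrow> real \<Rightarrow> plane \<Rightarrow> plane" where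
  "frenet_inv g L \<epsilon> \<xi>0 = the_inv_into ({-\<epsilon><..<\<epsilon>} \<times> {\<xi>0..<\<xi>0 + L}) (frenet g)"

subsection \<open>The domain, its splitting and the meshes\<close>

text \<open>
  \<open>\<Omega>\<close> is the open rectangle \<^term>\<open>box a b\<close>.  The last conjunct says that the normal points from
  \<open>\<Omega>m\<close> to \<open>\<Omega>p\<close>.
\<close>

definition interface_splitting ::
    "(real \<Rightarrow> plane) \<Rightarrow> real \<Rightarrow> real \<Rightarrow> plane \<Rightarrow> plane \<Rightarrow> plane set \<Rightarrow> plane set \<Rightarrow> bool" where
  "interface_splitting g \<xi>s \<xi>e a b \<Omega>p \<Omega>m \<longleftrightarrow>
     g ` {\<xi>s..\<xi>e} \<subseteq> box a b \<and>
     open \<Omega>p \<and> connected \<Omega>p \<and> \<Omega>p \<noteq> {} \<and> open \<Omega>m \<and> connected \<Omega>m \<and> \<Omega>m \<noteq> {} \<and>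
     \<Omega>p \<inter> \<Omega>m = {} \<and> \<Omega>p \<union> \<Omega>m = box a b - g ` {\<xi>s..\<xi>e} \<and>
     frontier \<Omega>p \<inter> frontier \<Omega>m = g ` {\<xi>s..\<xi>e} \<and>
     (\<forall>\<xi>. \<forall>\<^sub>F \<eta> in at_right 0. frenet g (\<eta>, \<xi>) \<in> \<Omega>p \<and> frenet g (- \<eta>, \<xi>) \<in> \<Omega>m)"

text \<open>
  The uniform mesh of the rectangle with corners \<open>a\<close>, \<open>b\<close> into closed congruent rectangles of
  diameter \<open>h\<close> and aspect ratio (width over height) \<open>\<rho>\<close>.
\<close>

definition uniform_mesh :: "plane \<Rightarrow> plane \<Rightarrow> real \<Rightarrow> real \<Rightarrow> plane set set \<Rightarrow> bool" where
  "uniform_mesh a b \<rho> h \<T> \<longleftrightarrow>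
     fst a < fst b \<and> snd a < snd b \<and>
     (\<exists>N1 N2 :: nat. \<exists>w1 w2 :: real. N1 > 0 \<and> N2 > 0 \<and>
        real N1 * w1 = fst b - fst a \<and> real N2 * w2 = snd b - snd a \<and>
        w1 = \<rho> * w2 \<and> h = sqrt (w1\<^sup>2 + w2\<^sup>2) \<and>
        \<T> = {cbox (fst a + real i * w1, snd a + real j * w2)
                   (fst a + real (Suc i) * w1, snd a + real (Suc j) * w2) | i j. i < N1 \<and> j < N2})"

subsection \<open>The immersed finite element space\<close>

definition piecewise_coeff :: "plane set \<Rightarrow> real \<Rightarrow> real \<Rightarrow> plane \<Rightarrow> real" where
  "piecewise_coeff \<Omega>p \<beta>p \<beta>m x = (if x \<in> \<Omega>p then \<beta>p else \<beta>m)"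

definition d_eta :: "(plane \<Rightarrow> real) \<Rightarrow> plane \<Rightarrow> real" where
  "d_eta v = (\<lambda>(\<eta>, \<xi>). deriv (\<lambda>s. v (s, \<xi>)) \<eta>)"

definition d_xi :: "(plane \<Rightarrow> real) \<Rightarrow> plane \<Rightarrow> real" where
  "d_xi v = (\<lambda>(\<eta>, \<xi>). deriv (\<lambda>s. v (\<eta>, s)) \<xi>)"

definition frenet_jac :: "(real \<Rightarrow> plane) \<Rightarrow> plane \<Rightarrow> real" where
  "frenet_jac g = (\<lambda>(\<eta>, \<xi>). norm (vderiv g \<xi>) * (1 + \<eta> * curvature g \<xi>))"

definition frenet_laplacian :: "(real \<Rightarrow> plane) \<Rightarrow> (plane \<Rightarrow> real) \<Rightarrow> plane \<Rightarrow> real" where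
  "frenet_laplacian g v = (\<lambda>(\<eta>, \<xi>).
     d_eta (d_eta v) (\<eta>, \<xi>)
     + curvature g \<xi> / (1 + \<eta> * curvature g \<xi>) * d_eta v (\<eta>, \<xi>)
     + 1 / frenet_jac g (\<eta>, \<xi>) * d_xi (\<lambda>z. 1 / frenet_jac g z * d_xi v z) (\<eta>, \<xi>))"

definition Q_poly :: "nat \<Rightarrow> (plane \<Rightarrow> real) set" where
  "Q_poly m = {p. \<exists>c :: nat \<Rightarrow> nat \<Rightarrow> real. \<forall>\<eta> \<xi>. p (\<eta>, \<xi>) = (\<Sum>i\<le>m. \<Sum>j\<le>m. c i j * \<eta> ^ i * \<xi> ^ j)}"

text \<open>
  The local space in Frenet coordinates, for the subelements \<open>Khp\<close>, \<open>Khm\<close> and the interface segment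
  \<open>{0} \<times> [\<xi>0, \<xi>1]\<close>.  The pieces are polynomials on the whole plane, so the jumps make sense on the
  whole segment.  Only the values on the two subelements are prescribed: functions are understood
  up to their values on the null set of remaining points.
\<close>

definition ref_ife_space ::
    "(real \<Rightarrow> plane) \<Rightarrow> nat \<Rightarrow> real \<Rightarrow> real \<Rightarrow> real \<Rightarrow> real \<Rightarrow> plane set \<Rightarrow> plane set \<Rightarrow> (plane \<Rightarrow> real) set"
  where
  "ref_ife_space g m \<beta>p \<beta>m \<xi>0 \<xi>1 Khp Khm = {\<phi>. \<exists>pp \<in> Q_poly m. \<exists>pm \<in> Q_poly m.
     (\<forall>z\<in>Khp. \<phi> z = pp z) \<and> (\<forall>z\<in>Khm. \<phi> z = pm z) \<and>
     (\<forall>\<xi>\<in>{\<xi>0..\<xi>1}. pp (0, \<xi>) - pm (0, \<xi>) = 0) \<and>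
     (\<forall>\<xi>\<in>{\<xi>0..\<xi>1}. \<beta>p * d_eta pp (0, \<xi>) - \<beta>m * d_eta pm (0, \<xi>) = 0) \<and>
     (\<forall>j. \<forall>v :: real poly. j + 2 \<le> m \<longrightarrow> degree v \<le> m \<longrightarrow>
        integral {\<xi>0..\<xi>1} (\<lambda>\<xi>. (\<beta>p * (d_eta ^^ j) (frenet_laplacian g pp) (0, \<xi>)
          - \<beta>m * (d_eta ^^ j) (frenet_laplacian g pm) (0, \<xi>)) * poly v \<xi>) = 0)}"

definition ife_space ::
    "(real \<Rightarrow> plane) \<Rightarrow> real \<Rightarrow> real \<Rightarrow> nat \<Rightarrow> real \<Rightarrow> real \<Rightarrow> real \<Rightarrow> real \<Rightarrow>
      plane set \<Rightarrow> plane set \<Rightarrow> plane set \<Rightarrow> (plane \<Rightarrow> real) set"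
  where
  "ife_space g L \<epsilon> m \<beta>p \<beta>m \<xi>0 \<xi>1 \<Omega>p \<Omega>m K =
     (let R = frenet_inv g L \<epsilon> \<xi>0 in
      {\<phi>. \<exists>\<phi>h \<in> ref_ife_space g m \<beta>p \<beta>m \<xi>0 \<xi>1 (R ` (K \<inter> \<Omega>p)) (R ` (K \<inter> \<Omega>m)). \<forall>x\<in>K. \<phi> x = \<phi>h (R x)})"

subsection \<open>Gradients, traces and norms\<close>

definition grad :: "(plane \<Rightarrow> real) \<Rightarrow> plane \<Rightarrow> plane" where
  "grad f x = (THE D. GDERIV f x :> D)"

text \<open>
  The trace on the boundary of a convex set with interior point \<open>c\<close>: the limit along the segment
  towards \<open>c\<close>.  It reads the field inside the set only, so it picks the correct side also where the
  interface runs along an edge.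
\<close>

definition inner_trace :: "plane \<Rightarrow> (plane \<Rightarrow> plane) \<Rightarrow> plane \<Rightarrow> plane" where
  "inner_trace c F x = Lim (at_right (0::real)) (\<lambda>t. F (x + t *\<^sub>R (c - x)))"

definition L2_norm :: "plane set \<Rightarrow> (plane \<Rightarrow> plane) \<Rightarrow> real" where
  "L2_norm K F = sqrt (LINT x:K|lebesgue. (norm (F x))\<^sup>2)"

definition rect_boundary_integral :: "plane \<Rightarrow> plane \<Rightarrow> (plane \<Rightarrow> real) \<Rightarrow> real" where
  "rect_boundary_integral p q f =
     (LINT x:{fst p..fst q}|lebesgue. f (x, snd p)) + (LINT x:{fst p..fst q}|lebesgue. f (x, snd q)) +
     (LINT y:{snd p..snd q}|lebesgue. f (fst p, y)) + (LINT y:{snd p..snd q}|lebesgue. f (fst q, y))"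

definition L2_boundary_norm :: "plane \<Rightarrow> plane \<Rightarrow> (plane \<Rightarrow> plane) \<Rightarrow> real" where
  "L2_boundary_norm p q F =
     sqrt (rect_boundary_integral p q (\<lambda>x. (norm (inner_trace (midpoint p q) F x))\<^sup>2))"

end

theory Submission
  imports Defs
begin

text \<open>
In Frenet coordinates \<open>(\<eta>, \<xi>)\<close>, rescaled by \<open>h\<close> and with origin \<open>(0, \<xi>0)\<close>, a function of the immersed space
is a pair of polynomials from one fixed finite-dimensional space, living on a rectangle whose shape
stays in a compact family.  Up to constants the gradient of such a polynomial \<open>p\<close> is therefore measured by
one number \<open>S p\<close>, a weighted sum of the absolute values of its coefficients other than the constant one
(\<open>grad_size\<close>), and the metric factors of the Frenet map are bounded above and below because
\<open>1 + \<eta> \<kappa>\<close> lies between \<open>1/2\<close> and \<open>3/2\<close>.  Three facts carry the estimate.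

\<^item> \<^emph>\<open>One piece controls the other.\<close>  Let \<open>p\<^sub>b\<close>, \<open>p\<^sub>e\<close> be the two pieces, \<open>r = \<beta>\<^sub>b / \<beta>\<^sub>e\<close> and
  \<open>d = p\<^sub>e - r p\<^sub>b = \<Sum>\<^sub>i \<eta>\<^sup>i d\<^sub>i(\<xi>)\<close>.  Continuity gives \<open>d\<^sub>0 = (1 - r) p\<^sub>b(0, \<cdot>)\<close> and the flux condition gives
  \<open>d\<^sub>1 = 0\<close>.  On \<open>\<eta> = 0\<close> the function \<open>\<partial>\<^sub>\<eta>\<^sup>j \<L> d\<close> equals \<open>(j+2)! d\<^sub>j\<^sub>+\<^sub>2\<close> plus terms in \<open>d\<^sub>0, \<dots>, d\<^sub>j\<^sub>+\<^sub>1\<close>, and it is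
  orthogonal to all polynomials of degree at most \<open>m\<close>, in particular to \<open>d\<^sub>j\<^sub>+\<^sub>2\<close> itself.  So the layers
  are bounded one after the other, and \<open>S p\<^sub>e \<le> C (1 + r) S p\<^sub>b\<close>; this is \<open>ife_extension_bound\<close>, and it
  is where the coefficients enter.

\<^item> \<^emph>\<open>Upper bound on the boundary.\<close>  Both one-sided gradients are bounded by \<open>C S p / h\<close> pointwise, and
  \<open>\<partial>K\<close> has length at most \<open>4 h\<close>.  The trace is the limit along the segment towards the centre; outside a
  countable set of boundary points that segment starts on a definite side of the interface
  (\<open>inner_trace_le\<close>, \<open>edge_integral_le\<close>).

\<^item> \<^emph>\<open>Lower bound in the element.\<close>  Along the normal line through the centre of \<open>K\<close> the Frenet map is
  affine, so a step away from the interface reaches a point of \<open>K\<close> at distance comparable to \<open>h\<close> from both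
  the interface and \<open>\<partial>K\<close>.  Hence on one side, \<open>K\<^sup>+\<close> or \<open>K\<^sup>-\<close>, there is a ball of radius comparable to \<open>h\<close> on
  which the gradient is at least \<open>c S p / h\<close> (\<open>large_gradient_ball\<close>).

The small side never needs an estimate of its own: its piece is controlled by the piece on the large
side.  If the large side is the minus side, \<open>r = \<beta>\<^sup>- / \<beta>\<^sup>+ \<le> 1\<close>; the boundary norm has the weight \<open>\<beta>\<^sup>+\<close> while the
energy norm only offers \<open>\<surd>\<beta>\<^sup>-\<close>, which costs \<open>\<beta>\<^sup>+ / \<surd>\<beta>\<^sup>-\<close>.  In the other case the factor \<open>r = \<beta>\<^sup>+ / \<beta>\<^sup>-\<close> of the extension
is cancelled by the weight \<open>\<beta>\<^sup>-\<close> (\<open>coefficient_bookkeeping\<close>).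
\<close>

section \<open>Polynomials of bounded degree\<close>

text \<open>
A norm on polynomials of degree at most \<open>m\<close>, chosen because multiplication by a linear factor and
differentiation act on it explicitly.
\<close>

definition coeff_norm :: "nat \<Rightarrow> real poly \<Rightarrow> real" where
  "coeff_norm m q = (\<Sum>k\<le>m. \<bar>coeff q k\<bar>)"

lemma coeff_norm_nonneg [simp]: "0 \<le> coeff_norm m q"
  by (simp add: coeff_norm_def sum_nonneg)

lemma coeff_norm_add: "coeff_norm m (p + q) \<le> coeff_norm m p + coeff_norm m q"
  unfolding coeff_norm_def sum.distrib[symmetric] by (rule sum_mono) simp

lemma coeff_norm_smult: "coeff_norm m (smult a q) = \<bar>a\<bar> * coeff_norm m q"
  by (simp add: coeff_norm_def abs_mult sum_distrib_left)

lemma coeff_norm_eq_degree: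
  assumes "degree q \<le> m" "m \<le> n" shows "coeff_norm n q = coeff_norm m q"
  unfolding coeff_norm_def
  by (rule sum.mono_neutral_right) (use assms in \<open>auto simp: coeff_eq_0\<close>)

lemma coeff_norm_pCons: "coeff_norm (Suc m) (pCons a q) = \<bar>a\<bar> + coeff_norm m q"
  unfolding coeff_norm_def sum.atMost_Suc_shift by simp

lemma coeff_norm_pderiv:
  assumes "degree q \<le> m" shows "coeff_norm m (pderiv q) \<le> real m * coeff_norm m q"
proof -
  have "coeff_norm m (pderiv q) = (\<Sum>k<Suc m. real (Suc k) * \<bar>coeff q (Suc k)\<bar>)"
    by (simp add: coeff_norm_def coeff_pderiv abs_mult lessThan_Suc_atMost)
  also have "\<dots> \<le> (\<Sum>k<Suc m. real m * \<bar>coeff q (Suc k)\<bar>)"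
  proof (rule sum_mono)
    fix k assume "k \<in> {..<Suc m}"
    show "real (Suc k) * \<bar>coeff q (Suc k)\<bar> \<le> real m * \<bar>coeff q (Suc k)\<bar>"
    proof (cases "k < m")
      case True then show ?thesis by (intro mult_right_mono) auto
    next
      case False then show ?thesis using assms by (simp add: coeff_eq_0)
    qed
  qed
  also have "\<dots> = real m * (\<Sum>k\<in>{1..Suc m}. \<bar>coeff q k\<bar>)"
    by (simp only: sum_distrib_left[symmetric] lessThan_Suc_atMost)
       (simp add: sum.shift_bounds_cl_Suc_ivl atMost_atLeast0 del: sum.cl_ivl_Suc)
  also have "(\<Sum>k\<in>{1..Suc m}. \<bar>coeff q k\<bar>) \<le> (\<Sum>k\<le>Suc m. \<bar>coeff q k\<bar>)"
    by (rule sum_mono2) auto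
  also have "\<dots> = coeff_norm m q"
    using coeff_norm_eq_degree[OF assms, of "Suc m"] by (simp add: coeff_norm_def)
  finally show ?thesis by (simp add: mult_left_mono)
qed

lemma poly_abs_le:
  assumes "degree q \<le> m" "\<bar>t\<bar> \<le> T" "1 \<le> T"
  shows "\<bar>poly q t\<bar> \<le> T ^ m * coeff_norm m q"
proof -
  have "poly q t = (\<Sum>k\<le>m. coeff q k * t ^ k)"
    unfolding poly_altdef by (rule sum.mono_neutral_left) (use assms in \<open>auto simp: coeff_eq_0\<close>)
  also have "\<bar>\<dots>\<bar> \<le> (\<Sum>k\<le>m. \<bar>coeff q k * t ^ k\<bar>)" by (rule sum_abs)
  also have "\<dots> \<le> (\<Sum>k\<le>m. T ^ m * \<bar>coeff q k\<bar>)"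
  proof (rule sum_mono)
    fix k assume "k \<in> {..m}"
    then have "\<bar>t\<bar> ^ k \<le> T ^ m"
      using assms by (meson abs_ge_zero atMost_iff order.trans power_increasing power_mono)
    then show "\<bar>coeff q k * t ^ k\<bar> \<le> T ^ m * \<bar>coeff q k\<bar>"
      using mult_left_mono[of "\<bar>t\<bar> ^ k" "T ^ m" "\<bar>coeff q k\<bar>"] by (simp add: abs_mult power_abs mult.commute)
  qed
  finally show ?thesis by (simp add: coeff_norm_def sum_distrib_left)
qed

lemma poly_lipschitz:
  assumes "degree q \<le> m" "\<bar>x\<bar> \<le> T" "\<bar>y\<bar> \<le> T" "1 \<le> T"
  shows "\<bar>poly q x - poly q y\<bar> \<le> T ^ m * (real m * coeff_norm m q) * \<bar>x - y\<bar>"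
proof -
  obtain z where z: "z \<in> {-T..T}" "poly q x - poly q y = (x - y) * poly (pderiv q) z"
    using poly_MVT'[of y x "{-T..T}" q] assms(2,3) by (auto simp: abs_le_iff)
  have "\<bar>poly (pderiv q) z\<bar> \<le> T ^ m * coeff_norm m (pderiv q)"
    using z assms by (intro poly_abs_le) (auto simp: degree_pderiv)
  also have "\<dots> \<le> T ^ m * (real m * coeff_norm m q)"
    using assms by (intro mult_left_mono coeff_norm_pderiv) auto
  finally show ?thesis
    unfolding z(2) abs_mult by (metis abs_ge_zero mult.commute mult_right_mono)
qed

text \<open>
Equivalence of norms, uniformly for intervals of length \<open>\<delta>\<close> in a bounded range.  Induction on the degree:
dividing \<open>q - q(a)\<close> by \<open>X - a\<close> leaves a polynomial of smaller degree which is bounded on the right half of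
the interval, where \<open>x - a \<ge> \<delta>/2\<close>.
\<close>

lemma coeff_norm_le_sup:
  fixes T \<delta> :: real
  assumes "0 < \<delta>" "0 \<le> T"
  shows "\<exists>C>0. \<forall>q a B. degree q \<le> m \<longrightarrow> \<bar>a\<bar> \<le> T \<longrightarrow> (\<forall>x\<in>{a..a+\<delta>}. \<bar>poly q x\<bar> \<le> B)
           \<longrightarrow> coeff_norm m q \<le> C * B"
  using assms
proof (induction m arbitrary: T \<delta>)
  case 0
  show ?case
  proof (intro exI[of _ 1] conjI allI impI)
    fix q :: "real poly" and a B
    assume "degree q \<le> 0" and "\<forall>x\<in>{a..a+\<delta>}. \<bar>poly q x\<bar> \<le> B"
    moreover from this have "\<bar>poly q a\<bar> \<le> B" using \<open>0 < \<delta>\<close> by simp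
    ultimately show "coeff_norm 0 q \<le> 1 * B"
      by (auto simp: coeff_norm_def elim!: degree_eq_zeroE)
  qed simp
next
  case (Suc m)
  obtain C where "C > 0" and C: "\<And>q a B. degree q \<le> m \<Longrightarrow> \<bar>a\<bar> \<le> T + \<delta>/2 \<Longrightarrow>
      (\<forall>x\<in>{a..a+\<delta>/2}. \<bar>poly q x\<bar> \<le> B) \<Longrightarrow> coeff_norm m q \<le> C * B"
    using Suc.IH[of "\<delta>/2" "T + \<delta>/2"] Suc.prems by auto
  show ?case
  proof (intro exI[of _ "(1 + T) * (C * (4/\<delta>)) + 1"] conjI allI impI)
    show "0 < (1 + T) * (C * (4/\<delta>)) + 1" using \<open>C > 0\<close> Suc.prems by (simp add: add_nonneg_pos)
    fix q :: "real poly" and a B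
    assume deg: "degree q \<le> Suc m" and a: "\<bar>a\<bar> \<le> T" and B: "\<forall>x\<in>{a..a+\<delta>}. \<bar>poly q x\<bar> \<le> B"
    define r where "r = synthetic_div q a"
    have q: "q = [:-a, 1:] * r + [:poly q a:]"
      unfolding r_def by (rule synthetic_div_correct'[symmetric])
    have degr: "degree r \<le> m" using deg by (simp add: r_def degree_synthetic_div)
    have Ba: "\<bar>poly q a\<bar> \<le> B" using B Suc.prems by simp
    have "\<bar>poly r x\<bar> \<le> (4/\<delta>) * B" if x: "x \<in> {a + \<delta>/2..a + \<delta>/2 + \<delta>/2}" for x
    proof -
      have "poly q x = (x - a) * poly r x + poly q a" by (subst q) (simp add: algebra_simps)
      then have "(x - a) * \<bar>poly r x\<bar> = \<bar>poly q x - poly q a\<bar>"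
        using x Suc.prems by (simp add: abs_mult)
      also have "\<dots> \<le> 2 * B" using B[rule_format, of x] Ba x Suc.prems by auto
      finally have "(\<delta>/2) * \<bar>poly r x\<bar> \<le> 2 * B"
        using x mult_right_mono[of "\<delta>/2" "x - a" "\<bar>poly r x\<bar>"] by auto
      then show ?thesis using Suc.prems by (simp add: field_simps)
    qed
    then have r: "coeff_norm m r \<le> C * ((4/\<delta>) * B)"
      by (intro C[of r "a + \<delta>/2"] degr) (use a Suc.prems in auto)
    have "coeff_norm (Suc m) q = coeff_norm (Suc m) (smult (-a) r + pCons 0 r + [:poly q a:])"
      by (subst q) simp
    also have "\<dots> \<le> \<bar>a\<bar> * coeff_norm m r + coeff_norm m r + \<bar>poly q a\<bar>"
    proof -
      have "coeff_norm (Suc m) [:poly q a:] = \<bar>poly q a\<bar>"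
        by (simp add: coeff_norm_pCons) (simp add: coeff_norm_def)
      then show ?thesis
        using coeff_norm_add[of "Suc m" "smult (-a) r + pCons 0 r" "[:poly q a:]"]
          coeff_norm_add[of "Suc m" "smult (-a) r" "pCons 0 r"]
          coeff_norm_eq_degree[OF degr, of "Suc m"] coeff_norm_smult[of "Suc m" "-a" r]
          coeff_norm_pCons[of m 0 r]
        by simp
    qed
    also have "\<dots> \<le> (1 + T) * coeff_norm m r + B"
      using Ba a mult_right_mono[OF a, of "coeff_norm m r"] by (simp add: algebra_simps)
    also have "\<dots> \<le> (1 + T) * (C * ((4/\<delta>) * B)) + B"
      using r Suc.prems by (intro add_right_mono mult_left_mono) auto
    finally show "coeff_norm (Suc m) q \<le> ((1 + T) * (C * (4/\<delta>)) + 1) * B"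
      by (simp add: algebra_simps)
  qed
qed

text \<open>
If \<open>K q + E\<close> is orthogonal to \<open>q\<close>, then \<open>q\<close> is controlled by \<open>E\<close>: testing gives
\<open>K \<integral>q\<^sup>2 = - \<integral>E q \<le> C h sup \<bar>E\<bar> \<parallel>q\<parallel>\<close>, whereas \<open>\<integral>q\<^sup>2 \<ge> c h \<parallel>q\<parallel>\<^sup>2\<close> since \<open>q\<close> stays large near a point where
it is large.  The factors \<open>h\<close> cancel, so the constant depends only on the ratio bounds \<open>c1\<close> and \<open>c2\<close>.
\<close>

lemma coeff_norm_le_of_orthogonal:
  fixes c1 c2 :: real
  assumes "0 < c1" "c1 \<le> c2"
  shows "\<exists>C>0. \<forall>q h \<xi>0 \<xi>1 K E e. degree q \<le> m \<longrightarrow> 0 < h \<longrightarrow> c1 * h \<le> \<xi>1 - \<xi>0 \<longrightarrow> \<xi>1 - \<xi>0 \<le> c2 * h \<longrightarrow>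
     1 \<le> K \<longrightarrow> continuous_on {\<xi>0..\<xi>1} E \<longrightarrow> (\<forall>\<xi>\<in>{\<xi>0..\<xi>1}. \<bar>E \<xi>\<bar> \<le> e) \<longrightarrow>
     integral {\<xi>0..\<xi>1} (\<lambda>\<xi>. (K * poly q ((\<xi> - \<xi>0) / h) + E \<xi>) * poly q ((\<xi> - \<xi>0) / h)) = 0 \<longrightarrow>
     coeff_norm m q \<le> C * e"
proof -
  define T where "T = max 1 c2"
  have T: "1 \<le> T" "c2 \<le> T" by (auto simp: T_def)
  obtain C where "C > 0" and C: "\<And>q a B. degree q \<le> m \<Longrightarrow> \<bar>a\<bar> \<le> 0 \<Longrightarrow>
      (\<forall>x\<in>{a..a+c1}. \<bar>poly q x\<bar> \<le> B) \<Longrightarrow> coeff_norm m q \<le> C * B"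
    using coeff_norm_le_sup[OF assms(1), of 0 m] by auto
  \<comment> \<open>On an interval of this length around a large value, the Lipschitz bound loses at most half of that value.\<close>
  define r where "r = min (c1/2) (1 / (4 * C * (T ^ m * real (m+1))))"
  have r: "0 < r" "r \<le> c1 / 2" "r * (4 * C * (T ^ m * real (m+1))) \<le> 1"
  proof -
    have "0 < 4 * C * (T ^ m * real (m+1))" using \<open>C > 0\<close> T by auto
    then show "0 < r" "r \<le> c1 / 2" "r * (4 * C * (T ^ m * real (m+1))) \<le> 1"
      using assms by (auto simp: r_def min_def field_simps)
  qed
  define D where "D = 16 * C\<^sup>2 * c2 * T ^ m / r"
  have "D > 0" using \<open>C > 0\<close> T assms r by (simp add: D_def)
  have "coeff_norm m q \<le> D * e"
    if deg: "degree q \<le> m" and h: "0 < h" and l: "c1 * h \<le> \<xi>1 - \<xi>0" "\<xi>1 - \<xi>0 \<le> c2 * h"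
      and K: "1 \<le> K" and E: "continuous_on {\<xi>0..\<xi>1} E" and e: "\<forall>\<xi>\<in>{\<xi>0..\<xi>1}. \<bar>E \<xi>\<bar> \<le> e"
      and I: "integral {\<xi>0..\<xi>1} (\<lambda>\<xi>. (K * poly q ((\<xi> - \<xi>0) / h) + E \<xi>) * poly q ((\<xi> - \<xi>0) / h)) = 0"
    for q :: "real poly" and h \<xi>0 \<xi>1 K E e
  proof -
    define A where "A = coeff_norm m q"
    define f where "f \<xi> = poly q ((\<xi> - \<xi>0) / h)" for \<xi>
    have le: "\<xi>0 \<le> \<xi>1" using l(1) h assms(1) by (smt (verit) mult_pos_pos)
    have e0: "0 \<le> e" using e le by force
    have cf: "continuous_on S f" for S unfolding f_def using h by (intro continuous_intros) auto
    have A0: "0 \<le> A" by (simp add: A_def)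
    show ?thesis
    proof (cases "A = 0")
      case True then show ?thesis using \<open>D > 0\<close> e0 by (simp add: A_def)
    next
      case False
      with A0 have Apos: "A > 0" by simp
      have "\<not> (\<forall>x\<in>{0..0+c1}. \<bar>poly q x\<bar> \<le> A / (2 * C))"
        using C[OF deg, of 0 "A / (2 * C)"] Apos \<open>C > 0\<close> by (auto simp: A_def)
      then obtain x where x: "0 \<le> x" "x \<le> c1" "A / (2 * C) < \<bar>poly q x\<bar>" by auto
      \<comment> \<open>The interval \<open>[y, y + r]\<close> has \<open>x\<close> as an end point and stays inside \<open>[0, c1]\<close>.\<close>
      define y where "y = (if x \<le> c1 / 2 then x else x - r)"
      have y: "0 \<le> y" "y + r \<le> c1" "y \<le> x" "x \<le> y + r" using x r by (auto simp: y_def)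
      have low: "A / (4 * C) \<le> \<bar>poly q z\<bar>" if z: "z \<in> {y..y+r}" for z
      proof -
        have "\<bar>poly q x - poly q z\<bar> \<le> T ^ m * (real m * A) * \<bar>x - z\<bar>"
          unfolding A_def using x y z T assms deg by (intro poly_lipschitz) auto
        also have "\<dots> \<le> T ^ m * (real (m+1) * A) * r"
          using y z T Apos by (intro mult_mono) auto
        also have "\<dots> = (r * (4 * C * (T ^ m * real (m+1)))) * A / (4 * C)"
          using \<open>C > 0\<close> by simp
        also have "\<dots> \<le> A / (4 * C)"
          using mult_right_mono[OF r(3), of A] Apos \<open>C > 0\<close>
          by (intro divide_right_mono) (simp_all del: of_nat_add)
        finally have "\<bar>poly q x - poly q z\<bar> \<le> A / (4 * C)" .
        moreover have "A / (2 * C) = A / (4 * C) + A / (4 * C)" by simp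
        ultimately show ?thesis using x(3) by linarith
      qed
      have sub: "{\<xi>0 + h * y..\<xi>0 + h * (y + r)} \<subseteq> {\<xi>0..\<xi>1}"
      proof -
        have "h * (y + r) \<le> h * c1" "0 \<le> h * y" using y h by auto
        then show ?thesis using l(1) by (auto simp: mult.commute[of h c1])
      qed
      have "(h * r) * (A / (4 * C))\<^sup>2 = integral {\<xi>0 + h * y..\<xi>0 + h * (y + r)} (\<lambda>_. (A / (4 * C))\<^sup>2)"
        using h r by (simp add: algebra_simps)
      also have "\<dots> \<le> integral {\<xi>0 + h * y..\<xi>0 + h * (y + r)} (\<lambda>\<xi>. (f \<xi>)\<^sup>2)"
      proof (rule integral_le)
        fix \<xi> assume \<xi>: "\<xi> \<in> {\<xi>0 + h * y..\<xi>0 + h * (y + r)}"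
        have "A / (4 * C) \<le> \<bar>f \<xi>\<bar>" unfolding f_def
          using \<xi> h by (intro low) (auto simp: field_simps)
        then show "(A / (4 * C))\<^sup>2 \<le> (f \<xi>)\<^sup>2"
          using Apos \<open>C > 0\<close> by (metis abs_le_square_iff abs_of_nonneg divide_nonneg_pos less_imp_le mult_pos_pos zero_less_numeral)
      qed (auto intro!: integrable_continuous_interval continuous_intros cf)
      also have "\<dots> \<le> integral {\<xi>0..\<xi>1} (\<lambda>\<xi>. (f \<xi>)\<^sup>2)"
        by (intro integral_subset_le sub) (auto intro!: integrable_continuous_interval continuous_intros cf)
      also have "\<dots> \<le> K * integral {\<xi>0..\<xi>1} (\<lambda>\<xi>. (f \<xi>)\<^sup>2)"
        using K mult_right_mono[OF K, of "integral {\<xi>0..\<xi>1} (\<lambda>\<xi>. (f \<xi>)\<^sup>2)"]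
        by (simp add: integral_nonneg integrable_continuous_interval continuous_intros cf)
      also have "\<dots> = integral {\<xi>0..\<xi>1} (\<lambda>\<xi>. - (E \<xi> * f \<xi>))"
      proof -
        have "0 = integral {\<xi>0..\<xi>1} (\<lambda>\<xi>. K * (f \<xi>)\<^sup>2 + E \<xi> * f \<xi>)"
          using I by (simp add: f_def algebra_simps power2_eq_square)
        also have "\<dots> = K * integral {\<xi>0..\<xi>1} (\<lambda>\<xi>. (f \<xi>)\<^sup>2) + integral {\<xi>0..\<xi>1} (\<lambda>\<xi>. E \<xi> * f \<xi>)"
          by (subst integral_add) (auto intro!: integrable_continuous_interval continuous_intros cf E)
        finally show ?thesis by simp
      qed
      also have "\<dots> \<le> integral {\<xi>0..\<xi>1} (\<lambda>_. e * (T ^ m * A))"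
      proof (rule integral_le)
        fix \<xi> assume \<xi>: "\<xi> \<in> {\<xi>0..\<xi>1}"
        then have "(\<xi> - \<xi>0) / h \<le> c2" using l h by (auto simp: field_simps)
        then have "\<bar>f \<xi>\<bar> \<le> T ^ m * A" unfolding f_def A_def
          using \<xi> h T by (intro poly_abs_le deg) auto
        then have "\<bar>E \<xi> * f \<xi>\<bar> \<le> e * (T ^ m * A)"
          unfolding abs_mult using e \<xi> e0 by (intro mult_mono) auto
        then show "- (E \<xi> * f \<xi>) \<le> e * (T ^ m * A)" by linarith
      qed (auto intro!: integrable_continuous_interval continuous_intros cf E)
      also have "\<dots> = (\<xi>1 - \<xi>0) * (e * (T ^ m * A))" using le by simp
      also have "\<dots> \<le> (c2 * h) * (e * (T ^ m * A))"
        using l e0 T Apos by (intro mult_right_mono) auto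
      finally have "h * (A * (r * A)) \<le> h * (A * (16 * C\<^sup>2 * c2 * T ^ m * e))"
        using \<open>C > 0\<close> by (simp add: power2_eq_square field_simps)
      then have "r * A \<le> 16 * C\<^sup>2 * c2 * T ^ m * e" using h Apos by simp
      then show ?thesis using r(1) by (simp add: D_def A_def field_simps)
    qed
  qed
  then show ?thesis using \<open>D > 0\<close> by blast
qed

section \<open>Layered polynomials in two variables\<close>

text \<open>
A bivariate polynomial is represented by its layers, \<open>\<Sum>\<^sub>i s\<^sup>i q\<^sub>i(t)\<close>.  Gradients do not see constants, so
layer \<open>0\<close> enters through its derivative.
\<close>

definition layer_size :: "nat \<Rightarrow> (nat \<Rightarrow> real poly) \<Rightarrow> nat \<Rightarrow> real" where
  "layer_size m q i = coeff_norm m (if i = 0 then pderiv (q 0) else q i)"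

definition grad_size :: "nat \<Rightarrow> (nat \<Rightarrow> real poly) \<Rightarrow> real" where
  "grad_size m q = (\<Sum>i\<le>m. layer_size m q i)"

text \<open>
Both partial derivatives of a layered polynomial have this shape, so that one upper bound and one
Lipschitz bound serve for the two of them.  In \<open>dsum_s\<close> the truncated exponent \<open>0 - 1\<close> is harmless because
its layer has the factor \<open>0\<close>.
\<close>

definition layer_sum :: "nat \<Rightarrow> (nat \<Rightarrow> nat) \<Rightarrow> (nat \<Rightarrow> real poly) \<Rightarrow> real \<Rightarrow> real \<Rightarrow> real" where
  "layer_sum m n r s t = (\<Sum>i\<le>m. s ^ n i * poly (r i) t)"

definition dsum_s :: "nat \<Rightarrow> (nat \<Rightarrow> real poly) \<Rightarrow> real \<Rightarrow> real \<Rightarrow> real" where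
  "dsum_s m q = layer_sum m (\<lambda>i. i - 1) (\<lambda>i. smult (real i) (q i))"

definition dsum_t :: "nat \<Rightarrow> (nat \<Rightarrow> real poly) \<Rightarrow> real \<Rightarrow> real \<Rightarrow> real" where
  "dsum_t m q = layer_sum m (\<lambda>i. i) (\<lambda>i. pderiv (q i))"

lemma layer_size_nonneg [simp]: "0 \<le> layer_size m q i"
  by (simp add: layer_size_def)

lemma grad_size_nonneg [simp]: "0 \<le> grad_size m q"
  by (simp add: grad_size_def sum_nonneg)

lemma coeff_norm_pderiv_layer:
  assumes "degree (q i) \<le> m"
  shows "coeff_norm m (pderiv (q i)) \<le> real (m + 1) * layer_size m q i"
proof (cases "i = 0")
  case True
  then show ?thesis
    using mult_right_mono[of 1 "real (m + 1)" "coeff_norm m (pderiv (q 0))"]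
    by (simp add: layer_size_def del: of_nat_add of_nat_Suc)
next
  case False
  have "real m * coeff_norm m (q i) \<le> real (m + 1) * coeff_norm m (q i)"
    by (intro mult_right_mono) auto
  with coeff_norm_pderiv[OF assms] False show ?thesis by (simp add: layer_size_def)
qed

lemma coeff_norm_0 [simp]: "coeff_norm m 0 = 0"
  by (simp add: coeff_norm_def)

lemma coeff_norm_smult_layer:
  assumes "i \<le> m"
  shows "coeff_norm m (smult (real i) (q i)) \<le> real (m + 1) * layer_size m q i"
  using assms by (cases "i = 0") (auto simp: coeff_norm_smult layer_size_def intro!: mult_right_mono)

lemma layer_sum_upper:
  assumes "\<And>i. i \<le> m \<Longrightarrow> degree (r i) \<le> m" "\<bar>s\<bar> \<le> 1" "\<bar>t\<bar> \<le> T" "1 \<le> T"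
  shows "\<bar>layer_sum m n r s t\<bar> \<le> T ^ m * (\<Sum>i\<le>m. coeff_norm m (r i))"
proof -
  have "\<bar>s ^ n i * poly (r i) t\<bar> \<le> T ^ m * coeff_norm m (r i)" if i: "i \<le> m" for i
  proof -
    have "\<bar>s ^ n i\<bar> \<le> 1" unfolding power_abs using assms(2) by (intro power_le_one) auto
    with poly_abs_le[OF assms(1)[OF i] assms(3,4)] show ?thesis
      using mult_mono[of "\<bar>s ^ n i\<bar>" 1 "\<bar>poly (r i) t\<bar>"] by (simp add: abs_mult)
  qed
  then show ?thesis
    unfolding layer_sum_def sum_distrib_left by (intro order.trans[OF sum_abs] sum_mono) auto
qed

lemma layer_sum_lipschitz:
  assumes "\<And>i. i \<le> m \<Longrightarrow> degree (r i) \<le> m" "\<And>i. i \<le> m \<Longrightarrow> n i \<le> m"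
    and "\<bar>s\<bar> \<le> 1" "\<bar>s'\<bar> \<le> 1" "\<bar>t\<bar> \<le> T" "\<bar>t'\<bar> \<le> T" "1 \<le> T"
  shows "\<bar>layer_sum m n r s t - layer_sum m n r s' t'\<bar>
    \<le> real m * T ^ m * (\<Sum>i\<le>m. coeff_norm m (r i)) * (\<bar>s - s'\<bar> + \<bar>t - t'\<bar>)"
proof -
  have "\<bar>s ^ n i * poly (r i) t - s' ^ n i * poly (r i) t'\<bar>
      \<le> real m * T ^ m * coeff_norm m (r i) * (\<bar>s - s'\<bar> + \<bar>t - t'\<bar>)" if i: "i \<le> m" for i
  proof -
    have "\<bar>s ^ n i - s' ^ n i\<bar> \<le> real (n i) * \<bar>s - s'\<bar>"
      using norm_power_diff[of s s' "n i"] assms by simp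
    also have "\<dots> \<le> real m * \<bar>s - s'\<bar>" using assms(2)[OF i] by (intro mult_right_mono) auto
    finally have 1: "\<bar>s ^ n i - s' ^ n i\<bar> \<le> real m * \<bar>s - s'\<bar>" .
    have 2: "\<bar>poly (r i) t\<bar> \<le> T ^ m * coeff_norm m (r i)" by (rule poly_abs_le[OF assms(1)[OF i] assms(5,7)])
    have 3: "\<bar>s' ^ n i\<bar> \<le> 1" unfolding power_abs using assms by (intro power_le_one) auto
    have 4: "\<bar>poly (r i) t - poly (r i) t'\<bar> \<le> T ^ m * (real m * coeff_norm m (r i)) * \<bar>t - t'\<bar>"
      by (rule poly_lipschitz[OF assms(1)[OF i] assms(5-7)])
    have "s ^ n i * poly (r i) t - s' ^ n i * poly (r i) t'
        = (s ^ n i - s' ^ n i) * poly (r i) t + s' ^ n i * (poly (r i) t - poly (r i) t')"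
      by (simp add: algebra_simps)
    also have "\<bar>\<dots>\<bar> \<le> (real m * \<bar>s - s'\<bar>) * (T ^ m * coeff_norm m (r i))
        + 1 * (T ^ m * (real m * coeff_norm m (r i)) * \<bar>t - t'\<bar>)"
      by (rule order.trans[OF abs_triangle_ineq])
         (unfold abs_mult, intro add_mono mult_mono 1 2 3 4, auto)
    finally show ?thesis by (simp add: algebra_simps)
  qed
  then show ?thesis
    unfolding layer_sum_def sum_subtractf[symmetric] sum_distrib_left sum_distrib_right
    by (intro order.trans[OF sum_abs] sum_mono) auto
qed

lemma gradient_layers:
  assumes "\<And>i. degree (q i) \<le> m"
  shows "(\<Sum>i\<le>m. coeff_norm m (smult (real i) (q i))) \<le> real (m + 1) * grad_size m q"
    and "(\<Sum>i\<le>m. coeff_norm m (pderiv (q i))) \<le> real (m + 1) * grad_size m q"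
  unfolding grad_size_def sum_distrib_left
  by (intro sum_mono coeff_norm_smult_layer coeff_norm_pderiv_layer assms; simp)+

lemma dsum_upper:
  assumes deg: "\<And>i. degree (q i) \<le> m" and st: "\<bar>s\<bar> \<le> 1" "\<bar>t\<bar> \<le> T" "1 \<le> T"
  shows "\<bar>dsum_s m q s t\<bar> \<le> real (m + 1) * T ^ m * grad_size m q"
    and "\<bar>dsum_t m q s t\<bar> \<le> real (m + 1) * T ^ m * grad_size m q"
proof -
  have "\<bar>layer_sum m n r s t\<bar> \<le> real (m + 1) * T ^ m * grad_size m q"
    if "\<And>i. degree (r i) \<le> m" "(\<Sum>i\<le>m. coeff_norm m (r i)) \<le> real (m + 1) * grad_size m q" for n r
    using order.trans[OF layer_sum_upper[where r = r and n = n, OF that(1) st] mult_left_mono[OF that(2)]] st(3)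
    by (simp add: mult_ac)
  note * = this
  show "\<bar>dsum_s m q s t\<bar> \<le> real (m + 1) * T ^ m * grad_size m q"
    "\<bar>dsum_t m q s t\<bar> \<le> real (m + 1) * T ^ m * grad_size m q"
    unfolding dsum_s_def dsum_t_def using deg
    by (intro * gradient_layers deg; simp add: degree_pderiv order.trans[OF degree_smult_le] le_diff_conv le_SucI)+
qed

lemma dsum_lipschitz:
  assumes deg: "\<And>i. degree (q i) \<le> m"
    and st: "\<bar>s\<bar> \<le> 1" "\<bar>s'\<bar> \<le> 1" "\<bar>t\<bar> \<le> T" "\<bar>t'\<bar> \<le> T" "1 \<le> T"
  shows "\<bar>dsum_s m q s t - dsum_s m q s' t'\<bar> \<le> (real (m + 1))\<^sup>2 * T ^ m * grad_size m q * (\<bar>s - s'\<bar> + \<bar>t - t'\<bar>)"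
    and "\<bar>dsum_t m q s t - dsum_t m q s' t'\<bar> \<le> (real (m + 1))\<^sup>2 * T ^ m * grad_size m q * (\<bar>s - s'\<bar> + \<bar>t - t'\<bar>)"
proof -
  have "\<bar>layer_sum m n r s t - layer_sum m n r s' t'\<bar> \<le> (real (m + 1))\<^sup>2 * T ^ m * grad_size m q * (\<bar>s - s'\<bar> + \<bar>t - t'\<bar>)"
    if "\<And>i. degree (r i) \<le> m" "\<And>i. i \<le> m \<Longrightarrow> n i \<le> m" "(\<Sum>i\<le>m. coeff_norm m (r i)) \<le> real (m + 1) * grad_size m q" for n r
  proof -
    have "real m * T ^ m * (\<Sum>i\<le>m. coeff_norm m (r i)) \<le> real (m + 1) * T ^ m * (real (m + 1) * grad_size m q)"
      using that(3) st(5) by (intro mult_mono) (auto intro: sum_nonneg)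
    then have "real m * T ^ m * (\<Sum>i\<le>m. coeff_norm m (r i)) \<le> (real (m + 1))\<^sup>2 * T ^ m * grad_size m q"
      by (simp only: power2_eq_square mult_ac)
    then show ?thesis
      using order.trans[OF layer_sum_lipschitz[where r = r and n = n, OF that(1,2) st] mult_right_mono] by simp
  qed
  note * = this
  show "\<bar>dsum_s m q s t - dsum_s m q s' t'\<bar> \<le> (real (m + 1))\<^sup>2 * T ^ m * grad_size m q * (\<bar>s - s'\<bar> + \<bar>t - t'\<bar>)"
    "\<bar>dsum_t m q s t - dsum_t m q s' t'\<bar> \<le> (real (m + 1))\<^sup>2 * T ^ m * grad_size m q * (\<bar>s - s'\<bar> + \<bar>t - t'\<bar>)"
    unfolding dsum_s_def dsum_t_def using deg
    by (intro * gradient_layers deg; simp add: degree_pderiv order.trans[OF degree_smult_le] le_diff_conv le_SucI)+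
qed

text \<open>
Apply \<open>coeff_norm_le_sup\<close> in \<open>s\<close> for fixed \<open>t\<close>, which bounds the values \<open>i q\<^sub>i(t)\<close> and \<open>q\<^sub>0'(t)\<close>, and then in
\<open>t\<close>.
\<close>

lemma grad_size_le_sup:
  fixes T \<delta> :: real
  assumes "0 < \<delta>" "0 \<le> T"
  shows "\<exists>C>0. \<forall>q s0 t0 B. (\<forall>i. degree (q i) \<le> m) \<longrightarrow> \<bar>s0\<bar> \<le> T \<longrightarrow> \<bar>t0\<bar> \<le> T \<longrightarrow>
     (\<forall>s\<in>{s0..s0+\<delta>}. \<forall>t\<in>{t0..t0+\<delta>}. \<bar>dsum_s m q s t\<bar> \<le> B \<and> \<bar>dsum_t m q s t\<bar> \<le> B) \<longrightarrow>
     grad_size m q \<le> C * B"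
proof -
  obtain C where "C > 0" and C: "\<And>q a B. degree q \<le> m \<Longrightarrow> \<bar>a\<bar> \<le> T \<Longrightarrow>
      (\<forall>x\<in>{a..a+\<delta>}. \<bar>poly q x\<bar> \<le> B) \<Longrightarrow> coeff_norm m q \<le> C * B"
    using coeff_norm_le_sup[OF assms, of m] by auto
  have coeff_le: "\<bar>coeff u k\<bar> \<le> coeff_norm m u" if "k \<le> m" for u :: "real poly" and k
    unfolding coeff_norm_def by (rule member_le_sum) (use that in auto)
  show ?thesis
  proof (intro exI[of _ "real (m + 1) * (C * C)"] conjI allI impI)
    show "0 < real (m + 1) * (C * C)" using \<open>C > 0\<close> by simp
    fix q :: "nat \<Rightarrow> real poly" and s0 t0 B
    assume deg: "\<forall>i. degree (q i) \<le> m" and s0: "\<bar>s0\<bar> \<le> T" and t0: "\<bar>t0\<bar> \<le> T"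
      and B: "\<forall>s\<in>{s0..s0+\<delta>}. \<forall>t\<in>{t0..t0+\<delta>}. \<bar>dsum_s m q s t\<bar> \<le> B \<and> \<bar>dsum_t m q s t\<bar> \<le> B"
    have "layer_size m q i \<le> C * (C * B)" if i: "i \<le> m" for i
    proof (cases "i = 0")
      case True
      have "\<bar>poly (pderiv (q 0)) t\<bar> \<le> C * B" if t: "t \<in> {t0..t0+\<delta>}" for t
      proof -
        define v where "v = (\<Sum>i\<le>m. monom (poly (pderiv (q i)) t) i)"
        have "poly v s = dsum_t m q s t" for s
          by (simp add: v_def dsum_t_def layer_sum_def poly_sum poly_monom mult.commute)
        moreover have "degree v \<le> m"
          unfolding v_def by (intro degree_sum_le) (auto intro: order.trans[OF degree_monom_le])
        ultimately have "coeff_norm m v \<le> C * B" using B t s0 by (intro C[of v s0]) auto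
        moreover have "coeff v 0 = poly (pderiv (q 0)) t"
          by (simp add: v_def coeff_sum)
        ultimately show ?thesis using coeff_le[of 0 v] by simp
      qed
      then have "coeff_norm m (pderiv (q 0)) \<le> C * (C * B)"
        using t0 deg[rule_format, of 0] by (intro C[of _ t0]) (auto simp: degree_pderiv)
      with True show ?thesis by (simp add: layer_size_def)
    next
      case False
      have "\<bar>poly (q i) t\<bar> \<le> C * B" if t: "t \<in> {t0..t0+\<delta>}" for t
      proof -
        define v where "v = (\<Sum>i\<le>m. monom (real i * poly (q i) t) (i - 1))"
        have "poly v s = dsum_s m q s t" for s
          by (simp add: v_def dsum_s_def layer_sum_def poly_sum poly_monom mult_ac)
        moreover have "degree v \<le> m"
          unfolding v_def by (intro degree_sum_le) (auto intro: order.trans[OF degree_monom_le])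
        ultimately have "coeff_norm m v \<le> C * B" using B t s0 by (intro C[of v s0]) auto
        moreover have "coeff v (i - 1) = (\<Sum>k\<le>m. if k = i then real i * poly (q i) t else 0)"
          unfolding v_def coeff_sum by (intro sum.cong) (use False in auto)
        then have "coeff v (i - 1) = real i * poly (q i) t" using False i by simp
        moreover have "\<bar>coeff v (i - 1)\<bar> \<le> coeff_norm m v" using i by (intro coeff_le) auto
        ultimately have "real i * \<bar>poly (q i) t\<bar> \<le> C * B" by (simp add: abs_mult)
        moreover have "1 * \<bar>poly (q i) t\<bar> \<le> real i * \<bar>poly (q i) t\<bar>"
          using False by (intro mult_right_mono) auto
        ultimately show ?thesis by linarith
      qed
      then have "coeff_norm m (q i) \<le> C * (C * B)"
        using t0 deg by (intro C[of _ t0]) auto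
      with False show ?thesis by (simp add: layer_size_def)
    qed
    then have "grad_size m q \<le> (\<Sum>i\<le>m. C * (C * B))" unfolding grad_size_def by (intro sum_mono) auto
    then show "grad_size m q \<le> real (m + 1) * (C * C) * B" by (simp add: mult_ac)
  qed
qed

lemma Q_poly_scaled:
  assumes "p \<in> Q_poly m" "h \<noteq> 0"
  obtains q where "\<And>i. degree (q i) \<le> m"
    and "\<And>\<eta> \<xi>. p (\<eta>, \<xi>) = (\<Sum>i\<le>m. (\<eta> / h) ^ i * poly (q i) ((\<xi> - \<xi>0) / h))"
proof -
  obtain c where c: "\<And>\<eta> \<xi>. p (\<eta>, \<xi>) = (\<Sum>i\<le>m. \<Sum>j\<le>m. c i j * \<eta> ^ i * \<xi> ^ j)"
    using assms(1) by (auto simp: Q_poly_def)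
  define q where "q i = smult (h ^ i) (pcompose (\<Sum>j\<le>m. monom (c i j) j) [:\<xi>0, h:])" for i
  have "degree (\<Sum>j\<le>m. monom (c i j) j) \<le> m" for i
    by (intro degree_sum_le) (auto intro: order.trans[OF degree_monom_le])
  then have deg: "degree (q i) \<le> m" for i
    unfolding q_def using assms(2) by (simp add: degree_pcompose)
  have "p (\<eta>, \<xi>) = (\<Sum>i\<le>m. (\<eta> / h) ^ i * poly (q i) ((\<xi> - \<xi>0) / h))" for \<eta> \<xi>
    unfolding c q_def using assms(2)
    by (simp add: poly_pcompose poly_sum poly_monom sum_distrib_left power_divide mult_ac)
  with deg show thesis by (rule that)
qed

section \<open>Taylor coefficients of the Frenet Laplacian\<close>

text \<open>
The conditions on \<open>\<partial>\<^sub>\<eta>\<^sup>j \<L>\<close> at \<open>\<eta> = 0\<close> are read off from a power series in \<open>\<eta>\<close>, with \<open>\<xi>\<close> frozen: all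
coefficients of the operator are rational in \<open>\<eta>\<close>.
\<close>

lemma has_fps_expansion_higher_deriv:
  fixes f :: "real \<Rightarrow> real"
  assumes "f has_fps_expansion F"
  shows "(deriv ^^ n) f 0 = fact n * fps_nth F n"
proof -
  have "(deriv ^^ n) f has_fps_expansion (fps_deriv ^^ n) F" for n
    using assms by (induction n) (auto intro!: has_fps_expansion_deriv)
  from this[of n] have "eventually (\<lambda>z. eval_fps ((fps_deriv ^^ n) F) z = (deriv ^^ n) f z) (nhds 0)"
    by (simp add: has_fps_expansion_def)
  then have "(deriv ^^ n) f 0 = fps_nth ((fps_deriv ^^ n) F) 0"
    by (auto dest: eventually_nhds_x_imp_x simp: eval_fps_at_0)
  then show ?thesis by (simp add: fps_0th_higher_deriv)
qed

lemma d_eta_funpow: "(d_eta ^^ j) v (\<eta>, \<xi>) = (deriv ^^ j) (\<lambda>s. v (s, \<xi>)) \<eta>"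
proof (induction j arbitrary: v)
  case (Suc j)
  have "(d_eta ^^ Suc j) v (\<eta>, \<xi>) = (d_eta ^^ j) (d_eta v) (\<eta>, \<xi>)" by (simp add: funpow_swap1)
  also have "\<dots> = (deriv ^^ j) (\<lambda>s. d_eta v (s, \<xi>)) \<eta>" by (rule Suc.IH)
  also have "(\<lambda>s. d_eta v (s, \<xi>)) = deriv (\<lambda>s. v (s, \<xi>))" by (auto simp: d_eta_def)
  also have "(deriv ^^ j) (deriv (\<lambda>s. v (s, \<xi>))) \<eta> = (deriv ^^ Suc j) (\<lambda>s. v (s, \<xi>)) \<eta>"
    by (simp add: funpow_swap1)
  finally show ?case .
qed simp

text \<open>
The Taylor coefficients of \<open>(1 + c \<eta>)\<^sup>-\<^sup>k\<close>.  They are continuous in \<open>c\<close>, hence bounded for curvatures in a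
bounded range.
\<close>

definition geom_coeff :: "nat \<Rightarrow> nat \<Rightarrow> real \<Rightarrow> real" where
  "geom_coeff k n c = fps_nth (inverse (1 + fps_const c * fps_X) ^ k) n"

lemma continuous_on_geom_coeff: "continuous_on UNIV (geom_coeff k n)"
proof (induction k arbitrary: n)
  case 0
  show ?case by (cases "n = 0") (simp_all add: geom_coeff_def)
next
  case (Suc k)
  have inv: "inverse (1 + fps_const c * fps_X) = Abs_fps (\<lambda>n. (-c) ^ n)" for c :: real
  proof -
    have "(1 + fps_const c * fps_X) * Abs_fps (\<lambda>n. (-c) ^ n) = 1"
      by (rule fps_ext) (auto simp: algebra_simps fps_X_mult_nth power_eq_if)
    then show ?thesis by (simp add: fps_inverse_unique)
  qed
  have "geom_coeff (Suc k) n = (\<lambda>c. \<Sum>i=0..n. (-c) ^ i * geom_coeff k (n - i) c)"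
    by (rule ext) (simp add: geom_coeff_def fps_mult_nth inv)
  then show ?case using Suc by (auto intro!: continuous_intros)
qed

lemma geom_coeff_bounded:
  "\<exists>M>0. \<forall>k\<le>3. \<forall>n\<le>m. \<forall>c. \<bar>c\<bar> \<le> B \<longrightarrow> \<bar>geom_coeff k n c\<bar> \<le> M"
proof -
  have "\<exists>M. \<forall>c. \<bar>c\<bar> \<le> B \<longrightarrow> \<bar>geom_coeff k n c\<bar> \<le> M" for k n
  proof -
    have "bounded (geom_coeff k n ` {-B..B})"
      by (intro compact_imp_bounded compact_continuous_image
            continuous_on_subset[OF continuous_on_geom_coeff]) auto
    then obtain M where "\<forall>x\<in>geom_coeff k n ` {-B..B}. norm x \<le> M" by (auto simp: bounded_iff)
    then show ?thesis by (intro exI[of _ M]) (auto simp: abs_le_iff)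
  qed
  then obtain M where M: "\<And>k n c. \<bar>c\<bar> \<le> B \<Longrightarrow> \<bar>geom_coeff k n c\<bar> \<le> M k n" by metis
  have "\<bar>geom_coeff k n c\<bar> \<le> (\<Sum>k\<le>3. \<Sum>n\<le>m. \<bar>M k n\<bar>) + 1" if "k \<le> 3" "n \<le> m" "\<bar>c\<bar> \<le> B" for k n c
  proof -
    have "\<bar>geom_coeff k n c\<bar> \<le> \<bar>M k n\<bar>" using M[OF that(3), of k n] by linarith
    also have "\<dots> \<le> (\<Sum>n\<le>m. \<bar>M k n\<bar>)" by (rule member_le_sum) (use that in auto)
    also have "\<dots> \<le> (\<Sum>k\<le>3. \<Sum>n\<le>m. \<bar>M k n\<bar>)"
      by (rule member_le_sum[where f = "\<lambda>k. \<Sum>n\<le>m. \<bar>M k n\<bar>"]) (use that in \<open>auto intro: sum_nonneg\<close>)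
    finally show ?thesis by simp
  qed
  then show ?thesis
    by (intro exI[of _ "(\<Sum>k\<le>3. \<Sum>n\<le>m. \<bar>M k n\<bar>) + 1"]) (auto intro!: add_nonneg_pos sum_nonneg)
qed

text \<open>
Layers that are arbitrary functions of \<open>\<xi>\<close>.  The operator is computed in this generality because the
rescaling of the polynomials is then irrelevant.
\<close>

definition layered :: "nat \<Rightarrow> (nat \<Rightarrow> real \<Rightarrow> real) \<Rightarrow> plane \<Rightarrow> real" where
  "layered m Q = (\<lambda>(\<eta>, \<xi>). \<Sum>i\<le>m. \<eta> ^ i * Q i \<xi>)"

lemma d_eta_layered: "d_eta (layered m Q) (\<eta>, \<xi>) = (\<Sum>i\<le>m. real i * \<eta> ^ (i - 1) * Q i \<xi>)"
  unfolding d_eta_def layered_def prod.case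
  by (rule DERIV_imp_deriv) (auto intro!: derivative_eq_intros)

lemma d_eta_d_eta_layered:
  "d_eta (d_eta (layered m Q)) (\<eta>, \<xi>) = (\<Sum>i\<le>m. real i * (real (i - 1) * \<eta> ^ (i - 2)) * Q i \<xi>)"
proof -
  have "d_eta (d_eta (layered m Q)) (\<eta>, \<xi>) = deriv (\<lambda>s. \<Sum>i\<le>m. real i * s ^ (i - 1) * Q i \<xi>) \<eta>"
    by (subst d_eta_def) (simp add: d_eta_layered)
  also have "\<dots> = (\<Sum>i\<le>m. real i * (real (i - 1) * \<eta> ^ (i - 2)) * Q i \<xi>)"
    by (rule DERIV_imp_deriv)
       (auto intro!: derivative_eq_intros sum.cong simp: numeral_2_eq_2 diff_diff_left)
  finally show ?thesis .
qed

lemma d_xi_layered: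
  assumes "\<And>i. (Q i has_real_derivative Q1 i \<xi>) (at \<xi>)"
  shows "d_xi (layered m Q) (\<eta>, \<xi>) = (\<Sum>i\<le>m. \<eta> ^ i * Q1 i \<xi>)"
  unfolding d_xi_def layered_def prod.case
  by (rule DERIV_imp_deriv) (auto intro!: derivative_eq_intros assms simp: mult.commute)

lemma frenet_laplacian_layered:
  fixes Q Q1 Q2 :: "nat \<Rightarrow> real \<Rightarrow> real"
  assumes Q1: "\<And>i \<xi>. (Q i has_real_derivative Q1 i \<xi>) (at \<xi>)"
    and Q2: "\<And>i \<xi>. (Q1 i has_real_derivative Q2 i \<xi>) (at \<xi>)"
    and w: "((\<lambda>t. 1 / norm (vderiv g t)) has_real_derivative w') (at \<xi>)"
    and k: "(curvature g has_real_derivative k') (at \<xi>)"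
    and nz: "1 + \<eta> * curvature g \<xi> \<noteq> 0"
  defines "w \<equiv> 1 / norm (vderiv g \<xi>)" and "u \<equiv> inverse (1 + curvature g \<xi> * \<eta>)"
  shows "frenet_laplacian g (layered m Q) (\<eta>, \<xi>) =
    (\<Sum>i\<le>m. real i * (real (i - 1) * \<eta> ^ (i - 2)) * Q i \<xi>
      + curvature g \<xi> * real i * Q i \<xi> * (\<eta> ^ (i - 1) * u)
      + (w\<^sup>2 * Q2 i \<xi> + w * w' * Q1 i \<xi>) * (\<eta> ^ i * u ^ 2)
      - w\<^sup>2 * k' * Q1 i \<xi> * (\<eta> ^ (i + 1) * u ^ 3))"
proof -
  define W where "W t = 1 / norm (vderiv g t)" for t
  have W: "(W has_real_derivative w') (at \<xi>)" "W \<xi> = w"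
    using w by (simp_all add: W_def[abs_def] w_def)
  have jac: "1 / frenet_jac g (a, t) = W t * inverse (1 + a * curvature g t)" for a t
    by (simp add: frenet_jac_def W_def field_simps)
  have u: "inverse (1 + \<eta> * curvature g \<xi>) = u" by (simp add: u_def mult.commute)
  have dx: "d_xi (layered m Q) (a, t) = (\<Sum>i\<le>m. a ^ i * Q1 i t)" for a t
    by (rule d_xi_layered) (rule Q1)
  have inner: "(\<lambda>z. 1 / frenet_jac g z * d_xi (layered m Q) z) =
      (\<lambda>(a, t). W t * inverse (1 + a * curvature g t) * (\<Sum>i\<le>m. a ^ i * Q1 i t))"
    unfolding fun_eq_iff split_paired_All prod.case jac dx by simp
  have "((\<lambda>t. W t * inverse (1 + \<eta> * curvature g t) * (\<Sum>i\<le>m. \<eta> ^ i * Q1 i t))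
      has_real_derivative ((w' * u - w * (\<eta> * k') * u\<^sup>2) * (\<Sum>i\<le>m. \<eta> ^ i * Q1 i \<xi>)
        + w * u * (\<Sum>i\<le>m. \<eta> ^ i * Q2 i \<xi>))) (at \<xi>)"
    using nz
    by (auto intro!: derivative_eq_intros W(1) k Q2 simp: u W(2))
       (simp add: algebra_simps power2_eq_square u)
  then have "d_xi (\<lambda>z. 1 / frenet_jac g z * d_xi (layered m Q) z) (\<eta>, \<xi>) =
      (w' * u - w * (\<eta> * k') * u\<^sup>2) * (\<Sum>i\<le>m. \<eta> ^ i * Q1 i \<xi>) + w * u * (\<Sum>i\<le>m. \<eta> ^ i * Q2 i \<xi>)"
    unfolding inner unfolding d_xi_def prod.case by (rule DERIV_imp_deriv)
  then have "frenet_laplacian g (layered m Q) (\<eta>, \<xi>) =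
      (\<Sum>i\<le>m. real i * (real (i - 1) * \<eta> ^ (i - 2)) * Q i \<xi>)
      + curvature g \<xi> * u * (\<Sum>i\<le>m. real i * \<eta> ^ (i - 1) * Q i \<xi>)
      + w * u * ((w' * u - w * (\<eta> * k') * u\<^sup>2) * (\<Sum>i\<le>m. \<eta> ^ i * Q1 i \<xi>)
         + w * u * (\<Sum>i\<le>m. \<eta> ^ i * Q2 i \<xi>))"
    unfolding frenet_laplacian_def prod.case d_eta_d_eta_layered d_eta_layered jac u W(2)
    by (simp add: divide_inverse u)
  also have "\<dots> = (\<Sum>i\<le>m. real i * (real (i - 1) * \<eta> ^ (i - 2)) * Q i \<xi>
      + curvature g \<xi> * u * (real i * \<eta> ^ (i - 1) * Q i \<xi>)
      + w * u * ((w' * u - w * (\<eta> * k') * u\<^sup>2) * (\<eta> ^ i * Q1 i \<xi>) + w * u * (\<eta> ^ i * Q2 i \<xi>)))"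
    by (simp add: sum.distrib sum_distrib_left distrib_left)
  also have "\<dots> = (\<Sum>i\<le>m. real i * (real (i - 1) * \<eta> ^ (i - 2)) * Q i \<xi>
      + curvature g \<xi> * real i * Q i \<xi> * (\<eta> ^ (i - 1) * u)
      + (w\<^sup>2 * Q2 i \<xi> + w * w' * Q1 i \<xi>) * (\<eta> ^ i * u ^ 2)
      - w\<^sup>2 * k' * Q1 i \<xi> * (\<eta> ^ (i + 1) * u ^ 3))"
    by (rule sum.cong[OF refl]) (simp add: algebra_simps power2_eq_square power3_eq_cube)
  finally show ?thesis .
qed

text \<open>
Everything in the \<open>j\<close>-th Taylor coefficient of \<open>\<L>\<close> at \<open>\<eta> = 0\<close> apart from the contribution of layer
\<open>j + 2\<close>; here \<open>Q1\<close>, \<open>Q2\<close> are the first and second \<open>\<xi>\<close>-derivatives of the layers, \<open>w'\<close> is the derivative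
of the inverse speed \<open>1/\<parallel>g'\<parallel>\<close> and \<open>k'\<close> that of the curvature.  The tangential part of \<open>\<L>\<close> does not lower the
power of \<open>\<eta>\<close>, so second derivatives occur only for layers up to \<open>j\<close>.
\<close>

definition lower_terms ::
  "(real \<Rightarrow> plane) \<Rightarrow> (real \<Rightarrow> real) \<Rightarrow> (real \<Rightarrow> real) \<Rightarrow> (nat \<Rightarrow> real \<Rightarrow> real) \<Rightarrow> (nat \<Rightarrow> real \<Rightarrow> real) \<Rightarrow> (nat \<Rightarrow> real \<Rightarrow> real)
     \<Rightarrow> nat \<Rightarrow> real \<Rightarrow> real" where
  "lower_terms g w' k' Q Q1 Q2 j \<xi> = (let w = 1 / norm (vderiv g \<xi>); k = curvature g \<xi> in
     \<Sum>i\<le>j + 1. k * real i * Q i \<xi> * geom_coeff 1 (j + 1 - i) k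
       + (if i \<le> j then (w\<^sup>2 * Q2 i \<xi> + w * w' \<xi> * Q1 i \<xi>) * geom_coeff 2 (j - i) k else 0)
       - (if i + 1 \<le> j then w\<^sup>2 * k' \<xi> * Q1 i \<xi> * geom_coeff 3 (j - (i + 1)) k else 0))"

text \<open>
The triangular structure behind the extension estimate: layer \<open>j + 2\<close> appears with the constant factor
\<open>(j + 2)!\<close>, all other contributions come from lower layers.
\<close>

lemma deriv_frenet_laplacian_layered:
  fixes Q Q1 Q2 :: "nat \<Rightarrow> real \<Rightarrow> real"
  assumes Q1: "\<And>i \<xi>. (Q i has_real_derivative Q1 i \<xi>) (at \<xi>)"
    and Q2: "\<And>i \<xi>. (Q1 i has_real_derivative Q2 i \<xi>) (at \<xi>)"
    and w: "((\<lambda>t. 1 / norm (vderiv g t)) has_real_derivative w' \<xi>) (at \<xi>)"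
    and k: "(curvature g has_real_derivative k' \<xi>) (at \<xi>)"
    and j: "j + 2 \<le> m"
  shows "(d_eta ^^ j) (frenet_laplacian g (layered m Q)) (0, \<xi>) =
    fact j * (real (j + 2) * real (j + 1) * Q (j + 2) \<xi> + lower_terms g w' k' Q Q1 Q2 j \<xi>)"
proof -
  define \<kappa> where "\<kappa> = curvature g \<xi>"
  define ww where "ww = 1 / norm (vderiv g \<xi>)"
  define A1 A2 A3 where "A1 i = \<kappa> * real i * Q i \<xi>"
    and "A2 i = ww\<^sup>2 * Q2 i \<xi> + ww * w' \<xi> * Q1 i \<xi>" and "A3 i = ww\<^sup>2 * k' \<xi> * Q1 i \<xi>" for i
  define B1 B2 B3 where "B1 i = (if i \<le> j + 1 then A1 i * geom_coeff 1 (j + 1 - i) \<kappa> else 0)"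
    and "B2 i = (if i \<le> j then A2 i * geom_coeff 2 (j - i) \<kappa> else 0)"
    and "B3 i = (if i + 1 \<le> j then A3 i * geom_coeff 3 (j - (i + 1)) \<kappa> else 0)" for i
  define U where "U = inverse (1 + fps_const \<kappa> * fps_X)"
  \<comment> \<open>\<open>G i\<close> is the expansion of the contribution of layer \<open>i\<close>; \<open>U\<close> is that of \<open>1 / (1 + \<kappa> \<eta>)\<close>.\<close>
  define G where "G i = fps_const (real i * real (i - 1) * Q i \<xi>) * fps_X ^ (i - 2)
      + fps_const (A1 i) * (fps_X ^ (i - 1) * U)
      + fps_const (A2 i) * (fps_X ^ i * (U * U))
      - fps_const (A3 i) * (fps_X ^ (i + 1) * (U * (U * U)))" for i
  define L where "L \<eta> = frenet_laplacian g (layered m Q) (\<eta>, \<xi>)" for \<eta>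
  define f where "f \<eta> = (\<Sum>i\<le>m. real i * real (i - 1) * Q i \<xi> * \<eta> ^ (i - 2)
      + A1 i * (\<eta> ^ (i - 1) * inverse (1 + \<kappa> * \<eta>))
      + A2 i * (\<eta> ^ i * (inverse (1 + \<kappa> * \<eta>) * inverse (1 + \<kappa> * \<eta>)))
      - A3 i * (\<eta> ^ (i + 1) * (inverse (1 + \<kappa> * \<eta>) * (inverse (1 + \<kappa> * \<eta>) * inverse (1 + \<kappa> * \<eta>)))))"
    for \<eta>
  have U: "(\<lambda>\<eta>. inverse (1 + \<kappa> * \<eta>)) has_fps_expansion U"
    unfolding U_def by (intro fps_expansion_intros) auto
  have "f has_fps_expansion (\<Sum>i\<le>m. G i)"
    unfolding f_def G_def by (intro fps_expansion_intros U)
  moreover have "eventually (\<lambda>\<eta>. f \<eta> = L \<eta>) (nhds 0)"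
  proof -
    have "((\<lambda>\<eta>. 1 + \<eta> * \<kappa>) \<longlongrightarrow> 1 + 0 * \<kappa>) (nhds 0)"
      by (intro tendsto_intros filterlim_ident)
    then have "eventually (\<lambda>\<eta>. 1 + \<eta> * \<kappa> \<noteq> 0) (nhds 0)"
      by (rule tendsto_imp_eventually_ne) simp
    then show ?thesis
    proof eventually_elim
      case (elim \<eta>)
      show ?case
        unfolding f_def L_def
        by (subst frenet_laplacian_layered[OF Q1 Q2 w k])
          (use elim in \<open>simp_all add: \<kappa>_def ww_def A1_def A2_def A3_def power2_eq_square power3_eq_cube mult_ac\<close>)
    qed
  qed
  ultimately have "L has_fps_expansion (\<Sum>i\<le>m. G i)"
    unfolding has_fps_expansion_def by (auto elim: eventually_elim2)
  then have "(deriv ^^ j) L 0 = fact j * fps_nth (\<Sum>i\<le>m. G i) j"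
    by (rule has_fps_expansion_higher_deriv)
  also have "fps_nth (\<Sum>i\<le>m. G i) j = (\<Sum>i\<le>m. fps_nth (G i) j)" by (simp add: fps_sum_nth)
  also have "\<dots> = (\<Sum>i\<le>m. (if i = j + 2 then real (j + 2) * real (j + 1) * Q (j + 2) \<xi> else 0)
      + B1 i + B2 i - B3 i)"
  proof (rule sum.cong[OF refl])
    fix i
    have 1: "fps_nth (fps_const (real i * real (i - 1) * Q i \<xi>) * fps_X ^ (i - 2)) j
        = (if i = j + 2 then real (j + 2) * real (j + 1) * Q (j + 2) \<xi> else 0)"
    proof (cases "2 \<le> i")
      case True then show ?thesis by (auto simp: fps_X_power_nth)
    next
      case False then have "i = 0 \<or> i = 1" by auto
      then show ?thesis by auto
    qed
    have 2: "fps_nth (fps_const (A1 i) * (fps_X ^ (i - 1) * U)) j = B1 i"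
    proof (cases "i = 0")
      case True then show ?thesis by (simp add: A1_def B1_def)
    next
      case False
      then have "j - (i - 1) = j + 1 - i" "(j < i - 1) = (\<not> i \<le> j + 1)" by auto
      then show ?thesis by (simp add: fps_X_power_mult_nth geom_coeff_def U_def B1_def)
    qed
    have 3: "fps_nth (fps_const (A2 i) * (fps_X ^ i * (U * U))) j = B2 i"
      unfolding B2_def geom_coeff_def U_def power2_eq_square[of "inverse _ :: real fps"] fps_mult_left_const_nth fps_X_power_mult_nth
      by (simp add: not_less)
    have 4: "fps_nth (fps_const (A3 i) * (fps_X ^ (i + 1) * (U * (U * U)))) j = B3 i"
      unfolding B3_def geom_coeff_def U_def power3_eq_cube[of "inverse _ :: real fps"] fps_mult_left_const_nth fps_X_power_mult_nth mult.assoc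
      by (simp add: not_less)
    show "fps_nth (G i) j = (if i = j + 2 then real (j + 2) * real (j + 1) * Q (j + 2) \<xi> else 0)
      + B1 i + B2 i - B3 i"
      unfolding G_def fps_add_nth fps_sub_nth by (simp only: 1 2 3 4)
  qed
  also have "\<dots> = (\<Sum>i\<le>m. (if i = j + 2 then real (j + 2) * real (j + 1) * Q (j + 2) \<xi> else 0))
      + (\<Sum>i\<le>m. B1 i + B2 i - B3 i)"
    (is "_ = _ + ?S") by (simp only: sum.distrib[symmetric] add.assoc add_diff_eq)
  also have "?S = (\<Sum>i\<le>j + 1. B1 i + B2 i - B3 i)"
    by (rule sum.mono_neutral_right) (use j in \<open>auto simp: B1_def B2_def B3_def\<close>)
  also have "\<dots> = lower_terms g w' k' Q Q1 Q2 j \<xi>"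
    unfolding lower_terms_def Let_def \<kappa>_def[symmetric] ww_def[symmetric]
    by (rule sum.cong) (auto simp: A1_def A2_def A3_def B1_def B2_def B3_def)
  also have "(\<Sum>i\<le>m. (if i = j + 2 then real (j + 2) * real (j + 1) * Q (j + 2) \<xi> else 0))
      = real (j + 2) * real (j + 1) * Q (j + 2) \<xi>"
    using j by simp
  finally show ?thesis unfolding d_eta_funpow L_def .
qed

section \<open>The extension estimate\<close>

text \<open>
If a polynomial has the layers \<open>q\<close> in the variables \<open>s = \<eta>/h\<close>, \<open>t = (\<xi> - \<xi>0)/h\<close>, these are its layers in
\<open>(\<eta>, \<xi>)\<close>.
\<close>

definition scaled_layer :: "real \<Rightarrow> real \<Rightarrow> (nat \<Rightarrow> real poly) \<Rightarrow> nat \<Rightarrow> real \<Rightarrow> real" where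
  "scaled_layer h \<xi>0 q i \<xi> = poly (q i) ((\<xi> - \<xi>0) / h) / h ^ i"

definition scaled_poly :: "nat \<Rightarrow> real \<Rightarrow> real \<Rightarrow> (nat \<Rightarrow> real poly) \<Rightarrow> plane \<Rightarrow> real" where
  "scaled_poly m h \<xi>0 q = layered m (scaled_layer h \<xi>0 q)"

lemma scaled_poly_eq:
  "scaled_poly m h \<xi>0 q (\<eta>, \<xi>) = (\<Sum>i\<le>m. (\<eta> / h) ^ i * poly (q i) ((\<xi> - \<xi>0) / h))"
  by (simp add: scaled_poly_def layered_def scaled_layer_def power_divide)

definition scaled_layer' :: "real \<Rightarrow> real \<Rightarrow> (nat \<Rightarrow> real poly) \<Rightarrow> nat \<Rightarrow> real \<Rightarrow> real" where
  "scaled_layer' h \<xi>0 q i \<xi> = poly (pderiv (q i)) ((\<xi> - \<xi>0) / h) / h ^ (i + 1)"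

definition scaled_layer'' :: "real \<Rightarrow> real \<Rightarrow> (nat \<Rightarrow> real poly) \<Rightarrow> nat \<Rightarrow> real \<Rightarrow> real" where
  "scaled_layer'' h \<xi>0 q i \<xi> = poly (pderiv (pderiv (q i))) ((\<xi> - \<xi>0) / h) / h ^ (i + 2)"

lemma DERIV_scaled_poly_arg:
  fixes h :: real
  assumes "h \<noteq> 0"
  shows "((\<lambda>\<xi>. poly p ((\<xi> - \<xi>0) / h) / h ^ n) has_real_derivative poly (pderiv p) ((\<xi> - \<xi>0) / h) / h ^ (n + 1)) (at \<xi>)"
  using assms
  by (auto intro!: derivative_eq_intros DERIV_chain2[OF poly_DERIV] simp: field_simps)

lemma DERIV_scaled_layer:
  assumes "h \<noteq> 0"
  shows "(scaled_layer h \<xi>0 q i has_real_derivative scaled_layer' h \<xi>0 q i \<xi>) (at \<xi>)"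
  using DERIV_scaled_poly_arg[OF assms, of "q i" \<xi>0 i] by (simp add: scaled_layer_def[abs_def] scaled_layer'_def)

lemma DERIV_scaled_layer':
  assumes "h \<noteq> 0"
  shows "(scaled_layer' h \<xi>0 q i has_real_derivative scaled_layer'' h \<xi>0 q i \<xi>) (at \<xi>)"
  using DERIV_scaled_poly_arg[OF assms, of "pderiv (q i)" \<xi>0 "i + 1"]
  by (simp add: scaled_layer'_def[abs_def] scaled_layer''_def)

definition scaled_lower where
  "scaled_lower g w' k' h \<xi>0 q = lower_terms g w' k' (scaled_layer h \<xi>0 q) (scaled_layer' h \<xi>0 q) (scaled_layer'' h \<xi>0 q)"

lemma scaled_lower_diff_smult:
  "scaled_lower g w' k' h \<xi>0 (\<lambda>i. p i - smult r (q i)) j \<xi>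
     = scaled_lower g w' k' h \<xi>0 p j \<xi> - r * scaled_lower g w' k' h \<xi>0 q j \<xi>"
  unfolding scaled_lower_def lower_terms_def Let_def scaled_layer_def scaled_layer'_def scaled_layer''_def
    sum_distrib_left sum_subtractf[symmetric]
  by (rule sum.cong) (auto simp: pderiv_diff pderiv_smult algebra_simps diff_divide_distrib add_divide_distrib)

text \<open>
A power count: layer \<open>i\<close> carries the factor \<open>h\<^sup>-\<^sup>i\<close> and each \<open>\<xi>\<close>-derivative one more \<open>h\<^sup>-\<^sup>1\<close>.  The terms
without derivative come from layers up to \<open>j + 1\<close>, those with one or two derivatives from layers up to \<open>j\<close>, so
no power worse than \<open>h\<^sup>-\<^sup>(\<^sup>j\<^sup>+\<^sup>2\<^sup>)\<close> occurs.
\<close>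

lemma scaled_lower_bound:
  fixes B T :: real
  assumes "1 \<le> T" "0 \<le> B"
  shows "\<exists>C>0. \<forall>w' k' h \<xi>0 q j \<xi>. (\<forall>i. degree (q i) \<le> m) \<longrightarrow> j + 2 \<le> m \<longrightarrow> 0 < h \<longrightarrow> h \<le> 1 \<longrightarrow> \<bar>(\<xi> - \<xi>0) / h\<bar> \<le> T \<longrightarrow>
    \<bar>curvature g \<xi>\<bar> \<le> B \<longrightarrow> 1 / norm (vderiv g \<xi>) \<le> B \<longrightarrow> \<bar>w' \<xi>\<bar> \<le> B \<longrightarrow> \<bar>k' \<xi>\<bar> \<le> B \<longrightarrow>
    h ^ (j + 2) * \<bar>scaled_lower g w' k' h \<xi>0 q j \<xi>\<bar> \<le> C * (\<Sum>i\<le>j + 1. layer_size m q i)"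
proof -
  obtain M where "M > 0" and M: "\<And>k n c. k \<le> 3 \<Longrightarrow> n \<le> m \<Longrightarrow> \<bar>c\<bar> \<le> B \<Longrightarrow> \<bar>geom_coeff k n c\<bar> \<le> M"
    using geom_coeff_bounded[of m B] by blast
  define A where "A = T ^ m * (real (m + 1))\<^sup>2"
  have A: "0 < A" using assms by (simp add: A_def)
  define C where "C = (B * real m + (B\<^sup>2 + B * B) + B\<^sup>2 * B) * A * M + 1"
  have C: "C > 0" using assms A \<open>M > 0\<close> by (auto simp: C_def intro!: add_nonneg_pos mult_nonneg_nonneg)
  have "h ^ (j + 2) * \<bar>scaled_lower g w' k' h \<xi>0 q j \<xi>\<bar> \<le> C * (\<Sum>i\<le>j + 1. layer_size m q i)"
    if deg: "\<forall>i. degree (q i) \<le> m" and j: "j + 2 \<le> m" and h: "0 < h" "h \<le> 1" and t: "\<bar>(\<xi> - \<xi>0) / h\<bar> \<le> T"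
      and k: "\<bar>curvature g \<xi>\<bar> \<le> B" and w: "1 / norm (vderiv g \<xi>) \<le> B" and w': "\<bar>w' \<xi>\<bar> \<le> B" and k': "\<bar>k' \<xi>\<bar> \<le> B"
    for w' k' h \<xi>0 and q :: "nat \<Rightarrow> real poly" and j \<xi>
  proof -
    define ww where "ww = 1 / norm (vderiv g \<xi>)"
    define kk where "kk = curvature g \<xi>"
    have w0: "\<bar>ww\<bar> \<le> B" using w by (simp add: ww_def)
    have hq: "h ^ n * (\<bar>x\<bar> / h ^ i) \<le> \<bar>x\<bar>" if "i \<le> n" for n i x
    proof -
      have "h ^ n * (\<bar>x\<bar> / h ^ i) = h ^ (n - i) * \<bar>x\<bar>" using h that by (simp add: power_diff)
      also have "\<dots> \<le> 1 * \<bar>x\<bar>" using h by (intro mult_right_mono power_le_one) auto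
      finally show ?thesis by simp
    qed
    have big: "T ^ m * (real (m + 1) * x) \<le> A * x" "T ^ m * (real m * (real (m + 1) * x)) \<le> A * x" "T ^ m * x \<le> A * x"
      if "0 \<le> x" for x
    proof -
      have "real (m + 1) \<le> (real (m + 1))\<^sup>2" "real m * real (m + 1) \<le> (real (m + 1))\<^sup>2" "1 \<le> (real (m + 1))\<^sup>2"
        by (simp_all add: power2_eq_square algebra_simps)
      then show "T ^ m * (real (m + 1) * x) \<le> A * x" "T ^ m * (real m * (real (m + 1) * x)) \<le> A * x" "T ^ m * x \<le> A * x"
        using that assms mult_right_mono[of _ _ x]
        by (simp_all only: A_def mult.assoc, (intro mult_left_mono; (simp add: mult.assoc[symmetric] mult_right_mono)?)+)
           (auto simp: mult_right_mono mult_le_cancel_right1)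
    qed
    have Q: "h ^ (j + 2) * \<bar>scaled_layer h \<xi>0 q i \<xi>\<bar> \<le> A * layer_size m q i" if "1 \<le> i" "i \<le> j + 1" for i
    proof -
      have "h ^ (j + 2) * \<bar>scaled_layer h \<xi>0 q i \<xi>\<bar> \<le> \<bar>poly (q i) ((\<xi> - \<xi>0) / h)\<bar>"
        using hq[of i "j + 2" "poly (q i) ((\<xi> - \<xi>0) / h)"] that h by (simp add: scaled_layer_def abs_mult)
      also have "\<dots> \<le> T ^ m * layer_size m q i"
        using poly_abs_le[of "q i" m "(\<xi> - \<xi>0) / h" T] deg t assms that by (simp add: layer_size_def)
      also have "\<dots> \<le> A * layer_size m q i" by (rule big) simp
      finally show ?thesis .
    qed
    have Q1: "h ^ (j + 2) * \<bar>scaled_layer' h \<xi>0 q i \<xi>\<bar> \<le> A * layer_size m q i" if "i \<le> j + 1" for i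
    proof -
      have "h ^ (j + 2) * \<bar>scaled_layer' h \<xi>0 q i \<xi>\<bar> \<le> \<bar>poly (pderiv (q i)) ((\<xi> - \<xi>0) / h)\<bar>"
        using hq[of "i + 1" "j + 2" "poly (pderiv (q i)) ((\<xi> - \<xi>0) / h)"] that h by (simp add: scaled_layer'_def abs_mult)
      also have "\<dots> \<le> T ^ m * coeff_norm m (pderiv (q i))"
        using deg[rule_format, of i] t assms by (intro poly_abs_le) (auto simp: degree_pderiv)
      also have "\<dots> \<le> T ^ m * (real (m + 1) * layer_size m q i)"
        using assms deg by (intro mult_left_mono coeff_norm_pderiv_layer) auto
      also have "\<dots> \<le> A * layer_size m q i" by (rule big) simp
      finally show ?thesis .
    qed
    have Q2: "h ^ (j + 2) * \<bar>scaled_layer'' h \<xi>0 q i \<xi>\<bar> \<le> A * layer_size m q i" if "i \<le> j" for i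
    proof -
      have degp: "degree (pderiv (q i)) \<le> m" using deg[rule_format, of i] by (simp add: degree_pderiv)
      have "h ^ (j + 2) * \<bar>scaled_layer'' h \<xi>0 q i \<xi>\<bar> \<le> \<bar>poly (pderiv (pderiv (q i))) ((\<xi> - \<xi>0) / h)\<bar>"
        using hq[of "i + 2" "j + 2" "poly (pderiv (pderiv (q i))) ((\<xi> - \<xi>0) / h)"] that h by (simp add: scaled_layer''_def abs_mult)
      also have "\<dots> \<le> T ^ m * coeff_norm m (pderiv (pderiv (q i)))"
        using degp t assms by (intro poly_abs_le) (auto simp: degree_pderiv[of "pderiv (q i)"])
      also have "\<dots> \<le> T ^ m * (real m * coeff_norm m (pderiv (q i)))"
        using assms by (intro mult_left_mono coeff_norm_pderiv degp) auto
      also have "\<dots> \<le> T ^ m * (real m * (real (m + 1) * layer_size m q i))"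
        using assms deg by (intro mult_left_mono coeff_norm_pderiv_layer) auto
      also have "\<dots> \<le> A * layer_size m q i" by (rule big) simp
      finally show ?thesis .
    qed
    have G: "\<bar>geom_coeff k n kk\<bar> \<le> M" if "k \<le> 3" "n \<le> m" for k n
      unfolding kk_def by (rule M[OF that k])
    define x1 where "x1 i = kk * real i * scaled_layer h \<xi>0 q i \<xi> * geom_coeff 1 (j + 1 - i) kk" for i
    define y2 where "y2 i = ww\<^sup>2 * scaled_layer'' h \<xi>0 q i \<xi> + ww * w' \<xi> * scaled_layer' h \<xi>0 q i \<xi>" for i
    define x2 where "x2 i = (if i \<le> j then y2 i * geom_coeff 2 (j - i) kk else 0)" for i
    define x3 where "x3 i = (if i + 1 \<le> j then ww\<^sup>2 * k' \<xi> * scaled_layer' h \<xi>0 q i \<xi> * geom_coeff 3 (j - (i + 1)) kk else 0)" for i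
    have "h ^ (j + 2) * \<bar>scaled_lower g w' k' h \<xi>0 q j \<xi>\<bar> = h ^ (j + 2) * \<bar>\<Sum>i\<le>j + 1. x1 i + x2 i - x3 i\<bar>"
      unfolding scaled_lower_def lower_terms_def Let_def ww_def[symmetric] kk_def[symmetric] x1_def y2_def x2_def x3_def ..
    also have "\<dots> \<le> h ^ (j + 2) * (\<Sum>i\<le>j + 1. \<bar>x1 i + x2 i - x3 i\<bar>)"
      using h by (intro mult_left_mono sum_abs) auto
    also have "\<dots> = (\<Sum>i\<le>j + 1. h ^ (j + 2) * \<bar>x1 i + x2 i - x3 i\<bar>)" by (rule sum_distrib_left)
    also have "\<dots> \<le> (\<Sum>i\<le>j + 1. C * layer_size m q i)"
    proof (rule sum_mono)
      fix i assume i: "i \<in> {..j + 1}"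
      define a where "a = A * layer_size m q i"
      have a0: "0 \<le> a" using A by (simp add: a_def)
      define H where "H = h ^ (j + 2)"
      have H0: "0 < H" using h by (simp add: H_def)
      note Q' = Q[of i, folded a_def H_def] and Q1' = Q1[of i, folded a_def H_def] and Q2' = Q2[of i, folded a_def H_def]
      have wsq: "\<bar>ww\<^sup>2\<bar> \<le> B\<^sup>2" using w0 assms by (metis abs_ge_zero abs_power2 power2_abs power_mono)
      have 1: "H * \<bar>x1 i\<bar> \<le> B * real m * a * M"
      proof (cases "i = 0")
        case True then show ?thesis using assms a0 \<open>M > 0\<close> by (simp add: x1_def)
      next
        case False
        have "H * \<bar>x1 i\<bar> = (\<bar>kk\<bar> * real i) * (H * \<bar>scaled_layer h \<xi>0 q i \<xi>\<bar>) * \<bar>geom_coeff 1 (j + 1 - i) kk\<bar>"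
          by (simp add: x1_def abs_mult)
        also have "\<dots> \<le> (B * real m) * a * M"
          using Q' False i k j assms a0 H0
          by (intro mult_mono G) (auto simp: kk_def)
        finally show ?thesis .
      qed
      have 2: "H * \<bar>x2 i\<bar> \<le> (B\<^sup>2 + B * B) * a * M"
      proof (cases "i \<le> j")
        case False then show ?thesis using assms a0 \<open>M > 0\<close> by (simp add: x2_def)
      next
        case True
        have "\<bar>y2 i\<bar>
            \<le> \<bar>ww\<^sup>2\<bar> * \<bar>scaled_layer'' h \<xi>0 q i \<xi>\<bar> + \<bar>ww\<bar> * \<bar>w' \<xi>\<bar> * \<bar>scaled_layer' h \<xi>0 q i \<xi>\<bar>"
          unfolding y2_def by (rule order.trans[OF abs_triangle_ineq]) (simp add: abs_mult)
        then have "H * \<bar>y2 i\<bar>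
            \<le> H * (\<bar>ww\<^sup>2\<bar> * \<bar>scaled_layer'' h \<xi>0 q i \<xi>\<bar> + \<bar>ww\<bar> * \<bar>w' \<xi>\<bar> * \<bar>scaled_layer' h \<xi>0 q i \<xi>\<bar>)"
          using H0 by (intro mult_left_mono) auto
        also have "\<dots> = \<bar>ww\<^sup>2\<bar> * (H * \<bar>scaled_layer'' h \<xi>0 q i \<xi>\<bar>) + (\<bar>ww\<bar> * \<bar>w' \<xi>\<bar>) * (H * \<bar>scaled_layer' h \<xi>0 q i \<xi>\<bar>)"
          by (simp add: algebra_simps)
        also have "\<dots> \<le> B\<^sup>2 * a + (B * B) * a"
          using Q2' Q1' True w0 w' assms a0 H0
          by (intro add_mono mult_mono wsq) auto
        finally have "H * \<bar>y2 i\<bar> * \<bar>geom_coeff 2 (j - i) kk\<bar>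
            \<le> (B\<^sup>2 * a + (B * B) * a) * M"
          using a0 assms j H0 by (intro mult_mono G) auto
        moreover have "H * \<bar>x2 i\<bar> = H * \<bar>y2 i\<bar> * \<bar>geom_coeff 2 (j - i) kk\<bar>"
          unfolding x2_def if_P[OF True] abs_mult by (rule mult.assoc[symmetric])
        ultimately show ?thesis by (simp only: distrib_right)
      qed
      have 3: "H * \<bar>x3 i\<bar> \<le> B\<^sup>2 * B * a * M"
      proof (cases "i + 1 \<le> j")
        case False then show ?thesis using assms a0 \<open>M > 0\<close> by (simp add: x3_def)
      next
        case True
        have "H * \<bar>x3 i\<bar> = \<bar>ww\<^sup>2\<bar> * \<bar>k' \<xi>\<bar> * (H * \<bar>scaled_layer' h \<xi>0 q i \<xi>\<bar>) * \<bar>geom_coeff 3 (j - (i + 1)) kk\<bar>"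
          using True by (simp add: x3_def abs_mult)
        also have "\<dots> \<le> B\<^sup>2 * B * a * M"
          using Q1' True k' j assms a0 H0
          by (intro mult_mono G wsq) auto
        finally show ?thesis .
      qed
      have "H * \<bar>x1 i + x2 i - x3 i\<bar> \<le> H * (\<bar>x1 i\<bar> + \<bar>x2 i\<bar> + \<bar>x3 i\<bar>)"
        using H0 by (intro mult_left_mono) auto
      also have "\<dots> \<le> B * real m * a * M + (B\<^sup>2 + B * B) * a * M + B\<^sup>2 * B * a * M"
        using 1 2 3 by (simp add: distrib_left)
      also have "\<dots> = ((B * real m + (B\<^sup>2 + B * B) + B\<^sup>2 * B) * A * M) * layer_size m q i"
        by (simp add: a_def algebra_simps)
      also have "\<dots> \<le> C * layer_size m q i" by (intro mult_right_mono) (auto simp: C_def)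
      finally show "h ^ (j + 2) * \<bar>x1 i + x2 i - x3 i\<bar> \<le> C * layer_size m q i" unfolding H_def .
    qed
    finally show ?thesis unfolding sum_distrib_left .
  qed
  with C show ?thesis by blast
qed

lemma continuous_on_scaled_lower:
  assumes "h \<noteq> 0" and k: "continuous_on UNIV (curvature g)" and w: "continuous_on UNIV (\<lambda>t. 1 / norm (vderiv g t))"
    and w': "continuous_on UNIV w'" and k': "continuous_on UNIV k'"
  shows "continuous_on S (scaled_lower g w' k' h \<xi>0 q j)"
proof -
  have G: "continuous_on UNIV (\<lambda>\<xi>. geom_coeff a b (curvature g \<xi>))" for a b
    using continuous_on_compose2[OF continuous_on_geom_coeff k] by simp
  have *: "continuous_on UNIV (scaled_layer h \<xi>0 q i)" "continuous_on UNIV (scaled_layer' h \<xi>0 q i)"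
     "continuous_on UNIV (scaled_layer'' h \<xi>0 q i)" for i
    unfolding scaled_layer_def[abs_def] scaled_layer'_def[abs_def] scaled_layer''_def[abs_def]
    using assms(1) by (auto intro!: continuous_intros)
  have "continuous_on UNIV (scaled_lower g w' k' h \<xi>0 q j)"
    unfolding scaled_lower_def lower_terms_def[abs_def] Let_def
  proof (intro continuous_on_sum)
    fix i
    show "continuous_on UNIV (\<lambda>\<xi>. curvature g \<xi> * real i * scaled_layer h \<xi>0 q i \<xi> * geom_coeff 1 (j + 1 - i) (curvature g \<xi>) +
         (if i \<le> j then ((1 / norm (vderiv g \<xi>))\<^sup>2 * scaled_layer'' h \<xi>0 q i \<xi> +
             1 / norm (vderiv g \<xi>) * w' \<xi> * scaled_layer' h \<xi>0 q i \<xi>) * geom_coeff 2 (j - i) (curvature g \<xi>) else 0) -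
         (if i + 1 \<le> j then (1 / norm (vderiv g \<xi>))\<^sup>2 * k' \<xi> * scaled_layer' h \<xi>0 q i \<xi> *
             geom_coeff 3 (j - (i + 1)) (curvature g \<xi>) else 0))"
      by (cases "i \<le> j"; cases "i + 1 \<le> j"; simp only: if_True if_False;
          intro continuous_on_add continuous_on_diff continuous_on_mult continuous_on_power continuous_on_const G k w w' k' *)
  qed
  then show ?thesis by (rule continuous_on_subset) simp
qed

lemma poly_eq_0_on_interval:
  fixes p :: "real poly"
  assumes "a < b" "\<And>x. x \<in> {a..b} \<Longrightarrow> poly p x = 0"
  shows "p = 0"
proof (rule ccontr)
  assume "p \<noteq> 0"
  then have "finite {x. poly p x = 0}" by (rule poly_roots_finite)
  moreover have "{a..b} \<subseteq> {x. poly p x = 0}" using assms(2) by auto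
  ultimately show False using assms(1) infinite_Icc finite_subset by blast
qed

lemma scaled_poly_0: "scaled_poly m h \<xi>0 q (0, \<xi>) = poly (q 0) ((\<xi> - \<xi>0) / h)"
proof -
  have "scaled_poly m h \<xi>0 q (0, \<xi>) = (\<Sum>i\<le>m. if i = 0 then poly (q 0) ((\<xi> - \<xi>0) / h) else 0)"
    unfolding scaled_poly_eq by (rule sum.cong) auto
  then show ?thesis by simp
qed

lemma d_eta_scaled_poly_0:
  assumes "1 \<le> m"
  shows "d_eta (scaled_poly m h \<xi>0 q) (0, \<xi>) = poly (q 1) ((\<xi> - \<xi>0) / h) / h"
proof -
  have "d_eta (scaled_poly m h \<xi>0 q) (0, \<xi>) = (\<Sum>i\<le>m. if i = 1 then poly (q 1) ((\<xi> - \<xi>0) / h) / h else 0)"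
    unfolding scaled_poly_def d_eta_layered
    by (rule sum.cong) (auto simp: scaled_layer_def power_0_left)
  then show ?thesis using assms by simp
qed

lemma grad_size_diff_smult:
  "grad_size m p \<le> grad_size m (\<lambda>i. p i - smult r (q i)) + \<bar>r\<bar> * grad_size m q"
proof -
  have "layer_size m p i \<le> layer_size m (\<lambda>i. p i - smult r (q i)) i + \<bar>r\<bar> * layer_size m q i" for i
  proof -
    define P where "P = (if i = 0 then pderiv (p 0) else p i)"
    define Q where "Q = (if i = 0 then pderiv (q 0) else q i)"
    have "coeff_norm m ((P - smult r Q) + smult r Q) \<le> coeff_norm m (P - smult r Q) + coeff_norm m (smult r Q)"
      by (rule coeff_norm_add)
    then show ?thesis
      by (simp add: layer_size_def P_def Q_def pderiv_diff pderiv_smult coeff_norm_smult split: if_splits)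
  qed
  then show ?thesis
    unfolding grad_size_def sum_distrib_left sum.distrib[symmetric] by (intro sum_mono) auto
qed

text \<open>
The three interface conditions of the reference space for a pair of polynomials, with the weights kept
symmetric so that either piece can play the part of the given one.
\<close>

definition transmission ::
  "(real \<Rightarrow> plane) \<Rightarrow> nat \<Rightarrow> real \<Rightarrow> real \<Rightarrow> real \<Rightarrow> real \<Rightarrow> (plane \<Rightarrow> real) \<Rightarrow> (plane \<Rightarrow> real) \<Rightarrow> bool" where
  "transmission g m \<beta>1 \<beta>2 \<xi>0 \<xi>1 p1 p2 \<longleftrightarrow>
     (\<forall>\<xi>\<in>{\<xi>0..\<xi>1}. p1 (0, \<xi>) - p2 (0, \<xi>) = 0) \<and>
     (\<forall>\<xi>\<in>{\<xi>0..\<xi>1}. \<beta>1 * d_eta p1 (0, \<xi>) - \<beta>2 * d_eta p2 (0, \<xi>) = 0) \<and>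
     (\<forall>j. \<forall>v :: real poly. j + 2 \<le> m \<longrightarrow> degree v \<le> m \<longrightarrow>
        integral {\<xi>0..\<xi>1} (\<lambda>\<xi>. (\<beta>1 * (d_eta ^^ j) (frenet_laplacian g p1) (0, \<xi>)
          - \<beta>2 * (d_eta ^^ j) (frenet_laplacian g p2) (0, \<xi>)) * poly v \<xi>) = 0)"

lemma transmission_sym:
  assumes "transmission g m \<beta>1 \<beta>2 \<xi>0 \<xi>1 p1 p2" shows "transmission g m \<beta>2 \<beta>1 \<xi>0 \<xi>1 p2 p1"
proof -
  have "integral {\<xi>0..\<xi>1} (\<lambda>\<xi>. (\<beta>2 * P2 \<xi> - \<beta>1 * P1 \<xi>) * poly v \<xi>)
      = - integral {\<xi>0..\<xi>1} (\<lambda>\<xi>. (\<beta>1 * P1 \<xi> - \<beta>2 * P2 \<xi>) * poly v \<xi>)" for P1 P2 and v :: "real poly"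
    unfolding integral_neg[symmetric] by (simp add: algebra_simps)
  then show ?thesis using assms unfolding transmission_def by force
qed

text \<open>
The layers \<open>qb\<close> are given and \<open>qe\<close> is determined by them; one constant serves all elements and coefficients.
\<close>

definition extension_bound :: "(real \<Rightarrow> plane) \<Rightarrow> nat \<Rightarrow> real \<Rightarrow> real \<Rightarrow> real \<Rightarrow> bool" where
  "extension_bound g m c1 c2 C \<longleftrightarrow> (\<forall>h \<xi>0 \<xi>1 qb qe \<beta>b \<beta>e. 0 < h \<longrightarrow> h \<le> 1 \<longrightarrow> c1 * h \<le> \<xi>1 - \<xi>0 \<longrightarrow> \<xi>1 - \<xi>0 \<le> c2 * h \<longrightarrow>
     (\<forall>i. degree (qb i) \<le> m) \<longrightarrow> (\<forall>i. degree (qe i) \<le> m) \<longrightarrow> 0 < \<beta>b \<longrightarrow> 0 < \<beta>e \<longrightarrow>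
     transmission g m \<beta>e \<beta>b \<xi>0 \<xi>1 (scaled_poly m h \<xi>0 qe) (scaled_poly m h \<xi>0 qb) \<longrightarrow>
     grad_size m qe \<le> C * (1 + \<beta>b / \<beta>e) * grad_size m qb)"

text \<open>
The difference \<open>d = q\<^sub>e - r q\<^sub>b\<close> with \<open>r = \<beta>b/\<beta>e\<close> absorbs the coefficients: its layer \<open>1\<close> vanishes, its
layer \<open>0\<close> is \<open>(1 - r)\<close> times that of \<open>q\<^sub>b\<close>, and the remaining conditions bound layer \<open>j + 2\<close> by the layers
below.  The curve enters with three derivatives only if \<open>m \<ge> 2\<close>.
\<close>

lemma ife_extension_bound:
  fixes c1 c2 B :: real
  assumes c: "0 < c1" "c1 \<le> c2" and B: "0 \<le> B"
    and w: "\<And>\<xi>. 2 \<le> m \<Longrightarrow> ((\<lambda>t. 1 / norm (vderiv g t)) has_real_derivative w' \<xi>) (at \<xi>)"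
    and k: "\<And>\<xi>. 2 \<le> m \<Longrightarrow> (curvature g has_real_derivative k' \<xi>) (at \<xi>)"
    and cont: "2 \<le> m \<Longrightarrow> continuous_on UNIV w'" "2 \<le> m \<Longrightarrow> continuous_on UNIV k'"
    and bd: "\<And>\<xi>. 2 \<le> m \<Longrightarrow> \<bar>curvature g \<xi>\<bar> \<le> B" "\<And>\<xi>. 2 \<le> m \<Longrightarrow> 1 / norm (vderiv g \<xi>) \<le> B"
      "\<And>\<xi>. 2 \<le> m \<Longrightarrow> \<bar>w' \<xi>\<bar> \<le> B" "\<And>\<xi>. 2 \<le> m \<Longrightarrow> \<bar>k' \<xi>\<bar> \<le> B"
  shows "\<exists>C>0. extension_bound g m c1 c2 C"
proof -
  define T where "T = max 1 c2"
  have T: "1 \<le> T" "c2 \<le> T" by (auto simp: T_def)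
  obtain C1 where "C1 > 0" and C1: "\<And>q h \<xi>0 \<xi>1 K E e. degree q \<le> m \<Longrightarrow> 0 < h \<Longrightarrow> c1 * h \<le> \<xi>1 - \<xi>0 \<Longrightarrow> \<xi>1 - \<xi>0 \<le> c2 * h \<Longrightarrow>
     1 \<le> K \<Longrightarrow> continuous_on {\<xi>0..\<xi>1} E \<Longrightarrow> (\<forall>\<xi>\<in>{\<xi>0..\<xi>1}. \<bar>E \<xi>\<bar> \<le> e) \<Longrightarrow>
     integral {\<xi>0..\<xi>1} (\<lambda>\<xi>. (K * poly q ((\<xi> - \<xi>0) / h) + E \<xi>) * poly q ((\<xi> - \<xi>0) / h)) = 0 \<Longrightarrow>
     coeff_norm m q \<le> C1 * e"
    using coeff_norm_le_of_orthogonal[OF c, of m] by blast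
  obtain C2 where "C2 > 0" and C2: "\<And>w' k' h \<xi>0 q j \<xi>. (\<forall>i. degree (q i) \<le> m) \<Longrightarrow> j + 2 \<le> m \<Longrightarrow> 0 < h \<Longrightarrow> h \<le> 1 \<Longrightarrow> \<bar>(\<xi> - \<xi>0) / h\<bar> \<le> T \<Longrightarrow>
    \<bar>curvature g \<xi>\<bar> \<le> B \<Longrightarrow> 1 / norm (vderiv g \<xi>) \<le> B \<Longrightarrow> \<bar>w' \<xi>\<bar> \<le> B \<Longrightarrow> \<bar>k' \<xi>\<bar> \<le> B \<Longrightarrow>
    h ^ (j + 2) * \<bar>scaled_lower g w' k' h \<xi>0 q j \<xi>\<bar> \<le> C2 * (\<Sum>i\<le>j + 1. layer_size m q i)"
    using scaled_lower_bound[OF T(1) B, of m g] by blast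
  define D where "D = C1 * C2"
  have D: "D > 0" using \<open>C1 > 0\<close> \<open>C2 > 0\<close> by (simp add: D_def)
  have "grad_size m qe \<le> ((1 + D) ^ m + 1) * (1 + \<beta>b / \<beta>e) * grad_size m qb"
    if h: "0 < h" "h \<le> 1" and l: "c1 * h \<le> \<xi>1 - \<xi>0" "\<xi>1 - \<xi>0 \<le> c2 * h"
      and degb: "\<forall>i. degree (qb i) \<le> m" and dege: "\<forall>i. degree (qe i) \<le> m" and \<beta>: "0 < \<beta>b" "0 < \<beta>e"
      and tr: "transmission g m \<beta>e \<beta>b \<xi>0 \<xi>1 (scaled_poly m h \<xi>0 qe) (scaled_poly m h \<xi>0 qb)"
    for h \<xi>0 \<xi>1 qb qe \<beta>b \<beta>e
  proof -
    note j0 = tr[unfolded transmission_def, THEN conjunct1]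
      and j1 = tr[unfolded transmission_def, THEN conjunct2, THEN conjunct1]
      and jj = tr[unfolded transmission_def, THEN conjunct2, THEN conjunct2]
    define r where "r = \<beta>b / \<beta>e"
    have r: "0 < r" "\<beta>b = r * \<beta>e" using \<beta> by (auto simp: r_def)
    define d where "d i = qe i - smult r (qb i)" for i
    have degd: "\<forall>i. degree (d i) \<le> m"
      using degb dege by (auto simp: d_def intro!: degree_diff_le order.trans[OF degree_smult_le])
    have pt: "\<xi>0 + h * t \<in> {\<xi>0..\<xi>1}" if "t \<in> {0..c1}" for t
    proof -
      have "h * t \<le> h * c1" "0 \<le> h * t" using that h by auto
      then show ?thesis using l(1) by (auto simp: mult.commute[of h c1])
    qed
    have "qe 0 - qb 0 = 0"
    proof (rule poly_eq_0_on_interval[OF c(1)])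
      fix t assume "t \<in> {0..c1}"
      from j0[rule_format, OF pt[OF this]] show "poly (qe 0 - qb 0) t = 0"
        using h by (simp add: scaled_poly_0)
    qed
    then have d0: "layer_size m d 0 = \<bar>1 - r\<bar> * layer_size m qb 0"
    proof -
      have "d 0 = smult (1 - r) (qb 0)" using \<open>qe 0 - qb 0 = 0\<close> by (simp add: d_def smult_diff_left)
      then show ?thesis by (simp add: layer_size_def pderiv_smult coeff_norm_smult)
    qed
    have d1: "layer_size m d 1 = 0" if m1: "1 \<le> m"
    proof -
      have "d 1 = 0"
      proof (rule poly_eq_0_on_interval[OF c(1)])
        fix t assume "t \<in> {0..c1}"
        from j1[rule_format, OF pt[OF this]] have "\<beta>e * poly (qe 1) t = \<beta>e * (r * poly (qb 1) t)"
          using h m1 by (simp add: d_eta_scaled_poly_0 r(2) mult_ac)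
        then show "poly (d 1) t = 0" using \<beta> by (simp add: d_def)
      qed
      then show ?thesis by (simp add: layer_size_def coeff_norm_def)
    qed
    have rec: "layer_size m d (j + 2) \<le> D * (\<Sum>i\<le>j + 1. layer_size m d i)" if j: "j + 2 \<le> m" for j
    proof -
      have m2: "2 \<le> m" using j by simp
      define E where "E \<xi> = h ^ (j + 2) * scaled_lower g w' k' h \<xi>0 d j \<xi>" for \<xi>
      \<comment> \<open>The test function is the new layer itself, which is why its degree bound \<open>m\<close> matches that of the test space.\<close>
      define v where "v = pcompose (d (j + 2)) [:- \<xi>0 / h, 1 / h:]"
      have v: "poly v \<xi> = poly (d (j + 2)) ((\<xi> - \<xi>0) / h)" for \<xi>
        by (simp add: v_def poly_pcompose diff_divide_distrib)
      have degv: "degree v \<le> m" unfolding v_def using degd h by (simp add: degree_pcompose)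
      have L: "(d_eta ^^ j) (frenet_laplacian g (scaled_poly m h \<xi>0 q)) (0, \<xi>)
          = fact j * (real (j + 2) * real (j + 1) * scaled_layer h \<xi>0 q (j + 2) \<xi> + scaled_lower g w' k' h \<xi>0 q j \<xi>)" for q \<xi>
        unfolding scaled_poly_def scaled_lower_def using h
        by (intro deriv_frenet_laplacian_layered DERIV_scaled_layer DERIV_scaled_layer' w k m2 j) auto
      have low: "scaled_lower g w' k' h \<xi>0 d j \<xi> = scaled_lower g w' k' h \<xi>0 qe j \<xi> - r * scaled_lower g w' k' h \<xi>0 qb j \<xi>" for \<xi>
        unfolding d_def by (rule scaled_lower_diff_smult)
      have lay: "scaled_layer h \<xi>0 qe (j + 2) \<xi> - r * scaled_layer h \<xi>0 qb (j + 2) \<xi> = poly v \<xi> / h ^ (j + 2)" for \<xi>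
        by (simp add: v scaled_layer_def d_def diff_divide_distrib)
      have "(\<beta>e * (d_eta ^^ j) (frenet_laplacian g (scaled_poly m h \<xi>0 qe)) (0, \<xi>)
          - \<beta>b * (d_eta ^^ j) (frenet_laplacian g (scaled_poly m h \<xi>0 qb)) (0, \<xi>)) * poly v \<xi>
         = (\<beta>e * fact j / h ^ (j + 2)) * ((real (j + 2) * real (j + 1) * poly v \<xi> + E \<xi>) * poly v \<xi>)" for \<xi>
      proof -
        have "\<beta>e * (d_eta ^^ j) (frenet_laplacian g (scaled_poly m h \<xi>0 qe)) (0, \<xi>)
          - \<beta>b * (d_eta ^^ j) (frenet_laplacian g (scaled_poly m h \<xi>0 qb)) (0, \<xi>)
          = \<beta>e * fact j * (real (j + 2) * real (j + 1) * (scaled_layer h \<xi>0 qe (j + 2) \<xi> - r * scaled_layer h \<xi>0 qb (j + 2) \<xi>)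
             + (scaled_lower g w' k' h \<xi>0 qe j \<xi> - r * scaled_lower g w' k' h \<xi>0 qb j \<xi>))"
          unfolding L r(2) by (simp add: algebra_simps)
        also have "\<dots> = \<beta>e * fact j * (real (j + 2) * real (j + 1) * (poly v \<xi> / h ^ (j + 2)) + E \<xi> / h ^ (j + 2))"
          unfolding lay low[symmetric] E_def using h by simp
        also have "\<dots> = (\<beta>e * fact j / h ^ (j + 2)) * (real (j + 2) * real (j + 1) * poly v \<xi> + E \<xi>)"
          by (simp add: distrib_left add_divide_distrib)
        finally show ?thesis by (simp add: mult.assoc)
      qed
      then have "(\<beta>e * fact j / h ^ (j + 2)) * integral {\<xi>0..\<xi>1} (\<lambda>\<xi>. (real (j + 2) * real (j + 1) * poly v \<xi> + E \<xi>) * poly v \<xi>) = 0"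
        using jj[rule_format, OF j degv] by simp
      then have I: "integral {\<xi>0..\<xi>1} (\<lambda>\<xi>. (real (j + 2) * real (j + 1) * poly v \<xi> + E \<xi>) * poly v \<xi>) = 0"
        using \<beta> h by simp
      have cE: "continuous_on {\<xi>0..\<xi>1} E"
      proof -
        have ck: "continuous_on UNIV (curvature g)" and cw: "continuous_on UNIV (\<lambda>t. 1 / norm (vderiv g t))"
          by (auto intro!: continuous_at_imp_continuous_on DERIV_isCont[OF k[OF m2]] DERIV_isCont[OF w[OF m2]])
        show ?thesis unfolding E_def
          by (intro continuous_on_mult continuous_on_const
              continuous_on_scaled_lower[OF _ ck cw cont(1)[OF m2] cont(2)[OF m2]]) (use h in auto)
      qed
      have bE: "\<forall>\<xi>\<in>{\<xi>0..\<xi>1}. \<bar>E \<xi>\<bar> \<le> C2 * (\<Sum>i\<le>j + 1. layer_size m d i)"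
      proof
        fix \<xi> assume \<xi>: "\<xi> \<in> {\<xi>0..\<xi>1}"
        then have "(\<xi> - \<xi>0) / h \<le> c2" "0 \<le> (\<xi> - \<xi>0) / h" using l h by (auto simp: field_simps)
        then have "\<bar>(\<xi> - \<xi>0) / h\<bar> \<le> T" using T by linarith
        then have "h ^ (j + 2) * \<bar>scaled_lower g w' k' h \<xi>0 d j \<xi>\<bar> \<le> C2 * (\<Sum>i\<le>j + 1. layer_size m d i)"
          by (intro C2 degd j h bd m2)
        then show "\<bar>E \<xi>\<bar> \<le> C2 * (\<Sum>i\<le>j + 1. layer_size m d i)" unfolding E_def abs_mult using h by simp
      qed
      have "1 * 1 \<le> real (j + 2) * real (j + 1)" by (intro mult_mono) auto
      then have "coeff_norm m (d (j + 2)) \<le> C1 * (C2 * (\<Sum>i\<le>j + 1. layer_size m d i))"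
        by (intro C1[where K = "real (j + 2) * real (j + 1)", OF degd[rule_format] h(1) l _ cE bE] I[unfolded v]) simp
      then show ?thesis by (simp add: layer_size_def D_def)
    qed
    have sums: "(\<Sum>i\<le>n. layer_size m d i) \<le> (1 + D) ^ n * layer_size m d 0" if "n \<le> m" for n
      using that
    proof (induction n)
      case (Suc n)
      have "layer_size m d (Suc n) \<le> D * (\<Sum>i\<le>n. layer_size m d i)"
      proof (cases n)
        case 0
        have "layer_size m d (Suc 0) = 0" using d1 Suc.prems by simp
        then show ?thesis using 0 D by simp
      next
        case (Suc j)
        then show ?thesis using rec[of j] Suc.prems \<open>Suc n \<le> m\<close> by (simp add: numeral_2_eq_2)
      qed
      then have "(\<Sum>i\<le>Suc n. layer_size m d i) \<le> (1 + D) * (\<Sum>i\<le>n. layer_size m d i)" by (simp add: algebra_simps)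
      also have "\<dots> \<le> (1 + D) * ((1 + D) ^ n * layer_size m d 0)"
        using Suc D by (intro mult_left_mono) auto
      finally show ?case by (simp add: mult_ac)
    qed simp
    have "layer_size m qb 0 \<le> grad_size m qb" unfolding grad_size_def by (rule member_le_sum) auto
    have "grad_size m d \<le> (1 + D) ^ m * (\<bar>1 - r\<bar> * layer_size m qb 0)"
      using sums[of m] by (simp add: grad_size_def d0)
    also have "\<dots> \<le> (1 + D) ^ m * ((1 + r) * grad_size m qb)"
      using r D \<open>layer_size m qb 0 \<le> grad_size m qb\<close> by (intro mult_left_mono mult_mono) auto
    finally have "grad_size m qe \<le> (1 + D) ^ m * ((1 + r) * grad_size m qb) + r * grad_size m qb"
      using grad_size_diff_smult[of m qe r qb] r by (simp add: d_def[abs_def])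
    also have "\<dots> \<le> (1 + D) ^ m * ((1 + r) * grad_size m qb) + (1 + r) * grad_size m qb"
      by (intro add_left_mono mult_right_mono) auto
    finally show ?thesis by (simp add: r_def algebra_simps)
  qed
  moreover have "(1 + D) ^ m + 1 > 0" using D by (simp add: add_pos_pos)
  ultimately show ?thesis unfolding extension_bound_def by blast
qed

section \<open>Closed curves and their Frenet map\<close>

text \<open>
All quantities attached to the closed curve are periodic, so continuity alone bounds them; this is the
source of constants that do not depend on the element.
\<close>

lemma periodic_bounded:
  fixes f :: "real \<Rightarrow> 'a::real_normed_vector"
  assumes "0 < L" "continuous_on UNIV f" "\<And>t. f (t + L) = f t"
  obtains B where "0 < B" "\<And>t. norm (f t) \<le> B"
proof -
  have shift: "f (t + of_int k * L) = f t" for t and k :: int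
  proof (induction k arbitrary: t rule: int_induct[where k = 0])
    case (step1 i)
    have "f (t + of_int (i + 1) * L) = f ((t + of_int i * L) + L)" by (simp add: algebra_simps)
    then show ?case using assms(3) step1 by simp
  next
    case (step2 i)
    have "f (t + of_int (i - 1) * L) = f ((t + of_int (i - 1) * L) + L)" using assms(3) by simp
    also have "\<dots> = f (t + of_int i * L)" by (simp add: algebra_simps)
    finally show ?case using step2 by simp
  qed simp
  have "bounded (f ` {0..L})"
    by (intro compact_imp_bounded compact_continuous_image continuous_on_subset[OF assms(2)]) auto
  then obtain B where "0 < B" and B: "\<And>t. t \<in> {0..L} \<Longrightarrow> norm (f t) \<le> B"
    unfolding bounded_pos by auto
  have "norm (f t) \<le> B" for t
  proof -
    define k where "k = \<lfloor>t / L\<rfloor>"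
    have "of_int k \<le> t / L" "t / L < of_int k + 1" unfolding k_def by linarith+
    then have "t + of_int (-k) * L \<in> {0..L}" using assms(1) by (auto simp: field_simps)
    then show ?thesis using B shift[of t "-k"] by metis
  qed
  with \<open>0 < B\<close> show thesis by (rule that)
qed

lemma vderiv_periodic:
  assumes "\<And>t. (f has_vector_derivative vderiv f t) (at t)" "\<And>t. f (t + L) = f t"
  shows "vderiv f (t + L) = vderiv f t"
proof -
  have "((\<lambda>s. f (s + L)) has_vector_derivative (1::real) *\<^sub>R vderiv f (t + L)) (at t)"
  proof -
    have "((\<lambda>s. s + L) has_vector_derivative 1) (at t)"
      by (auto intro!: derivative_eq_intros simp: has_vector_derivative_def)
    from vector_diff_chain_at[OF this assms(1)] show ?thesis by (simp add: o_def)
  qed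
  then have "(f has_vector_derivative vderiv f (t + L)) (at t)" by (simp add: assms(2))
  then show ?thesis using assms(1)[of t] by (rule vector_derivative_unique_at)
qed

text \<open>
A closed curve with speed between \<open>\<gamma>\<close> and \<open>\<Gamma>\<close>, the only two numbers through which the curve enters the
constants of the geometric estimates.
\<close>

locale regular_curve =
  fixes g :: "real \<Rightarrow> plane" and L \<gamma> \<Gamma> :: real
  assumes L: "0 < L"
    and per: "g (t + L) = g t"
    and dg: "(g has_vector_derivative vderiv g t) (at t)"
    and ddg: "(vderiv g has_vector_derivative vderiv (vderiv g) t) (at t)"
    and cddg: "continuous_on UNIV (vderiv (vderiv g))"
    and \<gamma>: "0 < \<gamma>" "\<gamma> \<le> norm (vderiv g t)" and \<Gamma>: "norm (vderiv g t) \<le> \<Gamma>"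
begin

lemma Npos: "0 < norm (vderiv g t)" using \<gamma> by (meson less_le_trans)

lemma \<Gamma>_pos: "0 < \<Gamma>" using Npos \<Gamma> by (meson less_le_trans)

lemma norm_tangent: "norm (tangent g t) = 1"
  using Npos[of t] by (simp add: tangent_def)

lemma norm_normal: "norm (normal_vec g t) = 1"
  using norm_tangent[of t] by (cases "tangent g t") (simp add: normal_vec_def norm_Pair add.commute)

lemma speed_deriv:
  "((\<lambda>t. norm (vderiv g t)) has_real_derivative
      (vderiv g t \<bullet> vderiv (vderiv g) t) / norm (vderiv g t)) (at t)"
proof -
  have "vderiv g t \<noteq> 0" using Npos[of t] by auto
  from has_derivative_compose[OF ddg[unfolded has_vector_derivative_def] has_derivative_norm[OF this]]
  have "((\<lambda>t. norm (vderiv g t)) has_derivative (\<lambda>h. (h *\<^sub>R vderiv (vderiv g) t) \<bullet> sgn (vderiv g t))) (at t)"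
    by (simp add: inner_commute)
  then show ?thesis
    unfolding has_field_derivative_def
    by (rule has_derivative_eq_rhs) (auto simp: sgn_div_norm inner_commute divide_inverse fun_eq_iff mult_ac)
qed

text \<open>
The Frenet formula \<open>n' = \<kappa> g'\<close>, in the form that holds for any parametrization.  It makes
\<open>\<partial>\<^sub>\<xi> P = (1 + \<eta> \<kappa>) g'\<close> orthogonal to \<open>\<partial>\<^sub>\<eta> P = n\<close>.
\<close>

lemma normal_deriv:
  "(normal_vec g has_vector_derivative curvature g t *\<^sub>R vderiv g t) (at t)"
proof -
  define a b N where "a s = fst (vderiv g s)" and "b s = snd (vderiv g s)" and "N s = norm (vderiv g s)" for s
  define c d where "c = fst (vderiv (vderiv g) t)" and "d = snd (vderiv (vderiv g) t)"
  have da: "(a has_real_derivative c) (at t)"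
    unfolding has_real_derivative_iff_has_vector_derivative a_def[abs_def] c_def
    using bounded_linear.has_vector_derivative[OF bounded_linear_fst ddg] .
  have db: "(b has_real_derivative d) (at t)"
    unfolding has_real_derivative_iff_has_vector_derivative b_def[abs_def] d_def
    using bounded_linear.has_vector_derivative[OF bounded_linear_snd ddg] .
  have dN: "(N has_real_derivative (a t * c + b t * d) / N t) (at t)"
    using speed_deriv[of t] by (simp add: N_def[abs_def] a_def b_def c_def d_def inner_prod_def)
  have N: "N t > 0" "(N t)\<^sup>2 = (a t)\<^sup>2 + (b t)\<^sup>2"
    using Npos by (simp_all add: N_def a_def b_def norm_prod_def)
  have k: "curvature g t = (a t * d - b t * c) / N t ^ 3"
    by (simp add: curvature_def det2_def N_def a_def b_def c_def d_def)
  have 1: "((\<lambda>s. b s / N s) has_real_derivative curvature g t * a t) (at t)"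
  proof -
    have "((\<lambda>s. b s / N s) has_real_derivative (d * N t - b t * ((a t * c + b t * d) / N t)) / (N t * N t)) (at t)"
      using N by (auto intro!: derivative_eq_intros db dN)
    also have "(d * N t - b t * ((a t * c + b t * d) / N t)) / (N t * N t) = (d * (N t)\<^sup>2 - b t * (a t * c + b t * d)) / N t ^ 3"
      using N(1) by (simp add: field_simps power2_eq_square power3_eq_cube)
    also have "\<dots> = curvature g t * a t" unfolding N(2) k by (simp add: algebra_simps power2_eq_square)
    finally show ?thesis .
  qed
  have 2: "((\<lambda>s. - (a s / N s)) has_real_derivative curvature g t * b t) (at t)"
  proof -
    have "((\<lambda>s. - (a s / N s)) has_real_derivative - ((c * N t - a t * ((a t * c + b t * d) / N t)) / (N t * N t))) (at t)"
      using N by (auto intro!: derivative_eq_intros da dN)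
    also have "- ((c * N t - a t * ((a t * c + b t * d) / N t)) / (N t * N t)) = - (c * (N t)\<^sup>2 - a t * (a t * c + b t * d)) / N t ^ 3"
      using N(1) by (simp add: field_simps power2_eq_square power3_eq_cube)
    also have "\<dots> = curvature g t * b t" unfolding N(2) k by (simp add: algebra_simps power2_eq_square)
    finally show ?thesis .
  qed
  have "normal_vec g = (\<lambda>s. (b s / N s, - (a s / N s)))"
    by (auto simp: normal_vec_def tangent_def a_def b_def N_def)
  moreover have "curvature g t *\<^sub>R vderiv g t = (curvature g t * a t, curvature g t * b t)"
    by (simp add: a_def b_def prod_eq_iff)
  ultimately show ?thesis
    using has_vector_derivative_Pair[OF 1[unfolded has_real_derivative_iff_has_vector_derivative] 2[unfolded has_real_derivative_iff_has_vector_derivative]]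
    by simp
qed

lemma continuous_on_velocity: "continuous_on S (vderiv g)"
  by (intro continuous_at_imp_continuous_on ballI has_vector_derivative_continuous[OF ddg])

lemma continuous_on_normal: "continuous_on S (normal_vec g)"
  by (intro continuous_at_imp_continuous_on ballI has_vector_derivative_continuous[OF normal_deriv])

lemma continuous_on_curvature: "continuous_on S (curvature g)"
proof -
  have "continuous_on UNIV (curvature g)"
    unfolding curvature_def[abs_def] det2_def
    using Npos by (intro continuous_intros continuous_on_velocity cddg) auto
  then show ?thesis by (rule continuous_on_subset) simp
qed

lemma normal_periodic: "normal_vec g (t + L) = normal_vec g t"
  using vderiv_periodic[OF dg per] by (simp add: normal_vec_def tangent_def)

lemma frenet_periodic: "frenet g (\<eta>, \<xi> + of_int k * L) = frenet g (\<eta>, \<xi>)"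
proof (induction k arbitrary: \<xi> rule: int_induct[where k = 0])
  case (step1 i)
  have "frenet g (\<eta>, \<xi> + of_int (i + 1) * L) = frenet g (\<eta>, (\<xi> + of_int i * L) + L)" by (simp add: algebra_simps)
  also have "\<dots> = frenet g (\<eta>, \<xi> + of_int i * L)" unfolding frenet_def prod.case by (simp add: per normal_periodic)
  finally show ?case using step1 by simp
next
  case (step2 i)
  have "frenet g (\<eta>, \<xi> + of_int (i - 1) * L) = frenet g (\<eta>, (\<xi> + of_int (i - 1) * L) + L)"
    unfolding frenet_def prod.case by (simp add: per normal_periodic)
  also have "\<dots> = frenet g (\<eta>, \<xi> + of_int i * L)" by (simp add: algebra_simps)
  finally show ?case using step2 by simp
qed simp

lemma frenet_deriv:
  "(frenet g has_derivative (\<lambda>v. fst v *\<^sub>R normal_vec g (snd z)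
      + (snd v * (1 + fst z * curvature g (snd z))) *\<^sub>R vderiv g (snd z))) (at z)"
proof -
  have 1: "((\<lambda>z. g (snd z)) has_derivative (\<lambda>v. snd v *\<^sub>R vderiv g (snd z))) (at z)"
    using has_derivative_compose[OF has_derivative_snd[OF has_derivative_ident] dg[unfolded has_vector_derivative_def]] .
  have 2: "((\<lambda>z. normal_vec g (snd z)) has_derivative (\<lambda>v. snd v *\<^sub>R (curvature g (snd z) *\<^sub>R vderiv g (snd z)))) (at z)"
    using has_derivative_compose[OF has_derivative_snd[OF has_derivative_ident] normal_deriv[unfolded has_vector_derivative_def]] .
  have "((\<lambda>z. g (snd z) + fst z *\<^sub>R normal_vec g (snd z)) has_derivative
     (\<lambda>v. snd v *\<^sub>R vderiv g (snd z) + (fst z *\<^sub>R (snd v *\<^sub>R (curvature g (snd z) *\<^sub>R vderiv g (snd z))) + fst v *\<^sub>R normal_vec g (snd z)))) (at z)"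
    by (intro has_derivative_add 1 has_derivative_scaleR 2 has_derivative_fst has_derivative_ident)
  moreover have "frenet g = (\<lambda>z. g (snd z) + fst z *\<^sub>R normal_vec g (snd z))"
    by (rule ext) (auto simp: frenet_def)
  ultimately have "(frenet g has_derivative
     (\<lambda>v. snd v *\<^sub>R vderiv g (snd z) + (fst z *\<^sub>R (snd v *\<^sub>R (curvature g (snd z) *\<^sub>R vderiv g (snd z))) + fst v *\<^sub>R normal_vec g (snd z)))) (at z)"
    by simp
  then show ?thesis
    by (rule has_derivative_eq_rhs) (simp add: fun_eq_iff algebra_simps)
qed

lemma continuous_on_frenet: "continuous_on S (frenet g)"
  by (intro continuous_at_imp_continuous_on ballI has_derivative_continuous[OF frenet_deriv])

lemma frame_orthogonal: "normal_vec g t \<bullet> vderiv g t = 0"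
  by (simp add: normal_vec_def tangent_def inner_prod_def mult.commute)

lemma frame_decomposition:
  "v = (v \<bullet> normal_vec g t) *\<^sub>R normal_vec g t + ((v \<bullet> vderiv g t) / (norm (vderiv g t))\<^sup>2) *\<^sub>R vderiv g t"
proof -
  obtain a b where ab: "vderiv g t = (a, b)" by fastforce
  obtain x y where v: "v = (x, y)" by fastforce
  have N: "(norm (vderiv g t))\<^sup>2 = a\<^sup>2 + b\<^sup>2" "norm (vderiv g t) > 0" using Npos[of t] by (simp_all add: ab norm_Pair)
  have n: "normal_vec g t = (b / norm (vderiv g t), - (a / norm (vderiv g t)))"
    by (simp add: normal_vec_def tangent_def ab)
  have "(v \<bullet> normal_vec g t) *\<^sub>R normal_vec g t = (((x * b - y * a) * b) / (norm (vderiv g t))\<^sup>2, - ((x * b - y * a) * a) / (norm (vderiv g t))\<^sup>2)"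
    unfolding n v by (simp add: inner_prod_def power2_eq_square diff_divide_distrib algebra_simps)
  moreover have "((v \<bullet> vderiv g t) / (norm (vderiv g t))\<^sup>2) *\<^sub>R vderiv g t = (((x * a + y * b) * a) / (norm (vderiv g t))\<^sup>2, ((x * a + y * b) * b) / (norm (vderiv g t))\<^sup>2)"
    unfolding ab v by (simp add: inner_prod_def)
  moreover have "a\<^sup>2 + b\<^sup>2 \<noteq> 0" using N by (metis less_irrefl zero_less_power)
  then have "x = ((x * b - y * a) * b) / (a\<^sup>2 + b\<^sup>2) + ((x * a + y * b) * a) / (a\<^sup>2 + b\<^sup>2)"
    "y = - ((x * b - y * a) * a) / (a\<^sup>2 + b\<^sup>2) + ((x * a + y * b) * b) / (a\<^sup>2 + b\<^sup>2)"
    by (simp_all add: add_divide_distrib[symmetric] field_simps power2_eq_square)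
  ultimately show ?thesis unfolding N v by simp
qed

end

lemma regular_closed_curve_imp:
  assumes "regular_closed_curve (m + 1) g \<xi>s \<xi>e" "1 \<le> m"
  obtains \<gamma> \<Gamma> where "regular_curve g (\<xi>e - \<xi>s) \<gamma> \<Gamma>"
proof -
  let ?L = "\<xi>e - \<xi>s"
  have Ck: "C_k (m + 1) g" and L: "0 < ?L" and per: "\<And>t. g (t + ?L) = g t" and nz: "\<And>t. vderiv g t \<noteq> 0"
    using assms by (auto simp: regular_closed_curve_def)
  have diff: "((vderiv ^^ j) g) differentiable (at t)" if "j < m + 1" for j t
    using Ck that by (auto simp: C_k_def)
  have dg: "(g has_vector_derivative vderiv g t) (at t)" for t
    using diff[of 0 t] by (simp add: vderiv_def vector_derivative_works)
  have ddg: "(vderiv g has_vector_derivative vderiv (vderiv g) t) (at t)" for t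
    using diff[of 1 t] assms(2) by (simp add: vderiv_def vector_derivative_works)
  have cddg: "continuous_on UNIV (vderiv (vderiv g))"
  proof (cases "m = 1")
    case True
    then show ?thesis using Ck by (simp add: C_k_def numeral_2_eq_2)
  next
    case False
    then have "2 < m + 1" using assms(2) by simp
    from diff[OF this] show ?thesis
      by (intro continuous_at_imp_continuous_on ballI differentiable_imp_continuous_within) (simp add: numeral_2_eq_2)
  qed
  have cdg: "continuous_on UNIV (vderiv g)"
    by (intro continuous_at_imp_continuous_on ballI has_vector_derivative_continuous[OF ddg])
  have vper: "vderiv g (t + ?L) = vderiv g t" for t by (rule vderiv_periodic[OF dg per])
  obtain \<Gamma> where "0 < \<Gamma>" "\<And>t. norm (vderiv g t) \<le> \<Gamma>" using periodic_bounded[OF L cdg vper] by metis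
  moreover obtain c where "0 < c" and c: "\<And>t. norm (1 / norm (vderiv g t)) \<le> c"
  proof (rule periodic_bounded[OF L, of "\<lambda>t. 1 / norm (vderiv g t)"])
    show "continuous_on UNIV (\<lambda>t. 1 / norm (vderiv g t))" using nz by (intro continuous_intros cdg) auto
  qed (auto simp: vper)
  moreover have "1 / c \<le> norm (vderiv g t)" for t
    using c[of t] nz[of t] \<open>0 < c\<close> by (simp add: field_simps)
  ultimately have "regular_curve g ?L (1 / c) \<Gamma>"
    using L per dg ddg cddg by unfold_locales auto
  then show thesis by (rule that)
qed

text \<open>
The extension estimate for \<open>m \<ge> 2\<close> needs first derivatives of curvature and inverse speed; they exist
because the curve is then of class \<open>C\<^sup>3\<close>.
\<close>

lemma curve_coefficients:
  assumes "regular_closed_curve (m + 1) g \<xi>s \<xi>e" "2 \<le> m"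
  obtains w' k' B where
    "\<forall>\<xi>. ((\<lambda>t. 1 / norm (vderiv g t)) has_real_derivative w' \<xi>) (at \<xi>)"
    "\<forall>\<xi>. (curvature g has_real_derivative k' \<xi>) (at \<xi>)"
    "continuous_on UNIV w'" "continuous_on UNIV k'" "0 < B"
    "\<forall>\<xi>. \<bar>curvature g \<xi>\<bar> \<le> B" "\<forall>\<xi>. 1 / norm (vderiv g \<xi>) \<le> B" "\<forall>\<xi>. \<bar>w' \<xi>\<bar> \<le> B" "\<forall>\<xi>. \<bar>k' \<xi>\<bar> \<le> B"
proof -
  let ?L = "\<xi>e - \<xi>s"
  obtain \<gamma> \<Gamma> where "regular_curve g ?L \<gamma> \<Gamma>" using regular_closed_curve_imp[OF assms(1)] assms(2) by auto
  then interpret regular_curve g ?L \<gamma> \<Gamma> .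
  have Ck: "C_k (m + 1) g" using assms by (auto simp: regular_closed_curve_def)
  define d1 d2 d3 where "d1 = vderiv g" and "d2 = vderiv d1" and "d3 = vderiv d2"
  have diff: "((vderiv ^^ j) g) differentiable (at t)" if "j < m + 1" for j t
    using Ck that by (auto simp: C_k_def)
  have D1: "(d1 has_vector_derivative d2 t) (at t)" for t using ddg by (simp add: d1_def d2_def)
  have D2: "(d2 has_vector_derivative d3 t) (at t)" for t
    using diff[of 2 t] assms(2) by (simp add: d1_def d2_def d3_def vderiv_def vector_derivative_works numeral_2_eq_2)
  have c3: "continuous_on UNIV d3"
  proof (cases "m = 2")
    case True
    then show ?thesis using Ck by (simp add: C_k_def numeral_2_eq_2 d1_def d2_def d3_def)
  next
    case False
    then have "3 < m + 1" using assms(2) by simp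
    from diff[OF this] show ?thesis
      by (intro continuous_at_imp_continuous_on ballI differentiable_imp_continuous_within)
         (simp add: numeral_3_eq_3 d1_def d2_def d3_def)
  qed
  have c1: "continuous_on UNIV d1" and c2: "continuous_on UNIV d2"
    using continuous_on_velocity cddg by (simp_all add: d1_def d2_def)
  have p1: "d1 (t + ?L) = d1 t" for t unfolding d1_def by (rule vderiv_periodic[OF dg per])
  have p2: "d2 (t + ?L) = d2 t" for t unfolding d2_def using vderiv_periodic[OF D1[unfolded d2_def] p1] .
  have p3: "d3 (t + ?L) = d3 t" for t unfolding d3_def using vderiv_periodic[OF D2[unfolded d3_def] p2] .
  define N where "N t = norm (d1 t)" for t
  define N' where "N' t = (d1 t \<bullet> d2 t) / N t" for t
  have N: "N t > 0" for t using Npos by (simp add: N_def d1_def)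
  have cN: "continuous_on UNIV N" unfolding N_def[abs_def] by (intro continuous_intros c1)
  have cN': "continuous_on UNIV N'" unfolding N'_def[abs_def]
    by (intro continuous_intros c1 c2 cN) (use N in \<open>auto simp: less_imp_neq[symmetric]\<close>)
  have dN: "(N has_real_derivative N' t) (at t)" for t
    using speed_deriv[of t] by (simp add: N_def[abs_def] N'_def d1_def d2_def)
  define w' where "w' t = - N' t / (N t)\<^sup>2" for t
  have dw: "((\<lambda>t. 1 / N t) has_real_derivative w' t) (at t)" for t
    unfolding w'_def using N[of t] by (auto intro!: derivative_eq_intros dN simp: power2_eq_square)
  have cw: "continuous_on UNIV w'" unfolding w'_def[abs_def]
    by (intro continuous_intros cN cN') (use N in \<open>auto simp: less_imp_neq[symmetric]\<close>)
  have comp: "((\<lambda>t. fst (d1 t)) has_real_derivative fst (d2 t)) (at t)"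
     "((\<lambda>t. snd (d1 t)) has_real_derivative snd (d2 t)) (at t)"
     "((\<lambda>t. fst (d2 t)) has_real_derivative fst (d3 t)) (at t)"
     "((\<lambda>t. snd (d2 t)) has_real_derivative snd (d3 t)) (at t)" for t
    unfolding has_real_derivative_iff_has_vector_derivative
    by (intro bounded_linear.has_vector_derivative[OF bounded_linear_fst] bounded_linear.has_vector_derivative[OF bounded_linear_snd] D1 D2)+
  define k' where "k' t = ((fst (d1 t) * snd (d3 t) - snd (d1 t) * fst (d3 t)) * N t ^ 3
      - (fst (d1 t) * snd (d2 t) - snd (d1 t) * fst (d2 t)) * (3 * (N t)\<^sup>2 * N' t)) / (N t ^ 3 * N t ^ 3)" for t
  have keq: "curvature g = (\<lambda>t. (fst (d1 t) * snd (d2 t) - snd (d1 t) * fst (d2 t)) / N t ^ 3)"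
    by (simp add: fun_eq_iff curvature_def det2_def N_def d1_def d2_def)
  have dk: "(curvature g has_real_derivative k' t) (at t)" for t
    unfolding keq k'_def using N[of t]
    by (auto intro!: derivative_eq_intros comp dN simp: algebra_simps)
  have ck: "continuous_on UNIV k'" unfolding k'_def[abs_def]
    by (intro continuous_intros c1 c2 c3 cN cN') (use N in \<open>auto simp: less_imp_neq[symmetric]\<close>)
  obtain B1 where B1: "0 < B1" "\<And>t. norm (curvature g t) \<le> B1"
    using periodic_bounded[OF L continuous_on_curvature] by (auto simp: keq p1 p2 N_def)
  obtain B2 where B2: "0 < B2" "\<And>t. norm (w' t) \<le> B2"
    using periodic_bounded[OF L cw] by (auto simp: w'_def N'_def N_def p1 p2)
  obtain B3 where B3: "0 < B3" "\<And>t. norm (k' t) \<le> B3"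
    using periodic_bounded[OF L ck] by (auto simp: k'_def N'_def N_def p1 p2 p3)
  have B4: "1 / N t \<le> 1 / \<gamma>" for t using \<gamma>(2)[of t] \<gamma>(1) by (auto simp: N_def d1_def intro!: divide_left_mono mult_pos_pos Npos)
  define B where "B = B1 + B2 + B3 + 1 / \<gamma>"
  have "0 < 1 / \<gamma>" using \<gamma>(1) by simp
  have bounds: "\<bar>curvature g \<xi>\<bar> \<le> B" "\<bar>w' \<xi>\<bar> \<le> B" "\<bar>k' \<xi>\<bar> \<le> B" for \<xi>
    using B1(2)[of \<xi>] B2(2)[of \<xi>] B3(2)[of \<xi>] B1(1) B2(1) B3(1) \<open>0 < 1 / \<gamma>\<close>
    unfolding B_def real_norm_def by linarith+
  have speed: "1 / norm (vderiv g \<xi>) \<le> B" for \<xi>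
    using B4[of \<xi>] B1(1) B2(1) B3(1) by (simp add: B_def N_def d1_def)
  have "0 < B" unfolding B_def using B1(1) B2(1) B3(1) \<open>0 < 1 / \<gamma>\<close> by (intro add_pos_pos)
  have "\<forall>\<xi>. ((\<lambda>t. 1 / norm (vderiv g t)) has_real_derivative w' \<xi>) (at \<xi>)"
    using dw by (simp add: N_def d1_def)
  then show thesis
    using dk cw ck \<open>0 < B\<close> bounds speed by (intro that[of w' k' B]) auto
qed

section \<open>The Frenet chart of an element\<close>

text \<open>
One element \<open>cbox p q\<close> inside its fictitious element.  The bound \<open>\<xi>1 - \<xi>0 + h < L\<close> keeps the parameter
interval, even slightly enlarged, shorter than one period.
\<close>

locale frenet_element = regular_curve g L \<gamma> \<Gamma> for g L \<gamma> \<Gamma> +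
  fixes \<epsilon> \<xi>s h \<xi>0 \<xi>1 :: real and p q :: plane
  assumes inj: "inj_on (frenet g) ({-\<epsilon><..<\<epsilon>} \<times> {\<xi>s..<\<xi>s + L})"
    and h: "0 < h" "2 * h < \<epsilon>" "h * \<bar>curvature g t\<bar> \<le> 1 / 2"
    and len: "\<xi>0 \<le> \<xi>1" "\<xi>1 - \<xi>0 + h < L"
    and sub: "cbox p q \<subseteq> frenet g ` ({-h..h} \<times> {\<xi>0..\<xi>1})"
    and pq: "fst p < fst q" "snd p < snd q"
begin

text \<open>
Shifting both parameters by whole periods brings them into the window on which injectivity is assumed.
\<close>

lemma frenet_eq_iff_mod_period:
  assumes "\<bar>\<eta>\<bar> < \<epsilon>" "\<bar>\<eta>'\<bar> < \<epsilon>" "frenet g (\<eta>, \<xi>) = frenet g (\<eta>', \<xi>')"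
  shows "\<eta> = \<eta>' \<and> (\<exists>k::int. \<xi> = \<xi>' + of_int k * L)"
proof -
  define k where "k \<xi> = - \<lfloor>(\<xi> - \<xi>s) / L\<rfloor>" for \<xi>
  have k: "\<xi> + of_int (k \<xi>) * L \<in> {\<xi>s..<\<xi>s + L}" for \<xi>
    using floor_divide_lower[OF L, of "\<xi> - \<xi>s"] floor_divide_upper[OF L, of "\<xi> - \<xi>s"]
    by (simp add: k_def algebra_simps)
  have "frenet g (\<eta>, \<xi> + of_int (k \<xi>) * L) = frenet g (\<eta>', \<xi>' + of_int (k \<xi>') * L)"
    using assms(3) by (simp add: frenet_periodic)
  with inj have "(\<eta>, \<xi> + of_int (k \<xi>) * L) = (\<eta>', \<xi>' + of_int (k \<xi>') * L)"
    by (rule inj_onD) (use k assms in \<open>auto simp: abs_less_iff\<close>)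
  then have "\<eta> = \<eta>'" "\<xi> = \<xi>' + of_int (k \<xi>' - k \<xi>) * L" by (auto simp: algebra_simps)
  then show ?thesis by blast
qed

lemma frenet_inj_short:
  assumes "\<bar>\<eta>\<bar> < \<epsilon>" "\<bar>\<eta>'\<bar> < \<epsilon>" "\<bar>\<xi> - \<xi>'\<bar> < L" "frenet g (\<eta>, \<xi>) = frenet g (\<eta>', \<xi>')"
  shows "\<eta> = \<eta>' \<and> \<xi> = \<xi>'"
proof -
  obtain k :: int where k: "\<eta> = \<eta>'" "\<xi> = \<xi>' + of_int k * L"
    using frenet_eq_iff_mod_period[OF assms(1,2,4)] by blast
  have "\<bar>of_int k\<bar> * L < 1 * L" using assms(3) k(2) L by (simp add: abs_mult)
  then have "\<bar>real_of_int k\<bar> < 1" using L mult_less_cancel_right_pos by blast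
  then have "k = 0" by linarith
  with k show ?thesis by simp
qed

text \<open>
An open neighbourhood of \<open>[-h, h] \<times> [\<xi>0, \<xi>1]\<close> on which the Frenet map is injective and regular.  Being
open, it allows differentiating the inverse at every point of the closed element, also at points with
parameter \<open>\<xi>0\<close>, where the inverse on a half-open period window jumps.
\<close>

definition window :: "plane set" where
  "window = {-2*h<..<2*h} \<times> {\<xi>0 - (L - (\<xi>1 - \<xi>0)) / 2<..<\<xi>1 + (L - (\<xi>1 - \<xi>0)) / 2}"

definition chart_dom :: "plane set" where "chart_dom = frenet g ` window"

definition chart :: "plane \<Rightarrow> plane" where "chart = the_inv_into window (frenet g)"

lemma open_window: "open window" unfolding window_def by (intro open_Times) auto

lemma inj_window: "inj_on (frenet g) window"
proof (rule inj_onI)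
  fix x y assume xy: "x \<in> window" "y \<in> window" "frenet g x = frenet g y"
  obtain a b a' b' where ab: "x = (a, b)" "y = (a', b')" by fastforce
  have "a = a' \<and> b = b'"
    using xy h len unfolding ab window_def
    by (intro frenet_inj_short) (auto simp: abs_less_iff field_simps)
  then show "x = y" by (simp add: ab)
qed

lemma open_chart_dom: "open chart_dom"
  unfolding chart_dom_def
  by (intro invariance_of_domain open_window inj_window continuous_on_frenet)

lemma chart_frenet: "z \<in> window \<Longrightarrow> chart (frenet g z) = z"
  unfolding chart_def by (rule the_inv_into_f_f[OF inj_window])

lemma frenet_chart: "x \<in> chart_dom \<Longrightarrow> frenet g (chart x) = x"
  unfolding chart_def chart_dom_def by (rule f_the_inv_into_f[OF inj_window])

lemma chart_in_window: "x \<in> chart_dom \<Longrightarrow> chart x \<in> window"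
  using chart_frenet by (auto simp: chart_dom_def)

lemma KF_window: "{-h..h} \<times> {\<xi>0..\<xi>1} \<subseteq> window"
proof -
  define d where "d = (L - (\<xi>1 - \<xi>0)) / 2"
  have "0 < d" using h(1) len(2) by (simp add: d_def)
  then show ?thesis using h(1) unfolding window_def d_def[symmetric] by auto
qed

lemma K_chart_dom: "cbox p q \<subseteq> chart_dom"
  using sub KF_window by (auto simp: chart_dom_def)

lemma chart_K: "x \<in> cbox p q \<Longrightarrow> chart x \<in> {-h..h} \<times> {\<xi>0..\<xi>1}"
  using sub chart_frenet KF_window by force

lemma chart_K':
  assumes "x \<in> cbox p q"
  shows "\<bar>fst (chart x)\<bar> \<le> h" "\<xi>0 \<le> snd (chart x)" "snd (chart x) \<le> \<xi>1"
  using chart_K[OF assms] by (auto simp: mem_Times_iff abs_le_iff)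

lemma frenet_inv_eq_chart:
  assumes "x \<in> cbox p q" shows "frenet_inv g L \<epsilon> \<xi>0 x = chart x"
proof -
  have "inj_on (frenet g) ({-\<epsilon><..<\<epsilon>} \<times> {\<xi>0..<\<xi>0 + L})"
  proof (rule inj_onI)
    fix x y assume xy: "x \<in> {-\<epsilon><..<\<epsilon>} \<times> {\<xi>0..<\<xi>0 + L}" "y \<in> {-\<epsilon><..<\<epsilon>} \<times> {\<xi>0..<\<xi>0 + L}" "frenet g x = frenet g y"
    obtain a b a' b' where ab: "x = (a, b)" "y = (a', b')" by fastforce
    have "a = a' \<and> b = b'" using xy unfolding ab by (intro frenet_inj_short) (auto simp: abs_less_iff)
    then show "x = y" by (simp add: ab)
  qed
  moreover have "chart x \<in> {-\<epsilon><..<\<epsilon>} \<times> {\<xi>0..<\<xi>0 + L}" using chart_K[OF assms] h len by auto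
  moreover have "frenet g (chart x) = x" using frenet_chart K_chart_dom assms by blast
  ultimately show ?thesis unfolding frenet_inv_def by (metis the_inv_into_f_eq)
qed

text \<open>
The window has half-width \<open>2 h\<close> in \<open>\<eta>\<close>, and \<open>h \<bar>\<kappa>\<bar> \<le> 1/2\<close>.
\<close>

lemma jac_factor:
  assumes "z \<in> window" shows "0 < 1 + fst z * curvature g (snd z)"
proof -
  have "\<bar>fst z * curvature g (snd z)\<bar> < 1"
  proof (cases "curvature g (snd z) = 0")
    case False
    have "\<bar>fst z\<bar> < 2 * h" using assms by (auto simp: window_def)
    then have "\<bar>fst z\<bar> * \<bar>curvature g (snd z)\<bar> < (2 * h) * \<bar>curvature g (snd z)\<bar>"
      using False by (intro mult_strict_right_mono) auto
    then show ?thesis using h(3)[of "snd z"] by (simp add: abs_mult)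
  qed simp
  then show ?thesis by linarith
qed

text \<open>
The inverse of the Frenet derivative, written in the orthogonal frame of normal and velocity.
\<close>

definition dchart :: "plane \<Rightarrow> plane \<Rightarrow> plane" where
  "dchart x v = (let z = chart x; t = snd z in
     (v \<bullet> normal_vec g t, (v \<bullet> vderiv g t) / ((1 + fst z * curvature g t) * (norm (vderiv g t))\<^sup>2)))"

text \<open>
The Frenet map is injective on an open set and has an invertible derivative, so its inverse is differentiable;
continuity of the inverse is invariance of domain.
\<close>

lemma chart_deriv:
  assumes "x \<in> chart_dom" shows "(chart has_derivative dchart x) (at x)"
proof -
  define z where "z = chart x"
  have z: "z \<in> window" "frenet g z = x" using assms chart_in_window frenet_chart by (auto simp: z_def)
  have "(chart has_derivative dchart x) (at (frenet g z))"
  proof (rule has_derivative_inverse_strong[OF open_window z(1) continuous_on_frenet chart_frenet frenet_deriv])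
    show "(\<lambda>v. fst v *\<^sub>R normal_vec g (snd z) + (snd v * (1 + fst z * curvature g (snd z))) *\<^sub>R vderiv g (snd z)) \<circ> dchart x = id"
    proof
      fix v
      have "((v \<bullet> vderiv g (snd z)) / ((1 + fst z * curvature g (snd z)) * (norm (vderiv g (snd z)))\<^sup>2) * (1 + fst z * curvature g (snd z)))
          = (v \<bullet> vderiv g (snd z)) / (norm (vderiv g (snd z)))\<^sup>2"
        using jac_factor[OF z(1)] by simp
      then show "((\<lambda>v. fst v *\<^sub>R normal_vec g (snd z) + (snd v * (1 + fst z * curvature g (snd z))) *\<^sub>R vderiv g (snd z)) \<circ> dchart x) v = id v"
        using frame_decomposition[of v "snd z"] unfolding dchart_def Let_def z_def[symmetric] o_def by simp
    qed
  qed
  then show ?thesis unfolding z(2) .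
qed

lemma continuous_on_chart: "continuous_on chart_dom chart"
  by (intro continuous_at_imp_continuous_on ballI has_derivative_continuous[OF chart_deriv])

lemma jac_factor_K:
  assumes "x \<in> cbox p q"
  shows "1 / 2 \<le> 1 + fst (chart x) * curvature g (snd (chart x))"
    "1 + fst (chart x) * curvature g (snd (chart x)) \<le> 3 / 2"
proof -
  have "\<bar>fst (chart x) * curvature g (snd (chart x))\<bar> \<le> h * \<bar>curvature g (snd (chart x))\<bar>"
    unfolding abs_mult using chart_K'(1)[OF assms] by (intro mult_right_mono) auto
  then have "\<bar>fst (chart x) * curvature g (snd (chart x))\<bar> \<le> 1 / 2" using h(3) order.trans by blast
  then show "1 / 2 \<le> 1 + fst (chart x) * curvature g (snd (chart x))"
    "1 + fst (chart x) * curvature g (snd (chart x)) \<le> 3 / 2" by linarith+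
qed

text \<open>
The element is convex, so a bound for the derivative of the chart on the element is enough.
\<close>

lemma chart_lipschitz:
  assumes "x \<in> cbox p q" "y \<in> cbox p q"
  shows "norm (chart x - chart y) \<le> (1 + 2 / \<gamma>) * norm (x - y)"
proof (rule differentiable_bound[OF convex_box(1)])
  show "(chart has_derivative dchart x) (at x within cbox p q)" if "x \<in> cbox p q" for x
    using chart_deriv K_chart_dom that has_derivative_at_withinI by blast
  show "onorm (dchart x) \<le> 1 + 2 / \<gamma>" if x: "x \<in> cbox p q" for x
  proof (rule onorm_le)
    fix v
    define t where "t = snd (chart x)"
    have "norm (dchart x v) \<le> \<bar>v \<bullet> normal_vec g t\<bar> + \<bar>(v \<bullet> vderiv g t) / ((1 + fst (chart x) * curvature g t) * (norm (vderiv g t))\<^sup>2)\<bar>"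
      unfolding dchart_def Let_def t_def[symmetric] by (rule order.trans[OF norm_Pair_le]) simp
    also have "\<bar>v \<bullet> normal_vec g t\<bar> \<le> norm v"
      using Cauchy_Schwarz_ineq2[of v "normal_vec g t"] by (simp add: norm_normal)
    also have "\<bar>(v \<bullet> vderiv g t) / ((1 + fst (chart x) * curvature g t) * (norm (vderiv g t))\<^sup>2)\<bar>
       \<le> (norm v * norm (vderiv g t)) / ((1 / 2) * (norm (vderiv g t))\<^sup>2)"
      unfolding abs_divide abs_mult
      using Cauchy_Schwarz_ineq2[of v "vderiv g t"] jac_factor_K[OF x] Npos[of t]
      by (intro frac_le mult_mono) (auto simp: t_def)
    also have "\<dots> = 2 / norm (vderiv g t) * norm v" using Npos[of t] by (simp add: power2_eq_square)
    also have "\<dots> \<le> 2 / \<gamma> * norm v"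
      using \<gamma>(2)[of t] \<gamma>(1) Npos[of t] by (intro mult_right_mono divide_left_mono mult_pos_pos) auto
    finally show "norm (dchart x v) \<le> (1 + 2 / \<gamma>) * norm v" by (simp add: algebra_simps)
  qed
qed (use assms in auto)

lemma frenet_lipschitz:
  assumes "\<bar>\<eta>\<bar> \<le> 2 * h" "\<bar>\<eta>'\<bar> \<le> 2 * h"
  shows "norm (frenet g (\<eta>, \<xi>) - frenet g (\<eta>', \<xi>')) \<le> (1 + 2 * \<Gamma>) * norm ((\<eta>, \<xi>) - (\<eta>', \<xi>'))"
proof (rule differentiable_bound[of "{-2*h..2*h} \<times> UNIV"])
  show "convex ({-2*h..2*h} \<times> (UNIV :: real set))" by (intro convex_Times) auto
  fix z :: plane assume z: "z \<in> {-2*h..2*h} \<times> UNIV"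
  show "(frenet g has_derivative (\<lambda>v. fst v *\<^sub>R normal_vec g (snd z)
      + (snd v * (1 + fst z * curvature g (snd z))) *\<^sub>R vderiv g (snd z))) (at z within {-2*h..2*h} \<times> UNIV)"
    by (rule has_derivative_at_withinI[OF frenet_deriv])
  show "onorm (\<lambda>v. fst v *\<^sub>R normal_vec g (snd z)
      + (snd v * (1 + fst z * curvature g (snd z))) *\<^sub>R vderiv g (snd z)) \<le> 1 + 2 * \<Gamma>"
  proof (rule onorm_le)
    fix v :: plane
    have "\<bar>fst z * curvature g (snd z)\<bar> \<le> (2 * h) * \<bar>curvature g (snd z)\<bar>"
      unfolding abs_mult using z by (intro mult_right_mono) (auto simp: abs_le_iff mem_Times_iff)
    then have j: "\<bar>1 + fst z * curvature g (snd z)\<bar> \<le> 2" using h(3)[of "snd z"] by linarith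
    have "norm (fst v *\<^sub>R normal_vec g (snd z) + (snd v * (1 + fst z * curvature g (snd z))) *\<^sub>R vderiv g (snd z))
       \<le> \<bar>fst v\<bar> * 1 + (\<bar>snd v\<bar> * \<bar>1 + fst z * curvature g (snd z)\<bar>) * norm (vderiv g (snd z))"
      by (rule order.trans[OF norm_triangle_ineq]) (simp add: norm_normal abs_mult)
    also have "\<dots> \<le> norm v * 1 + (norm v * 2) * \<Gamma>"
      using norm_fst_le[of "fst v" "snd v"] norm_snd_le[of "snd v" "fst v"] j \<Gamma> \<Gamma>_pos
      by (intro add_mono mult_mono) auto
    finally show "norm (fst v *\<^sub>R normal_vec g (snd z) + (snd v * (1 + fst z * curvature g (snd z))) *\<^sub>R vderiv g (snd z))
       \<le> (1 + 2 * \<Gamma>) * norm v" by (simp add: algebra_simps)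
  qed
qed (use assms in auto)

lemma segment_avoids_curve:
  assumes "\<eta> \<noteq> 0" "\<bar>\<eta>\<bar> < \<epsilon>" shows "frenet g (\<eta>, \<xi>) \<notin> range g"
proof
  assume "frenet g (\<eta>, \<xi>) \<in> range g"
  then obtain t where "frenet g (\<eta>, \<xi>) = frenet g (0, t)" by (auto simp: frenet_def)
  from frenet_eq_iff_mod_period[OF _ _ this] assms h show False by auto
qed

text \<open>
In the element the sign of \<open>\<eta>\<close> tells the two subdomains apart.  The straight segment from \<open>g(\<xi>)\<close> along the
normal to the point stays in the convex domain and meets the curve only at its start, so it lies in a
single subdomain; close to the curve that subdomain is prescribed by the orientation of the normal.
\<close>

lemma side_of_interface:
  assumes split: "interface_splitting g \<xi>s (\<xi>s + L) a b \<Omega>p \<Omega>m"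
    and x: "x \<in> cbox p q" "x \<in> box a b"
  shows "0 < fst (chart x) \<Longrightarrow> x \<in> \<Omega>p" "fst (chart x) < 0 \<Longrightarrow> x \<in> \<Omega>m"
proof -
  have rg: "g t \<in> g ` {\<xi>s..\<xi>s + L}" for t
  proof -
    define k where "k = - \<lfloor>(t - \<xi>s) / L\<rfloor>"
    have "t + of_int k * L \<in> {\<xi>s..\<xi>s + L}"
      using floor_divide_lower[OF L, of "t - \<xi>s"] floor_divide_upper[OF L, of "t - \<xi>s"]
      by (simp add: k_def algebra_simps)
    moreover have "g (t + of_int k * L) = g t" using frenet_periodic[of 0 t k] by (simp add: frenet_def)
    ultimately show ?thesis by (metis imageI)
  qed
  have gbox: "g t \<in> box a b" for t using split rg by (auto simp: interface_splitting_def)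
  define \<eta> t where "\<eta> = fst (chart x)" and "t = snd (chart x)"
  have x_eq: "x = g t + \<eta> *\<^sub>R normal_vec g t"
    using frenet_chart[of x] K_chart_dom x(1) by (auto simp: frenet_def \<eta>_def t_def case_prod_beta)
  have \<eta>: "\<bar>\<eta>\<bar> < \<epsilon>" using chart_K'(1)[OF x(1)] h by (simp add: \<eta>_def)
  define \<sigma> where "\<sigma> = sgn \<eta>"
  \<comment> \<open>The segment without its foot on the curve.\<close>
  define S where "S = (\<lambda>s. frenet g (\<sigma> * s, t)) ` {0<..\<bar>\<eta>\<bar>}"
  have conn: "connected S" unfolding S_def
    by (intro connected_continuous_image continuous_on_compose2[OF continuous_on_frenet[of UNIV]] continuous_intros) auto
  have Sbox: "S \<subseteq> box a b"
  proof
    fix y assume "y \<in> S"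
    then obtain s where s: "0 < s" "s \<le> \<bar>\<eta>\<bar>" and y: "y = frenet g (\<sigma> * s, t)" by (auto simp: S_def)
    have "\<bar>\<eta>\<bar> > 0" using s by linarith
    have "y = (1 - s / \<bar>\<eta>\<bar>) *\<^sub>R g t + (s / \<bar>\<eta>\<bar>) *\<^sub>R x"
    proof -
      have "(s / \<bar>\<eta>\<bar>) * \<eta> = \<sigma> * s" using \<open>\<bar>\<eta>\<bar> > 0\<close> by (simp add: \<sigma>_def sgn_if field_simps)
      then show ?thesis unfolding y x_eq frenet_def by (simp add: scaleR_add_right scaleR_diff_left)
    qed
    then show "y \<in> box a b"
      using convexD_alt[OF convex_box(2) gbox x(2), of "s / \<bar>\<eta>\<bar>"] s \<open>\<bar>\<eta>\<bar> > 0\<close> by simp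
  qed
  have Sg: "S \<inter> g ` {\<xi>s..\<xi>s + L} = {}"
  proof -
    have "frenet g (\<sigma> * s, t) \<notin> range g" if "0 < s" "s \<le> \<bar>\<eta>\<bar>" for s
    proof (rule segment_avoids_curve)
      show "\<sigma> * s \<noteq> 0" "\<bar>\<sigma> * s\<bar> < \<epsilon>" using that \<eta> by (auto simp: \<sigma>_def sgn_if abs_mult)
    qed
    then have "S \<subseteq> - range g" unfolding S_def by (intro image_subsetI) (simp only: Compl_iff greaterThanAtMost_iff not_False_eq_True)
    then show ?thesis by auto
  qed
  have un: "\<Omega>p \<union> \<Omega>m = box a b - g ` {\<xi>s..\<xi>s + L}" "\<Omega>p \<inter> \<Omega>m = {}" "open \<Omega>p" "open \<Omega>m"
    using split by (auto simp: interface_splitting_def)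
  have cov: "S \<subseteq> \<Omega>p \<union> \<Omega>m" using un Sbox Sg by auto
  have one: "\<Omega>p \<inter> S = {} \<or> \<Omega>m \<inter> S = {}"
    using connectedD[OF conn un(3,4)] un(2) cov by auto
  have near: "\<forall>\<^sub>F \<eta> in at_right 0. frenet g (\<eta>, t) \<in> \<Omega>p \<and> frenet g (- \<eta>, t) \<in> \<Omega>m"
    using split by (auto simp: interface_splitting_def)
  then obtain d where d: "d > 0" "\<And>s. 0 < s \<Longrightarrow> s < d \<Longrightarrow> frenet g (s, t) \<in> \<Omega>p \<and> frenet g (- s, t) \<in> \<Omega>m"
    by (auto simp: eventually_at_right_field)
  define s where "s = min \<bar>\<eta>\<bar> (d / 2)"
  have xS: "x \<in> S" if "\<eta> \<noteq> 0"
    unfolding S_def using that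
    by (intro image_eqI[of _ _ "\<bar>\<eta>\<bar>"]) (auto simp: frenet_def x_eq \<sigma>_def sgn_if)
  show "x \<in> \<Omega>p" if "0 < fst (chart x)"
  proof -
    have "\<eta> > 0" using that by (simp add: \<eta>_def)
    then have "0 < s" "s < d" "s \<le> \<bar>\<eta>\<bar>" "\<sigma> = 1" using d by (auto simp: s_def \<sigma>_def)
    then have "frenet g (s, t) \<in> S \<inter> \<Omega>p" using d(2)[of s] by (auto simp: S_def intro!: image_eqI[of _ _ s])
    then show ?thesis using one xS \<open>\<eta> > 0\<close> cov by auto
  qed
  show "x \<in> \<Omega>m" if "fst (chart x) < 0"
  proof -
    have "\<eta> < 0" using that by (simp add: \<eta>_def)
    then have "0 < s" "s < d" "s \<le> \<bar>\<eta>\<bar>" "\<sigma> = -1" using d by (auto simp: s_def \<sigma>_def)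
    then have "frenet g (- s, t) \<in> S \<inter> \<Omega>m" using d(2)[of s] by (auto simp: S_def intro!: image_eqI[of _ _ s])
    then show ?thesis using one xS \<open>\<eta> < 0\<close> cov by auto
  qed
qed

text \<open>
The slopes are taken in the rescaled variables; the derivatives in \<open>\<eta>\<close> and \<open>\<xi>\<close> are \<open>1/h\<close> times as large.
\<close>

definition slope_s :: "nat \<Rightarrow> (nat \<Rightarrow> real poly) \<Rightarrow> plane \<Rightarrow> real" where
  "slope_s m u z = dsum_s m u (fst z / h) ((snd z - \<xi>0) / h)"

definition slope_t :: "nat \<Rightarrow> (nat \<Rightarrow> real poly) \<Rightarrow> plane \<Rightarrow> real" where
  "slope_t m u z = dsum_t m u (fst z / h) ((snd z - \<xi>0) / h)"

text \<open>
The gradient of \<open>p \<circ> R\<close>, where \<open>p\<close> is the polynomial with layers \<open>u\<close>.  It is defined and continuous on both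
sides of the interface, whereas the gradient of the immersed function agrees with it on one side only.
\<close>

definition chart_grad :: "nat \<Rightarrow> (nat \<Rightarrow> real poly) \<Rightarrow> plane \<Rightarrow> plane" where
  "chart_grad m u x = (let z = chart x; t = snd z in
     (slope_s m u z / h) *\<^sub>R normal_vec g t
     + (slope_t m u z / h / ((1 + fst z * curvature g t) * (norm (vderiv g t))\<^sup>2)) *\<^sub>R vderiv g t)"

lemma scaled_poly_deriv:
  "(scaled_poly m h \<xi>0 u has_derivative
     (\<lambda>v. fst v * (slope_s m u z / h) + snd v * (slope_t m u z / h))) (at z)"
proof -
  have D: "((\<lambda>z. \<Sum>i\<le>m. (fst z / h) ^ i * poly (u i) ((snd z - \<xi>0) / h)) has_derivative
     (\<lambda>v. \<Sum>i\<le>m. (fst z / h) ^ i * (poly (pderiv (u i)) ((snd z - \<xi>0) / h) * (snd v / h))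
        + (real i * (fst v / h) * (fst z / h) ^ (i - 1)) * poly (u i) ((snd z - \<xi>0) / h))) (at z)"
  proof (intro has_derivative_sum has_derivative_mult)
    fix i
    have a: "((\<lambda>z. fst z / h) has_derivative (\<lambda>v. fst v / h)) (at z)" for z :: plane
      using h by (auto intro!: derivative_eq_intros)
    show "((\<lambda>z. (fst z / h) ^ i) has_derivative (\<lambda>v. real i * (fst v / h) * (fst z / h) ^ (i - 1))) (at z)"
      using has_derivative_power[OF a[of z], of i] by (simp add: mult_ac)
    have b: "((\<lambda>z. (snd z - \<xi>0) / h) has_derivative (\<lambda>v. snd v / h)) (at z)" for z :: plane
      using h by (auto intro!: derivative_eq_intros)
    show "((\<lambda>z. poly (u i) ((snd z - \<xi>0) / h)) has_derivative (\<lambda>v. poly (pderiv (u i)) ((snd z - \<xi>0) / h) * (snd v / h))) (at z)"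
      using has_derivative_compose[OF b poly_DERIV[unfolded has_field_derivative_def]] .
  qed
  have e1: "(\<lambda>z. \<Sum>i\<le>m. (fst z / h) ^ i * poly (u i) ((snd z - \<xi>0) / h)) = scaled_poly m h \<xi>0 u"
    by (rule ext) (auto simp: scaled_poly_eq)
  have e2: "(\<lambda>v. \<Sum>i\<le>m. (fst z / h) ^ i * (poly (pderiv (u i)) ((snd z - \<xi>0) / h) * (snd v / h))
        + (real i * (fst v / h) * (fst z / h) ^ (i - 1)) * poly (u i) ((snd z - \<xi>0) / h))
     = (\<lambda>v. fst v * (slope_s m u z / h) + snd v * (slope_t m u z / h))"
  proof
    fix v :: plane
    show "(\<Sum>i\<le>m. (fst z / h) ^ i * (poly (pderiv (u i)) ((snd z - \<xi>0) / h) * (snd v / h))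
        + (real i * (fst v / h) * (fst z / h) ^ (i - 1)) * poly (u i) ((snd z - \<xi>0) / h))
     = fst v * (slope_s m u z / h) + snd v * (slope_t m u z / h)"
      unfolding slope_s_def slope_t_def dsum_s_def dsum_t_def layer_sum_def sum_divide_distrib sum_distrib_left sum.distrib[symmetric]
      by (rule sum.cong) (auto simp: algebra_simps)
  qed
  show ?thesis using D unfolding e1 e2 .
qed

lemma gderiv_chart:
  assumes "x \<in> chart_dom"
  shows "GDERIV (\<lambda>x. scaled_poly m h \<xi>0 u (chart x)) x :> chart_grad m u x"
  unfolding gderiv_def
  by (rule has_derivative_eq_rhs[OF has_derivative_compose[OF chart_deriv[OF assms] scaled_poly_deriv]])
     (simp add: fun_eq_iff chart_grad_def dchart_def Let_def inner_add_right mult_ac)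

lemma grad_eqI:
  assumes "GDERIV f x :> D" shows "grad f x = D"
proof -
  have "D' = D" if "GDERIV f x :> D'" for D'
  proof -
    have "(\<lambda>v. v \<bullet> D') = (\<lambda>v. v \<bullet> D)"
      using assms that unfolding gderiv_def by (rule has_derivative_unique[rotated])
    then show ?thesis by (metis inner_commute vector_eq_ldot)
  qed
  then show ?thesis unfolding grad_def using assms by blast
qed

lemma grad_eq_chart_grad:
  assumes "open U" "x \<in> U" "U \<subseteq> chart_dom" "\<And>y. y \<in> U \<Longrightarrow> \<phi> y = scaled_poly m h \<xi>0 u (chart y)"
  shows "grad \<phi> x = chart_grad m u x"
proof (rule grad_eqI)
  have "x \<in> chart_dom" using assms by auto
  from gderiv_chart[OF this, of m u] show "GDERIV \<phi> x :> chart_grad m u x"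
    unfolding gderiv_def
    by (rule has_derivative_transform_within_open[OF _ assms(1,2)]) (simp add: assms(4))
qed

lemma continuous_on_chart_grad: "continuous_on chart_dom (chart_grad m u)"
proof -
  have 1: "continuous_on chart_dom (\<lambda>x. fst (chart x))" "continuous_on chart_dom (\<lambda>x. snd (chart x))"
    by (intro continuous_intros continuous_on_chart)+
  have c: "continuous_on chart_dom (\<lambda>x. f (snd (chart x)))" if "continuous_on UNIV f" for f :: "real \<Rightarrow> 'x::topological_space"
    using continuous_on_compose2[OF that 1(2)] by simp
  have nz: "(1 + fst (chart x) * curvature g (snd (chart x))) * (norm (vderiv g (snd (chart x))))\<^sup>2 \<noteq> 0" if "x \<in> chart_dom" for x
    using jac_factor[OF chart_in_window[OF that]] Npos[of "snd (chart x)"] by auto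
  have arg: "continuous_on chart_dom (\<lambda>x. fst (chart x) / h)" "continuous_on chart_dom (\<lambda>x. (snd (chart x) - \<xi>0) / h)"
    using h(1) by (auto intro!: continuous_on_divide continuous_on_diff 1)
  have P: "continuous_on chart_dom (\<lambda>x. poly r ((snd (chart x) - \<xi>0) / h))" for r
    by (rule continuous_on_poly[OF arg(2)])
  have S: "continuous_on chart_dom (\<lambda>x. slope_s m u (chart x) / h)"
    unfolding slope_s_def dsum_s_def layer_sum_def using h(1)
    by (intro continuous_on_divide continuous_on_sum continuous_on_mult continuous_on_const continuous_on_power arg P) auto
  have T: "continuous_on chart_dom (\<lambda>x. slope_t m u (chart x) / h)"
    unfolding slope_t_def dsum_t_def layer_sum_def using h(1)
    by (intro continuous_on_divide continuous_on_sum continuous_on_mult continuous_on_const continuous_on_power arg P) auto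
  show ?thesis
    unfolding chart_grad_def[abs_def] Let_def
    by (intro continuous_on_add continuous_on_scaleR S T continuous_on_divide[OF T] continuous_on_mult continuous_on_power
        continuous_on_norm continuous_on_const 1 c continuous_on_normal continuous_on_velocity continuous_on_curvature ballI nz)
qed

end

lemma mem_box_plane:
  fixes x p q :: plane
  shows "x \<in> box p q \<longleftrightarrow> fst p < fst x \<and> fst x < fst q \<and> snd p < snd x \<and> snd x < snd q"
  by (auto simp: mem_box Basis_prod_def inner_prod_def)

lemma norm_frame_combination:
  assumes "regular_curve g L \<gamma> \<Gamma>"
  shows "(norm (a *\<^sub>R normal_vec g t + b *\<^sub>R vderiv g t))\<^sup>2 = a\<^sup>2 + (b * norm (vderiv g t))\<^sup>2"
proof -
  interpret regular_curve g L \<gamma> \<Gamma> by (rule assms)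
  have nn: "normal_vec g t \<bullet> normal_vec g t = 1"
    using norm_normal[of t] by (metis norm_eq_1)
  show ?thesis
    unfolding power2_norm_eq_inner
    by (simp add: inner_add_left inner_add_right frame_orthogonal inner_commute[of "vderiv g t" "normal_vec g t"]
        nn power_mult_distrib power2_norm_eq_inner power2_eq_square[of a] power2_eq_square[of b] mult.assoc)
qed

section \<open>Bounds for gradients and traces\<close>

text \<open>
Such zeros are isolated, so each has a rational interval in which it is the only one.
\<close>

lemma countable_transversal_zeros:
  "countable {s::real. \<phi> s = (0::real) \<and> (\<exists>D. D \<noteq> 0 \<and> (\<phi> has_real_derivative D) (at s))}" (is "countable ?Z")
proof -
  define P :: "real \<Rightarrow> rat \<times> rat \<Rightarrow> bool" where
    "P s ab \<longleftrightarrow> real_of_rat (fst ab) < s \<and> s < real_of_rat (snd ab)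
       \<and> (\<forall>t. real_of_rat (fst ab) < t \<longrightarrow> t < real_of_rat (snd ab) \<longrightarrow> \<phi> t = 0 \<longrightarrow> t = s)" for s ab
  have ex: "\<exists>ab. P s ab" if "s \<in> ?Z" for s
  proof -
    from that obtain D where D: "\<phi> s = 0" "D \<noteq> 0" "(\<phi> has_real_derivative D) (at s)" by auto
    have "((\<lambda>t. (\<phi> t - \<phi> s) / (t - s)) \<longlongrightarrow> D) (at s)"
      using D(3) by (simp add: has_field_derivative_iff)
    then have "\<forall>\<^sub>F t in at s. (\<phi> t - \<phi> s) / (t - s) \<noteq> 0" by (rule tendsto_imp_eventually_ne) fact
    then obtain d where d: "d > 0" "\<forall>t. t \<noteq> s \<and> dist t s < d \<longrightarrow> (\<phi> t - \<phi> s) / (t - s) \<noteq> 0"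
      unfolding eventually_at by blast
    obtain a where a: "s - d < real_of_rat a" "real_of_rat a < s" using of_rat_dense[of "s - d" s] d(1) by auto
    obtain b where b: "s < real_of_rat b" "real_of_rat b < s + d" using of_rat_dense[of s "s + d"] d(1) by auto
    have "t = s" if t: "real_of_rat a < t" "t < real_of_rat b" "\<phi> t = 0" for t
    proof (rule ccontr)
      assume "t \<noteq> s"
      moreover have "dist t s < d" unfolding dist_real_def using a b t by linarith
      ultimately have "(\<phi> t - \<phi> s) / (t - s) \<noteq> 0" using d(2) by blast
      then show False using t(3) D(1) by simp
    qed
    then have "P s (a, b)" using a b unfolding P_def fst_conv snd_conv by blast
    then show ?thesis by blast
  qed
  define A where "A s = (SOME ab. P s ab)" for s
  have A: "P s (A s)" if "s \<in> ?Z" for s unfolding A_def using ex[OF that] by (rule someI_ex)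
  have "inj_on A ?Z"
  proof (rule inj_onI)
    fix s t assume s: "s \<in> ?Z" and t: "t \<in> ?Z" and eq: "A s = A t"
    have "\<phi> t = 0" using t by simp
    moreover have "real_of_rat (fst (A t)) < t" "t < real_of_rat (snd (A t))" using A[OF t] by (simp_all add: P_def)
    moreover have "P s (A t)" using A[OF s] eq by simp
    ultimately have "t = s" unfolding P_def by blast
    then show "s = t" by simp
  qed
  then show ?thesis by (rule countableI')
qed

context frenet_element
begin

lemma chart_grad_norm_sq:
  assumes "x \<in> cbox p q"
  shows "(norm (chart_grad m u x))\<^sup>2
    = (slope_s m u (chart x) / h)\<^sup>2
    + (slope_t m u (chart x) / h
        / ((1 + fst (chart x) * curvature g (snd (chart x))) * norm (vderiv g (snd (chart x)))))\<^sup>2"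
  unfolding chart_grad_def Let_def norm_frame_combination[OF regular_curve_axioms]
  using Npos[of "snd (chart x)"] by (simp add: power2_eq_square)

lemma chart_grad_upper:
  assumes x: "x \<in> cbox p q" and deg: "\<And>i. degree (u i) \<le> m" and T: "1 \<le> T" "\<xi>1 - \<xi>0 \<le> T * h"
  shows "norm (chart_grad m u x) \<le> (1 + 2 / \<gamma>) * (real (m + 1) * T ^ m) * (grad_size m u / h)"
proof -
  define M where "M = real (m + 1) * T ^ m * grad_size m u"
  define s t where "s = fst (chart x) / h" and "t = (snd (chart x) - \<xi>0) / h"
  define N where "N = norm (vderiv g (snd (chart x)))"
  have st: "\<bar>s\<bar> \<le> 1" "\<bar>t\<bar> \<le> T"
    using chart_K'[OF x] h(1) T by (auto simp: s_def t_def field_simps)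
  have M: "\<bar>dsum_s m u s t\<bar> \<le> M" "\<bar>dsum_t m u s t\<bar> \<le> M"
    unfolding M_def by (rule dsum_upper[OF deg st T(1)])+
  have M0: "0 \<le> M" using M(1) by linarith
  define J where "J = (1 + fst (chart x) * curvature g (snd (chart x))) * N"
  have J: "\<gamma> / 2 \<le> J"
    using mult_mono[OF jac_factor_K(1)[OF x] \<gamma>(2)[of "snd (chart x)"]] \<gamma>(1) jac_factor_K(1)[OF x] by (simp add: J_def N_def)
  have sq: "a\<^sup>2 + b\<^sup>2 \<le> (\<bar>a\<bar> + \<bar>b\<bar>)\<^sup>2" for a b :: real
    by (simp add: power2_sum)
  have "(norm (chart_grad m u x))\<^sup>2 = (dsum_s m u s t / h)\<^sup>2 + (dsum_t m u s t / h / J)\<^sup>2"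
    unfolding chart_grad_norm_sq[OF x] slope_s_def slope_t_def s_def t_def J_def N_def ..
  also have "\<dots> \<le> (\<bar>dsum_s m u s t / h\<bar> + \<bar>dsum_t m u s t / h / J\<bar>)\<^sup>2"
    by (rule sq)
  finally have "norm (chart_grad m u x) \<le> \<bar>dsum_s m u s t / h\<bar> + \<bar>dsum_t m u s t / h / J\<bar>"
    by (rule power2_le_imp_le) simp
  also have "\<bar>dsum_s m u s t / h\<bar> \<le> M / h" using M(1) h(1) by (simp add: divide_right_mono)
  also have "\<bar>dsum_t m u s t / h / J\<bar> \<le> M / h / (\<gamma> / 2)"
    unfolding abs_divide using M(2) M0 h(1) J \<gamma>(1) by (intro frac_le divide_right_mono) auto
  finally show ?thesis by (simp add: M_def algebra_simps add_divide_distrib)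
qed

lemma chart_grad_lower:
  assumes x: "x \<in> cbox p q"
  shows "\<bar>slope_s m u (chart x)\<bar> / h \<le> norm (chart_grad m u x)"
    and "\<bar>slope_t m u (chart x)\<bar> / h / (2 * \<Gamma>) \<le> norm (chart_grad m u x)"
proof -
  define ds dt where "ds = slope_s m u (chart x)"
    and "dt = slope_t m u (chart x)"
  define N where "N = norm (vderiv g (snd (chart x)))"
  define J where "J = (1 + fst (chart x) * curvature g (snd (chart x))) * N"
  have eq: "(norm (chart_grad m u x))\<^sup>2 = (ds / h)\<^sup>2 + (dt / h / J)\<^sup>2"
    unfolding chart_grad_norm_sq[OF x] ds_def dt_def J_def N_def ..
  have "(\<bar>ds\<bar> / h)\<^sup>2 \<le> (norm (chart_grad m u x))\<^sup>2" unfolding eq by (simp add: power_divide)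
  then show "\<bar>ds\<bar> / h \<le> norm (chart_grad m u x)" by (rule power2_le_imp_le) simp
  have "0 < J" "J \<le> 2 * \<Gamma>"
  proof -
    have "J \<le> (3 / 2) * \<Gamma>" unfolding J_def N_def
      using jac_factor_K[OF x] \<Gamma> Npos[of "snd (chart x)"] by (intro mult_mono) auto
    then show "J \<le> 2 * \<Gamma>" using \<Gamma>_pos by simp
    show "0 < J" unfolding J_def N_def using jac_factor_K(1)[OF x] Npos[of "snd (chart x)"] by simp
  qed
  have "(\<bar>dt\<bar> / h / J)\<^sup>2 \<le> (norm (chart_grad m u x))\<^sup>2" unfolding eq by (simp add: power_divide)
  then have "\<bar>dt\<bar> / h / J \<le> norm (chart_grad m u x)" by (rule power2_le_imp_le) simp
  moreover have "\<bar>dt\<bar> / h / (2 * \<Gamma>) \<le> \<bar>dt\<bar> / h / J"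
    using \<open>0 < J\<close> \<open>J \<le> 2 * \<Gamma>\<close> h(1) by (intro divide_left_mono) auto
  ultimately show "\<bar>dt\<bar> / h / (2 * \<Gamma>) \<le> norm (chart_grad m u x)" by simp
qed

lemma signed_distance_deriv:
  assumes "(X has_vector_derivative e) (at s)" "X s \<in> chart_dom"
  shows "((\<lambda>s. fst (chart (X s))) has_real_derivative e \<bullet> normal_vec g (snd (chart (X s)))) (at s)"
proof -
  have "((\<lambda>s. chart (X s)) has_derivative (\<lambda>v. dchart (X s) (v *\<^sub>R e))) (at s)"
    using has_derivative_compose[OF assms(1)[unfolded has_vector_derivative_def] chart_deriv[OF assms(2)]] .
  then have "((\<lambda>s. fst (chart (X s))) has_derivative (\<lambda>v. fst (dchart (X s) (v *\<^sub>R e)))) (at s)"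
    by (rule has_derivative_fst)
  then show ?thesis
    unfolding has_field_derivative_def
    by (rule has_derivative_eq_rhs) (simp add: dchart_def Let_def fun_eq_iff mult.commute)
qed

abbreviation center :: plane where "center \<equiv> midpoint p q"

lemma center_box: "center \<in> box p q"
  using pq by (simp add: mem_box_plane midpoint_def)

text \<open>
If the point lies off the interface, or if the segment to the centre crosses the interface transversally,
then the start of the segment lies on one side, where the field has a continuous extension.
\<close>

lemma inner_trace_le:
  assumes x: "x \<in> cbox p q" "x \<noteq> center"
    and transversal: "fst (chart x) \<noteq> 0 \<or> (center - x) \<bullet> normal_vec g (snd (chart x)) \<noteq> 0"
    and F: "\<And>y. y \<in> box p q \<Longrightarrow> 0 < fst (chart y) \<Longrightarrow> F y = Gp y"
      "\<And>y. y \<in> box p q \<Longrightarrow> fst (chart y) < 0 \<Longrightarrow> F y = Gm y"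
    and G: "continuous_on chart_dom Gp" "continuous_on chart_dom Gm"
    and M: "norm (Gp x) \<le> M" "norm (Gm x) \<le> M"
  shows "norm (inner_trace center F x) \<le> M"
proof -
  define y where "y t = x + t *\<^sub>R (center - x)" for t :: real
  have x_dom: "x \<in> chart_dom" using x K_chart_dom by blast
  have dy: "(y has_vector_derivative (center - x)) (at t)" for t
    unfolding y_def has_vector_derivative_def by (auto intro!: derivative_eq_intros)
  have y0: "y 0 = x" by (simp add: y_def)
  have ybox: "y t \<in> box p q" if "0 < t" "t \<le> 1" for t
  proof -
    have "x - t *\<^sub>R (x - center) \<in> interior (cbox p q)"
      using mem_interior_closure_convex_shrink[of "cbox p q" center x t] center_box x that by simp
    then show ?thesis by (simp add: y_def algebra_simps)
  qed
  define f where "f t = fst (chart (y t))" for t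
  have df: "(f has_real_derivative (center - x) \<bullet> normal_vec g (snd (chart x))) (at 0)"
    using signed_distance_deriv[OF dy, of 0] x_dom by (simp add: y0 f_def[abs_def])
  have cf: "(f \<longlongrightarrow> f 0) (at_right 0)"
    using DERIV_isCont[OF df] by (auto simp: isCont_def intro: tendsto_within_subset)
  have ev1: "\<forall>\<^sub>F t in at_right (0::real). t \<le> 1 \<and> 0 < t"
    by (auto simp: eventually_at_right_field intro!: exI[of _ 1])
  have lim: "((\<lambda>t. G (y t)) \<longlongrightarrow> G x) (at_right 0)" if "continuous_on chart_dom G" for G :: "plane \<Rightarrow> plane"
  proof -
    have "isCont G x" using that x_dom open_chart_dom continuous_on_eq_continuous_at by blast
    moreover have "(y \<longlongrightarrow> x) (at_right 0)"
      using has_vector_derivative_continuous[OF dy, of 0] y0 by (auto simp: continuous_at intro: tendsto_within_subset)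
    ultimately show ?thesis by (rule isCont_tendsto_compose)
  qed
  have "(\<forall>\<^sub>F t in at_right 0. 0 < f t) \<or> (\<forall>\<^sub>F t in at_right 0. f t < 0)"
  proof (cases "f 0 = 0")
    case False
    then consider "0 < f 0" | "f 0 < 0" by linarith
    then show ?thesis using order_tendstoD(1)[OF cf, of 0] order_tendstoD(2)[OF cf, of 0] by cases simp_all
  next
    case True
    with transversal have D: "(center - x) \<bullet> normal_vec g (snd (chart x)) \<noteq> 0" (is "?D \<noteq> 0") by (simp add: f_def y0)
    then consider "?D > 0" | "?D < 0" by linarith
    then show ?thesis
    proof cases
      case 1
      obtain d where "d > 0" "\<forall>t>0. t < d \<longrightarrow> f 0 < f (0 + t)" using DERIV_pos_inc_right[OF df 1] by auto
      then show ?thesis using True by (auto simp: eventually_at_right_field)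
    next
      case 2
      obtain d where "d > 0" "\<forall>t>0. t < d \<longrightarrow> f 0 > f (0 + t)" using DERIV_neg_dec_right[OF df 2] by auto
      then show ?thesis using True by (auto simp: eventually_at_right_field)
    qed
  qed
  then show ?thesis
  proof
    assume "\<forall>\<^sub>F t in at_right 0. 0 < f t"
    then have "\<forall>\<^sub>F t in at_right 0. Gp (y t) = F (y t)"
      using ev1 by eventually_elim (use F(1) ybox in \<open>auto simp: f_def\<close>)
    from Lim_transform_eventually[OF lim[OF G(1)] this] have "inner_trace center F x = Gp x"
      unfolding inner_trace_def y_def by (intro tendsto_Lim) auto
    then show ?thesis using M by simp
  next
    assume "\<forall>\<^sub>F t in at_right 0. f t < 0"
    then have "\<forall>\<^sub>F t in at_right 0. Gm (y t) = F (y t)"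
      using ev1 by eventually_elim (use F(2) ybox in \<open>auto simp: f_def\<close>)
    from Lim_transform_eventually[OF lim[OF G(2)] this] have "inner_trace center F x = Gm x"
      unfolding inner_trace_def y_def by (intro tendsto_Lim) auto
    then show ?thesis using M by simp
  qed
qed

text \<open>
At a point where the interface touches the edge and is also tangent to the segment to the centre, the edge
is transversal to the interface, as the normal cannot annihilate two independent directions.  Such points are
transversal zeros of \<open>\<eta>\<close> along the edge, hence countably many.
\<close>

lemma edge_integral_le:
  assumes X: "\<And>s. (X has_vector_derivative e) (at s)" "\<And>s. s \<in> {\<alpha>..\<beta>} \<Longrightarrow> X s \<in> cbox p q"
    and indep: "\<And>s. s \<in> {\<alpha>..\<beta>} \<Longrightarrow> det2 e (center - X s) \<noteq> 0" and "\<alpha> \<le> \<beta>"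
    and F: "\<And>y. y \<in> box p q \<Longrightarrow> 0 < fst (chart y) \<Longrightarrow> F y = Gp y"
      "\<And>y. y \<in> box p q \<Longrightarrow> fst (chart y) < 0 \<Longrightarrow> F y = Gm y"
    and G: "continuous_on chart_dom Gp" "continuous_on chart_dom Gm"
    and M: "\<And>y. y \<in> cbox p q \<Longrightarrow> norm (Gp y) \<le> M" "\<And>y. y \<in> cbox p q \<Longrightarrow> norm (Gm y) \<le> M"
  shows "(LINT s:{\<alpha>..\<beta>}|lebesgue. (norm (inner_trace center F (X s)))\<^sup>2) \<le> (\<beta> - \<alpha>) * M\<^sup>2"
proof -
  define Z where "Z = {s. fst (chart (X s)) = 0 \<and> (\<exists>D. D \<noteq> 0 \<and> ((\<lambda>s. fst (chart (X s))) has_real_derivative D) (at s))}"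
  have "countable Z" unfolding Z_def by (rule countable_transversal_zeros)
  then have Z: "Z \<in> null_sets lebesgue"
    by (intro null_sets_completionI countable_imp_null_set_lborel)
  have le: "(norm (inner_trace center F (X s)))\<^sup>2 \<le> M\<^sup>2" if s: "s \<in> {\<alpha>..\<beta>}" "s \<notin> Z" for s
  proof -
    note Xs = X(2)[OF s(1)]
    define n where "n = normal_vec g (snd (chart (X s)))"
    have "fst (chart (X s)) \<noteq> 0 \<or> (center - X s) \<bullet> n \<noteq> 0"
    proof (rule ccontr)
      assume "\<not> ?thesis"
      then have 0: "fst (chart (X s)) = 0" "(center - X s) \<bullet> n = 0" by auto
      have "e \<bullet> n = 0"
        using signed_distance_deriv[OF X(1)] Xs K_chart_dom s(2) 0(1) by (auto simp: Z_def n_def)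
      with 0(2) indep[OF s(1)] have "n = 0"
      proof -
        define d where "d = center - X s"
        have 1: "fst e * fst n + snd e * snd n = 0" "fst d * fst n + snd d * snd n = 0"
            "fst e * snd d - snd e * fst d \<noteq> 0"
          using \<open>e \<bullet> n = 0\<close> 0(2) indep[OF s(1)] by (simp_all add: det2_def inner_prod_def d_def)
        have "(fst e * snd d - snd e * fst d) * fst n
              = snd d * (fst e * fst n + snd e * snd n) - snd e * (fst d * fst n + snd d * snd n)"
          "(fst e * snd d - snd e * fst d) * snd n
              = fst e * (fst d * fst n + snd d * snd n) - fst d * (fst e * fst n + snd e * snd n)"
          by (simp_all add: algebra_simps)
        then have "(fst e * snd d - snd e * fst d) * fst n = 0" "(fst e * snd d - snd e * fst d) * snd n = 0"
          unfolding 1(1,2) by simp_all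
        then show ?thesis using 1(3) by (simp only: mult_eq_0_iff simp_thms prod_eq_iff fst_zero snd_zero)
      qed
      then show False using norm_normal[of "snd (chart (X s))"] by (simp add: n_def)
    qed
    moreover have "X s \<noteq> center" using indep[OF s(1)] by (auto simp: det2_def)
    ultimately have "norm (inner_trace center F (X s)) \<le> M"
      unfolding n_def using Xs by (intro inner_trace_le[of _ F Gp Gm] F G M) auto
    then show ?thesis by (intro power_mono) auto
  qed
  have "(LINT s:{\<alpha>..\<beta>}|lebesgue. (norm (inner_trace center F (X s)))\<^sup>2) \<le> (LINT s|lebesgue. indicator {\<alpha>..\<beta>} s * M\<^sup>2)"
    unfolding set_lebesgue_integral_def
  proof (rule integral_mono_AE')
    show "integrable lebesgue (\<lambda>s. indicator {\<alpha>..\<beta>} s * M\<^sup>2)"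
      by (intro integrable_mult_left integrable_real_indicator) (auto simp: \<open>\<alpha> \<le> \<beta>\<close>)
    show "AE s in lebesgue. indicator {\<alpha>..\<beta>} s *\<^sub>R (norm (inner_trace center F (X s)))\<^sup>2 \<le> indicator {\<alpha>..\<beta>} s * M\<^sup>2"
      by (rule AE_I'[OF Z]) (use le in \<open>auto simp: indicator_def\<close>)
  qed auto
  also have "\<dots> = (\<beta> - \<alpha>) * M\<^sup>2" using \<open>\<alpha> \<le> \<beta>\<close> by simp
  finally show ?thesis .
qed

lemma L2_boundary_norm_le:
  assumes F: "\<And>y. y \<in> box p q \<Longrightarrow> 0 < fst (chart y) \<Longrightarrow> F y = Gp y"
      "\<And>y. y \<in> box p q \<Longrightarrow> fst (chart y) < 0 \<Longrightarrow> F y = Gm y"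
    and G: "continuous_on chart_dom Gp" "continuous_on chart_dom Gm"
    and M: "\<And>y. y \<in> cbox p q \<Longrightarrow> norm (Gp y) \<le> M" "\<And>y. y \<in> cbox p q \<Longrightarrow> norm (Gm y) \<le> M"
    and sides: "fst q - fst p \<le> h" "snd q - snd p \<le> h"
  shows "L2_boundary_norm p q F \<le> 2 * sqrt h * M"
proof -
  have "center \<in> cbox p q" using center_box box_subset_cbox by blast
  from M(1)[OF this] have M0: "0 \<le> M" using norm_ge_zero[of "Gp center"] by linarith
  have pq': "fst p \<le> fst q" "snd p \<le> snd q" using pq by auto
  have cx: "fst center = (fst p + fst q) / 2" "snd center = (snd p + snd q) / 2"
    by (simp_all add: midpoint_def)
  have mem: "(x, y) \<in> cbox p q \<longleftrightarrow> fst p \<le> x \<and> x \<le> fst q \<and> snd p \<le> y \<and> y \<le> snd q" for x y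
    by (cases p; cases q) (auto simp: cbox_Pair_eq)
  have d1: "((\<lambda>s. (s, k)) has_vector_derivative (1, 0)) (at s)" for k s :: real
    by (auto simp: has_vector_derivative_def intro!: derivative_eq_intros)
  have d2: "((\<lambda>s. (k, s)) has_vector_derivative (0, 1)) (at s)" for k s :: real
    by (auto simp: has_vector_derivative_def intro!: derivative_eq_intros)
  have h_edge: "(LINT s:{fst p..fst q}|lebesgue. (norm (inner_trace center F (s, k)))\<^sup>2) \<le> (fst q - fst p) * M\<^sup>2"
    if "k = snd p \<or> k = snd q" for k
  proof (rule edge_integral_le[where X = "\<lambda>s. (s, k)", OF d1 _ _ pq'(1) F G M])
    fix s assume s: "s \<in> {fst p..fst q}"
    show "(s, k) \<in> cbox p q" using s that pq' by (auto simp: mem)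
    show "det2 (1, 0) (center - (s, k)) \<noteq> 0" using that pq by (auto simp: det2_def cx)
  qed
  have v_edge: "(LINT s:{snd p..snd q}|lebesgue. (norm (inner_trace center F (k, s)))\<^sup>2) \<le> (snd q - snd p) * M\<^sup>2"
    if "k = fst p \<or> k = fst q" for k
  proof (rule edge_integral_le[where X = "\<lambda>s. (k, s)", OF d2 _ _ pq'(2) F G M])
    fix s assume s: "s \<in> {snd p..snd q}"
    show "(k, s) \<in> cbox p q" using s that pq' by (auto simp: mem)
    show "det2 (0, 1) (center - (k, s)) \<noteq> 0" using that pq by (auto simp: det2_def cx)
  qed
  have "rect_boundary_integral p q (\<lambda>x. (norm (inner_trace center F x))\<^sup>2)
      \<le> (fst q - fst p) * M\<^sup>2 + (fst q - fst p) * M\<^sup>2 + (snd q - snd p) * M\<^sup>2 + (snd q - snd p) * M\<^sup>2"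
    unfolding rect_boundary_integral_def by (intro add_mono h_edge v_edge) auto
  also have "\<dots> \<le> h * M\<^sup>2 + h * M\<^sup>2 + h * M\<^sup>2 + h * M\<^sup>2"
    using sides by (intro add_mono mult_right_mono) auto
  finally have "L2_boundary_norm p q F \<le> sqrt (2\<^sup>2 * h * M\<^sup>2)"
    unfolding L2_boundary_norm_def by simp
  also have "\<dots> = 2 * sqrt h * M" using M0 by (simp add: real_sqrt_mult)
  finally show ?thesis .
qed

end

context frenet_element
begin

section \<open>Lower bound in the element\<close>

text \<open>
The interface and the boundary of the element are null sets, and off them the field coincides with a bounded
Borel function.  Without this the Lebesgue integral could be \<open>0\<close> by convention, and no lower bound would hold.
\<close>

lemma L2_norm_ge:
  assumes F: "\<And>y. y \<in> box p q \<Longrightarrow> 0 < fst (chart y) \<Longrightarrow> F y = Gp y"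
      "\<And>y. y \<in> box p q \<Longrightarrow> fst (chart y) < 0 \<Longrightarrow> F y = Gm y"
    and G: "continuous_on chart_dom Gp" "continuous_on chart_dom Gm"
    and ball: "ball x r \<subseteq> box p q" "0 \<le> r" and l: "0 \<le> l"
    and low: "\<And>y. y \<in> ball x r \<Longrightarrow> 0 < fst (chart y) \<and> l \<le> norm (Gp y) \<or> fst (chart y) < 0 \<and> l \<le> norm (Gm y)"
  shows "l * r \<le> L2_norm (cbox p q) F"
proof -
  define Kp where "Kp = cbox p q \<inter> (chart_dom \<inter> (\<lambda>y. fst (chart y)) -` {0<..})"
  define Km where "Km = cbox p q \<inter> (chart_dom \<inter> (\<lambda>y. fst (chart y)) -` {..<0})"
  have cf: "continuous_on chart_dom (\<lambda>y. fst (chart y))" by (intro continuous_on_fst continuous_on_chart)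
  have "open (chart_dom \<inter> (\<lambda>y. fst (chart y)) -` {0<..})" "open (chart_dom \<inter> (\<lambda>y. fst (chart y)) -` {..<0})"
    by (intro continuous_open_preimage cf open_chart_dom; simp)+
  then have Kb: "Kp \<in> sets borel" "Km \<in> sets borel" unfolding Kp_def Km_def by (auto intro!: sets.Int)
  define H where "H y = indicator Kp y *\<^sub>R (norm (Gp y))\<^sup>2 + indicator Km y *\<^sub>R (norm (Gm y))\<^sup>2" for y
  have cG: "continuous_on S (\<lambda>y. (norm (Gp y))\<^sup>2)" "continuous_on S (\<lambda>y. (norm (Gm y))\<^sup>2)" if "S \<subseteq> chart_dom" for S
    using continuous_on_subset[OF G(1) that] continuous_on_subset[OF G(2) that] by (auto intro!: continuous_intros)
  have Hm: "H \<in> borel_measurable lebesgue"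
  proof -
    have "H \<in> borel_measurable borel"
      unfolding H_def
      by (intro borel_measurable_add borel_measurable_continuous_on_indicator Kb cG) (auto simp: Kp_def Km_def)
    then show ?thesis by (simp add: measurable_completion)
  qed
  obtain B1 B2 where B1: "\<And>y. y \<in> cbox p q \<Longrightarrow> norm ((norm (Gp y))\<^sup>2) \<le> B1"
    and B2: "\<And>y. y \<in> cbox p q \<Longrightarrow> norm ((norm (Gm y))\<^sup>2) \<le> B2"
  proof -
    have "bounded ((\<lambda>y. (norm (Gp y))\<^sup>2) ` cbox p q)" "bounded ((\<lambda>y. (norm (Gm y))\<^sup>2) ` cbox p q)"
      by (intro compact_imp_bounded compact_continuous_image cG K_chart_dom compact_cbox)+
    then obtain B1 B2 where "\<forall>z\<in>(\<lambda>y. (norm (Gp y))\<^sup>2) ` cbox p q. norm z \<le> B1" "\<forall>z\<in>(\<lambda>y. (norm (Gm y))\<^sup>2) ` cbox p q. norm z \<le> B2"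
      unfolding bounded_iff by blast
    then show thesis by (intro that[of B1 B2]) auto
  qed
  have Hi: "integrable lebesgue H"
  proof (rule Bochner_Integration.integrable_bound[OF _ Hm])
    show "integrable lebesgue (\<lambda>y. indicator (cbox p q) y * (\<bar>B1\<bar> + \<bar>B2\<bar>))"
      by (intro integrable_mult_left integrable_real_indicator) (auto simp: emeasure_lborel_cbox_eq)
    show "AE y in lebesgue. norm (H y) \<le> norm (indicator (cbox p q) y * (\<bar>B1\<bar> + \<bar>B2\<bar>))"
    proof (rule AE_I2)
      fix y
      show "norm (H y) \<le> norm (indicator (cbox p q) y * (\<bar>B1\<bar> + \<bar>B2\<bar>))"
        using B1[of y] B2[of y] by (auto simp: H_def indicator_def Kp_def Km_def)
    qed
  qed
  define N where "N = (cbox p q - box p q) \<union> range g"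
  have "g differentiable_on UNIV"
    using dg unfolding differentiable_on_def has_vector_derivative_def
    by (auto simp: differentiable_def intro: has_derivative_at_withinI)
  then have "negligible (range g)" by (intro negligible_differentiable_image_lowdim) auto
  then have "negligible N" unfolding N_def by (intro negligible_Un negligible_frontier_interval)
  then have N: "N \<in> null_sets lebesgue" by (simp add: negligible_iff_null_sets)
  have eq: "indicator (cbox p q) y *\<^sub>R (norm (F y))\<^sup>2 = H y" if "y \<notin> N" for y
  proof (cases "y \<in> cbox p q")
    case True
    with that have y: "y \<in> box p q" "y \<notin> range g" by (auto simp: N_def)
    have "fst (chart y) \<noteq> 0"
    proof
      assume 0: "fst (chart y) = 0"
      have "y = frenet g (chart y)" using frenet_chart[of y] K_chart_dom True by (metis subsetD)
      also have "\<dots> = g (snd (chart y))" using 0 by (cases "chart y") (simp add: frenet_def)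
      finally show False using y(2) by blast
    qed
    then consider "0 < fst (chart y)" | "fst (chart y) < 0" by linarith
    then show ?thesis
    proof cases
      case 1
      then have "y \<in> Kp" "y \<notin> Km" using True K_chart_dom by (auto simp: Kp_def Km_def)
      then show ?thesis using F(1)[OF y(1) 1] True by (simp add: H_def)
    next
      case 2
      then have "y \<notin> Kp" "y \<in> Km" using True K_chart_dom by (auto simp: Kp_def Km_def)
      then show ?thesis using F(2)[OF y(1) 2] True by (simp add: H_def)
    qed
  qed (auto simp: H_def Kp_def Km_def)
  have ae: "AE y in lebesgue. indicator (cbox p q) y *\<^sub>R (norm (F y))\<^sup>2 = H y"
    by (rule AE_I'[OF N]) (use eq in auto)
  then have mF: "(\<lambda>y. indicator (cbox p q) y *\<^sub>R (norm (F y))\<^sup>2) \<in> borel_measurable lebesgue"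
    by (intro borel_measurable_AE[OF Hm]) (auto elim: eventually_mono)
  have "l\<^sup>2 * (pi * r\<^sup>2) = (LINT y|lebesgue. indicator (ball x r) y * l\<^sup>2)"
    using ball(2) by (simp add: content_ball unit_ball_vol_2 power2_eq_square)
  also have "\<dots> \<le> (LINT y|lebesgue. H y)"
  proof (rule integral_mono[OF _ Hi])
    show "integrable lebesgue (\<lambda>y. indicator (ball x r) y * l\<^sup>2)"
      using emeasure_bounded_finite[OF bounded_ball, of x r]
      by (intro integrable_mult_left integrable_real_indicator) (auto simp: less_top)
    fix y
    have H0: "0 \<le> H y" by (simp add: H_def)
    show "indicator (ball x r) y * l\<^sup>2 \<le> H y"
    proof (cases "y \<in> ball x r")
      case True
      then have yK: "y \<in> cbox p q" using ball(1) box_subset_cbox by blast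
      from low[OF True] show ?thesis
      proof
        assume *: "0 < fst (chart y) \<and> l \<le> norm (Gp y)"
        then have "y \<in> Kp" "y \<notin> Km" using yK K_chart_dom by (auto simp: Kp_def Km_def)
        then show ?thesis using * True l by (simp add: H_def power_mono)
      next
        assume *: "fst (chart y) < 0 \<and> l \<le> norm (Gm y)"
        then have "y \<notin> Kp" "y \<in> Km" using yK K_chart_dom by (auto simp: Kp_def Km_def)
        then show ?thesis using * True l by (simp add: H_def power_mono)
      qed
    qed (simp add: H0)
  qed
  also have "\<dots> = (LINT y|lebesgue. indicator (cbox p q) y *\<^sub>R (norm (F y))\<^sup>2)"
    by (rule integral_cong_AE[OF Hm mF]) (use ae in auto)
  finally have int: "l\<^sup>2 * (pi * r\<^sup>2) \<le> (LINT y:cbox p q|lebesgue. (norm (F y))\<^sup>2)"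
    by (simp add: set_lebesgue_integral_def)
  \<comment> \<open>The ball has area \<open>\<pi> r\<^sup>2 \<ge> r\<^sup>2\<close>.\<close>
  have "(l * r)\<^sup>2 \<le> l\<^sup>2 * (pi * r\<^sup>2)"
    using pi_ge_two mult_right_mono[of 1 pi "l\<^sup>2 * r\<^sup>2"] by (simp add: power_mult_distrib mult_ac)
  with int show ?thesis
    unfolding L2_norm_def by (intro real_le_rsqrt) linarith
qed

definition large_slope :: "nat \<Rightarrow> (nat \<Rightarrow> real poly) \<Rightarrow> real \<Rightarrow> plane \<Rightarrow> bool" where
  "large_slope m u c x \<longleftrightarrow> c \<le> \<bar>slope_s m u (chart x)\<bar> \<or> c \<le> \<bar>slope_t m u (chart x)\<bar>"

text \<open>
Start at the centre, with Frenet coordinates \<open>(\<eta>\<^sub>c, \<xi>\<^sub>c)\<close>, and move by \<open>w/4\<close> along the normal in the direction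
of increasing \<open>\<bar>\<eta>\<bar>\<close>, where \<open>w = \<omega> h\<close> is at most the shorter side.  A Frenet square of half-side \<open>\<delta> h\<close> around
the new point is mapped into the element, on one side of the interface.  By equivalence of norms the gradient is
large somewhere in the square, and by its Lipschitz bound it remains large on a ball of radius \<open>\<nu> h\<close>.
The side \<open>\<sigma>\<close> depends on the element only, not on the polynomial.
\<close>

lemma large_gradient_ball:
  fixes \<omega> T C :: real and m :: nat
  defines "\<delta> \<equiv> \<omega> / (32 * (1 + 2 * \<Gamma>))"
  defines "\<nu> \<equiv> min (\<omega> / (16 * (1 + 2 / \<gamma>))) (1 / (8 * C * ((real (m + 1))\<^sup>2 * T ^ m) * (1 + 2 / \<gamma>)))"
  assumes \<omega>: "0 < \<omega>" "\<omega> \<le> 1" "\<omega> * h \<le> fst q - fst p" "\<omega> * h \<le> snd q - snd p"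
    and T: "1 \<le> T" "\<xi>1 - \<xi>0 \<le> T * h"
    and C: "0 < C" "\<And>u s0 t0 B. (\<forall>i. degree (u i) \<le> m) \<Longrightarrow> \<bar>s0\<bar> \<le> T \<Longrightarrow> \<bar>t0\<bar> \<le> T \<Longrightarrow>
     (\<forall>s\<in>{s0..s0+2*\<delta>}. \<forall>t\<in>{t0..t0+2*\<delta>}. \<bar>dsum_s m u s t\<bar> \<le> B \<and> \<bar>dsum_t m u s t\<bar> \<le> B) \<Longrightarrow>
     grad_size m u \<le> C * B"
  obtains \<sigma> :: real where "\<sigma> = 1 \<or> \<sigma> = -1"
    and "\<forall>u. (\<forall>i. degree (u i) \<le> m) \<longrightarrow> 0 < grad_size m u \<longrightarrow> (\<exists>x. ball x (\<nu> * h) \<subseteq> box p q \<and> (\<forall>y\<in>ball x (\<nu> * h). 0 < \<sigma> * fst (chart y) \<and>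
        large_slope m u (grad_size m u / (4 * C)) y))"
proof -
  define LR where "LR = 1 + 2 / \<gamma>"
  define Cl where "Cl = (real (m + 1))\<^sup>2 * T ^ m"
  define w where "w = \<omega> * h"
  have LR: "1 \<le> LR" using \<gamma>(1) by (simp add: LR_def)
  have Cl: "0 < Cl" using T by (simp add: Cl_def)
  have w: "0 < w" "w \<le> h" using \<omega> h(1) by (simp_all add: w_def)
  \<comment> \<open>The constant \<open>\<delta>\<close> is such that the image of the square has radius at most \<open>w/16\<close>.\<close>
  have \<delta>: "0 < \<delta>" "(1 + 2 * \<Gamma>) * (2 * (\<delta> * h)) = w / 16" "\<delta> * h \<le> w / 16"
  proof -
    show "0 < \<delta>" using \<omega>(1) \<Gamma>_pos by (simp add: \<delta>_def)
    show e: "(1 + 2 * \<Gamma>) * (2 * (\<delta> * h)) = w / 16" using \<Gamma>_pos by (simp add: \<delta>_def w_def field_simps)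
    have "1 * (2 * (\<delta> * h)) \<le> (1 + 2 * \<Gamma>) * (2 * (\<delta> * h))"
      using \<Gamma>_pos \<open>0 < \<delta>\<close> h(1) by (intro mult_right_mono) auto
    moreover have "0 < \<delta> * h" using \<open>0 < \<delta>\<close> h(1) by simp
    ultimately show "\<delta> * h \<le> w / 16" using e by linarith
  qed
  have \<delta>h: "0 < \<delta> * h" using \<delta>(1) h(1) by simp
  define r where "r = \<nu> * h"
  have \<nu>: "0 < \<nu>" "\<nu> \<le> \<omega> / (16 * LR)" "\<nu> \<le> 1 / (8 * C * Cl * LR)"
    using \<omega>(1) LR C(1) Cl unfolding \<nu>_def LR_def[symmetric] Cl_def[symmetric] by auto
  \<comment> \<open>The first bound keeps the ball on its side and in the element, the second preserves half of the lower bound that the slope has at the centre of the ball.\<close>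
  have r: "0 < r" "LR * r \<le> w / 16" "Cl * (2 * (LR * r) / h) \<le> 1 / (4 * C)"
  proof -
    show "0 < r" using \<nu>(1) h(1) by (simp add: r_def)
    have "LR * \<nu> \<le> \<omega> / 16" using \<nu>(2) LR by (simp add: field_simps)
    then show "LR * r \<le> w / 16" using h(1) mult_right_mono[of "LR * \<nu>" "\<omega> / 16" h] by (simp add: r_def w_def)
    have "\<nu> * (8 * C * Cl * LR) \<le> 1" using \<nu>(3) LR C(1) Cl by (simp add: field_simps)
    then show "Cl * (2 * (LR * r) / h) \<le> 1 / (4 * C)" using h(1) C(1) by (simp add: r_def field_simps)
  qed
  have "1 * r \<le> LR * r" using LR r(1) by (intro mult_right_mono) auto
  then have rw: "r \<le> w / 16" using r(2) by linarith
  define \<eta>c \<xi>c where "\<eta>c = fst (chart center)" and "\<xi>c = snd (chart center)"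
  have cK: "center \<in> cbox p q" using center_box box_subset_cbox by blast
  have c: "\<bar>\<eta>c\<bar> \<le> h" "\<xi>0 \<le> \<xi>c" "\<xi>c \<le> \<xi>1" using chart_K'[OF cK] by (simp_all add: \<eta>c_def \<xi>c_def)
  have c_eq: "center = g \<xi>c + \<eta>c *\<^sub>R normal_vec g \<xi>c"
    using frenet_chart[of center] cK K_chart_dom by (auto simp: frenet_def case_prod_beta \<eta>c_def \<xi>c_def)
  define \<sigma> :: real where "\<sigma> = (if 0 \<le> \<eta>c then 1 else -1)"
  have \<sigma>: "\<sigma> = 1 \<or> \<sigma> = -1" "\<sigma> * \<eta>c = \<bar>\<eta>c\<bar>" "\<bar>\<sigma>\<bar> = 1" "\<sigma> * \<sigma> = 1" by (auto simp: \<sigma>_def)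
  define \<eta>0 where "\<eta>0 = \<eta>c + \<sigma> * (w / 4)"
  have \<eta>0: "\<bar>\<eta>0\<bar> \<le> h + w / 4" "w / 4 \<le> \<sigma> * \<eta>0"
  proof -
    show "\<bar>\<eta>0\<bar> \<le> h + w / 4" unfolding \<eta>0_def using c(1) w(1) \<sigma>(1) by auto
    have "\<sigma> * \<eta>0 = \<bar>\<eta>c\<bar> + w / 4" unfolding \<eta>0_def using \<sigma> by (auto simp: distrib_left)
    then show "w / 4 \<le> \<sigma> * \<eta>0" by simp
  qed
  have P0: "norm (frenet g (\<eta>0, \<xi>c) - center) = w / 4"
  proof -
    have "frenet g (\<eta>0, \<xi>c) - center = (\<sigma> * (w / 4)) *\<^sub>R normal_vec g \<xi>c"
      unfolding c_eq by (simp add: frenet_def \<eta>0_def scaleR_add_left)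
    then show ?thesis using w(1) \<sigma>(3) by (simp add: norm_normal abs_mult)
  qed
  \<comment> \<open>The budget of distances to the centre of the element is \<open>w/2\<close>; it is spent as \<open>w/4 + w/16 + w/16\<close>.\<close>
  have near_center: "y \<in> box p q" if "norm (y - center) < w / 2" for y
  proof -
    have e: "fst (y - center) = fst y - (fst p + fst q) / 2" "snd (y - center) = snd y - (snd p + snd q) / 2"
      by (simp_all add: midpoint_def)
    have "\<bar>fst (y - center)\<bar> < w / 2" "\<bar>snd (y - center)\<bar> < w / 2"
      using that norm_fst_le[of "fst (y - center)" "snd (y - center)"] norm_snd_le[of "snd (y - center)" "fst (y - center)"]
      unfolding prod.collapse real_norm_def by linarith+
    then have "\<bar>fst y - (fst p + fst q) / 2\<bar> < w / 2" "\<bar>snd y - (snd p + snd q) / 2\<bar> < w / 2" unfolding e .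
    then have "- (w / 2) < fst y - (fst p + fst q) / 2" "fst y - (fst p + fst q) / 2 < w / 2"
      "- (w / 2) < snd y - (snd p + snd q) / 2" "snd y - (snd p + snd q) / 2 < w / 2" by linarith+
    moreover have "w / 2 \<le> fst q / 2 - fst p / 2" "w / 2 \<le> snd q / 2 - snd p / 2"
      using \<omega>(3,4)[folded w_def] by simp_all
    ultimately have "fst p < fst y" "fst y < fst q" "snd p < snd y" "snd y < snd q"
      unfolding add_divide_distrib by linarith+
    then show ?thesis by (simp add: mem_box_plane)
  qed
  have rect: "norm (frenet g (\<eta>, \<xi>) - center) \<le> w / 16 + w / 4 \<and> frenet g (\<eta>, \<xi>) \<in> cbox p q \<and> chart (frenet g (\<eta>, \<xi>)) = (\<eta>, \<xi>)"
    if z: "\<bar>\<eta> - \<eta>0\<bar> \<le> \<delta> * h" "\<bar>\<xi> - \<xi>c\<bar> \<le> \<delta> * h" for \<eta> \<xi>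
  proof -
    have \<eta>2: "\<bar>\<eta>\<bar> \<le> 2 * h" "\<bar>\<eta>0\<bar> \<le> 2 * h" using z(1) \<eta>0(1) \<delta>(3) w by linarith+
    have "norm (frenet g (\<eta>, \<xi>) - frenet g (\<eta>0, \<xi>c)) \<le> (1 + 2 * \<Gamma>) * norm ((\<eta>, \<xi>) - (\<eta>0, \<xi>c))"
      by (rule frenet_lipschitz[OF \<eta>2])
    also have "norm ((\<eta>, \<xi>) - (\<eta>0, \<xi>c)) \<le> 2 * (\<delta> * h)"
      using norm_Pair_le[of "\<eta> - \<eta>0" "\<xi> - \<xi>c"] z by simp
    then have "(1 + 2 * \<Gamma>) * norm ((\<eta>, \<xi>) - (\<eta>0, \<xi>c)) \<le> (1 + 2 * \<Gamma>) * (2 * (\<delta> * h))"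
      using \<Gamma>_pos by (intro mult_left_mono) auto
    finally have d: "norm (frenet g (\<eta>, \<xi>) - center) \<le> w / 16 + w / 4"
      using \<delta>(2) P0 norm_triangle_ineq[of "frenet g (\<eta>, \<xi>) - frenet g (\<eta>0, \<xi>c)" "frenet g (\<eta>0, \<xi>c) - center"] by simp
    then have "norm (frenet g (\<eta>, \<xi>) - center) < w / 2" using w(1) by linarith
    then have K: "frenet g (\<eta>, \<xi>) \<in> cbox p q" using near_center box_subset_cbox by blast
    obtain \<eta>' \<xi>' where z': "chart (frenet g (\<eta>, \<xi>)) = (\<eta>', \<xi>')" by fastforce
    have k: "\<bar>\<eta>'\<bar> \<le> h" "\<xi>0 \<le> \<xi>'" "\<xi>' \<le> \<xi>1" using chart_K'[OF K] z' by simp_all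
    have "frenet g (\<eta>, \<xi>) = frenet g (\<eta>', \<xi>')" using frenet_chart K K_chart_dom z' by (metis subsetD)
    \<comment> \<open>Both parameters lie in an interval shorter than a period.\<close>
    then have "\<eta> = \<eta>' \<and> \<xi> = \<xi>'"
      using k c z(2) \<eta>2(1) h(1,2) len \<delta>(3) w by (intro frenet_inj_short) (auto simp: abs_less_iff abs_le_iff)
    with d K z' show ?thesis by simp
  qed
  have corner: "\<bar>\<eta>0 - \<delta> * h\<bar> \<le> h \<and> \<xi>0 \<le> \<xi>c - \<delta> * h"
    using rect[of "\<eta>0 - \<delta> * h" "\<xi>c - \<delta> * h"] \<delta>h chart_K'(1,2)[of "frenet g (\<eta>0 - \<delta> * h, \<xi>c - \<delta> * h)"] by simp
  have main: "\<exists>x. ball x (\<nu> * h) \<subseteq> box p q \<and> (\<forall>y\<in>ball x (\<nu> * h). 0 < \<sigma> * fst (chart y) \<and>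
        large_slope m u (grad_size m u / (4 * C)) y)"
    if deg: "\<forall>i. degree (u i) \<le> m" and S: "0 < grad_size m u" for u
  proof -
    define S where "S = grad_size m u"
    define s0 t0 where "s0 = (\<eta>0 - \<delta> * h) / h" and "t0 = (\<xi>c - \<delta> * h - \<xi>0) / h"
    have s0: "\<bar>s0\<bar> \<le> T"
    proof -
      have "h \<le> T * h" using h(1) T(1) by simp
      with corner have "\<bar>\<eta>0 - \<delta> * h\<bar> \<le> T * h" by linarith
      then show ?thesis using h(1) by (simp add: s0_def divide_le_eq)
    qed
    have t0: "\<bar>t0\<bar> \<le> T"
    proof -
      have "0 \<le> \<xi>c - \<delta> * h - \<xi>0" "\<xi>c - \<delta> * h - \<xi>0 \<le> T * h" using corner c \<delta>h T(2) by linarith+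
      then show ?thesis using h(1) by (simp add: t0_def divide_le_eq)
    qed
    have "\<not> (\<forall>s\<in>{s0..s0+2*\<delta>}. \<forall>t\<in>{t0..t0+2*\<delta>}. \<bar>dsum_s m u s t\<bar> \<le> S / (2 * C) \<and> \<bar>dsum_t m u s t\<bar> \<le> S / (2 * C))"
    proof
      assume "\<forall>s\<in>{s0..s0+2*\<delta>}. \<forall>t\<in>{t0..t0+2*\<delta>}. \<bar>dsum_s m u s t\<bar> \<le> S / (2 * C) \<and> \<bar>dsum_t m u s t\<bar> \<le> S / (2 * C)"
      from C(2)[OF deg s0 t0 this] show False using S C(1) by (simp add: S_def)
    qed
    then obtain s t where st: "s \<in> {s0..s0+2*\<delta>}" "t \<in> {t0..t0+2*\<delta>}"
      and big: "S / (2 * C) < \<bar>dsum_s m u s t\<bar> \<or> S / (2 * C) < \<bar>dsum_t m u s t\<bar>" by force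
    define \<eta> \<xi> where "\<eta> = h * s" and "\<xi> = \<xi>0 + h * t"
    have z: "\<bar>\<eta> - \<eta>0\<bar> \<le> \<delta> * h" "\<bar>\<xi> - \<xi>c\<bar> \<le> \<delta> * h"
    proof -
      have "h * s0 \<le> h * s" "h * s \<le> h * (s0 + 2 * \<delta>)" "h * t0 \<le> h * t" "h * t \<le> h * (t0 + 2 * \<delta>)"
        using st h(1) by auto
      moreover have "h * s0 = \<eta>0 - \<delta> * h" "h * t0 = \<xi>c - \<delta> * h - \<xi>0" using h(1) by (simp_all add: s0_def t0_def)
      moreover have "h * (s0 + 2 * \<delta>) = h * s0 + 2 * (\<delta> * h)" "h * (t0 + 2 * \<delta>) = h * t0 + 2 * (\<delta> * h)"
        by (simp_all add: algebra_simps)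
      ultimately show "\<bar>\<eta> - \<eta>0\<bar> \<le> \<delta> * h" "\<bar>\<xi> - \<xi>c\<bar> \<le> \<delta> * h" unfolding \<eta>_def \<xi>_def by linarith+
    qed
    define x where "x = frenet g (\<eta>, \<xi>)"
    have x: "norm (x - center) \<le> w / 16 + w / 4" "x \<in> cbox p q" "chart x = (\<eta>, \<xi>)"
      using rect[OF z] by (simp_all add: x_def)
    have sub: "y \<in> box p q" if y: "y \<in> ball x r" for y
    proof (rule near_center)
      have "norm (y - x) < r" using y by (simp add: dist_norm norm_minus_commute)
      then show "norm (y - center) < w / 2"
        using norm_triangle_ineq[of "y - x" "x - center"] x(1) rw w(1) by simp
    qed
    have "0 < \<sigma> * fst (chart y) \<and> large_slope m u (S / (4 * C)) y" if y: "y \<in> ball x r" for y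
    proof -
      have yK: "y \<in> cbox p q" using sub[OF y] box_subset_cbox by blast
      obtain \<eta>' \<xi>' where z': "chart y = (\<eta>', \<xi>')" by fastforce
      have "norm (chart y - chart x) \<le> LR * norm (y - x)" unfolding LR_def by (rule chart_lipschitz[OF yK x(2)])
      also have "\<dots> \<le> LR * r" using y LR by (intro mult_left_mono) (auto simp: dist_norm norm_minus_commute)
      finally have d: "norm (\<eta>' - \<eta>, \<xi>' - \<xi>) \<le> LR * r" by (simp add: z' x(3))
      then have d1: "\<bar>\<eta>' - \<eta>\<bar> \<le> LR * r" "\<bar>\<xi>' - \<xi>\<bar> \<le> LR * r"
        using norm_fst_le[of "\<eta>' - \<eta>" "\<xi>' - \<xi>"] norm_snd_le[of "\<xi>' - \<xi>" "\<eta>' - \<eta>"] by auto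
      have pos: "0 < \<sigma> * \<eta>'"
      proof -
        have "\<bar>\<eta>' - \<eta>0\<bar> \<le> w / 16 + w / 16" using d1(1) r(2) z(1) \<delta>(3) by linarith
        then have "\<bar>\<sigma> * (\<eta>' - \<eta>0)\<bar> \<le> w / 16 + w / 16" unfolding abs_mult \<sigma>(3) by simp
        then have "\<sigma> * \<eta>0 - (w / 16 + w / 16) \<le> \<sigma> * \<eta>'"
          unfolding right_diff_distrib by linarith
        then show ?thesis using \<eta>0(2) w(1) by linarith
      qed
      define s' t' where "s' = \<eta>' / h" and "t' = (\<xi>' - \<xi>0) / h"
      have st_eq: "s = \<eta> / h" "t = (\<xi> - \<xi>0) / h" using h(1) by (simp_all add: \<eta>_def \<xi>_def)
      have bnd: "\<bar>s\<bar> \<le> 1" "\<bar>s'\<bar> \<le> 1" "\<bar>t\<bar> \<le> T" "\<bar>t'\<bar> \<le> T"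
        using chart_K'[OF yK] chart_K'[OF x(2)] T h(1) unfolding st_eq s'_def t'_def x(3) z' fst_conv snd_conv
        by (simp_all add: divide_le_eq)
      have "\<bar>s - s'\<bar> = \<bar>\<eta>' - \<eta>\<bar> / h" "\<bar>t - t'\<bar> = \<bar>\<xi>' - \<xi>\<bar> / h"
        using h(1) by (simp_all add: st_eq s'_def t'_def diff_divide_distrib[symmetric] abs_minus_commute)
      then have "\<bar>s - s'\<bar> + \<bar>t - t'\<bar> \<le> 2 * (LR * r) / h"
        using d1 h(1) by (simp add: add_divide_distrib[symmetric] divide_right_mono)
      then have "Cl * S * (\<bar>s - s'\<bar> + \<bar>t - t'\<bar>) \<le> Cl * S * (2 * (LR * r) / h)"
        using Cl S by (intro mult_left_mono) (auto simp: S_def)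
      also have "\<dots> = S * (Cl * (2 * (LR * r) / h))" by simp
      also have "\<dots> \<le> S * (1 / (4 * C))" using r(3) S by (intro mult_left_mono) (auto simp: S_def)
      finally have var: "Cl * S * (\<bar>s - s'\<bar> + \<bar>t - t'\<bar>) \<le> S / (4 * C)" by simp
      have "\<bar>dsum_s m u s t - dsum_s m u s' t'\<bar> \<le> S / (4 * C)" "\<bar>dsum_t m u s t - dsum_t m u s' t'\<bar> \<le> S / (4 * C)"
        using dsum_lipschitz[of u m, OF deg[rule_format] bnd(1,2,3,4) T(1)] var
        unfolding Cl_def S_def by linarith+
      moreover have "S / (2 * C) = S / (4 * C) + S / (4 * C)" by simp
      ultimately have "S / (4 * C) \<le> \<bar>dsum_s m u s' t'\<bar> \<or> S / (4 * C) \<le> \<bar>dsum_t m u s' t'\<bar>"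
        using big by linarith
      then show ?thesis using pos by (simp add: large_slope_def slope_s_def slope_t_def z' s'_def t'_def)
    qed
    then show ?thesis using sub unfolding r_def[symmetric] S_def by blast
  qed
  show thesis by (rule that[OF \<sigma>(1)]) (use main in blast)
qed

end

section \<open>The trace inequality\<close>

text \<open>
Nonempty boxes determine their corners, so an element has the side lengths of the mesh.
\<close>

lemma uniform_mesh_element:
  assumes "uniform_mesh a b \<rho> h \<T>" "cbox p q \<in> \<T>" "interior (cbox p q) \<noteq> {}"
  obtains w where "0 < w" "fst q - fst p = \<rho> * w" "snd q - snd p = w" "h = w * sqrt (1 + \<rho>\<^sup>2)" "cbox p q \<subseteq> cbox a b" "0 < \<rho>"
proof -
  obtain N1 N2 :: nat and w1 w2 :: real where ab: "fst a < fst b" "snd a < snd b" and N: "N1 > 0" "N2 > 0"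
    and w: "real N1 * w1 = fst b - fst a" "real N2 * w2 = snd b - snd a" "w1 = \<rho> * w2" "h = sqrt (w1\<^sup>2 + w2\<^sup>2)"
    and T: "\<T> = {cbox (fst a + real i * w1, snd a + real j * w2)
                   (fst a + real (Suc i) * w1, snd a + real (Suc j) * w2) | i j. i < N1 \<and> j < N2}"
    using assms(1) unfolding uniform_mesh_def by blast
  have "0 < real N1 * w1" "0 < real N2 * w2" using w(1,2) ab by linarith+
  then have pos: "0 < w1" "0 < w2" using N by (simp_all add: zero_less_mult_iff)
  obtain i j where ij: "i < N1" "j < N2" and K: "cbox p q = cbox (fst a + real i * w1, snd a + real j * w2)
                   (fst a + real (Suc i) * w1, snd a + real (Suc j) * w2)"
    using assms(2) unfolding T by blast
  have "cbox p q \<noteq> {}" using assms(3) interior_subset[of "cbox p q"] by blast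
  then have pq: "p = (fst a + real i * w1, snd a + real j * w2)" "q = (fst a + real (Suc i) * w1, snd a + real (Suc j) * w2)"
    using K by (simp_all add: eq_cbox)
  have le: "real (Suc i) * w1 \<le> real N1 * w1" "real (Suc j) * w2 \<le> real N2 * w2"
    using ij pos by (intro mult_right_mono; simp)+
  have "cbox p q \<subseteq> cbox (fst a, snd a) (fst b, snd b)"
    unfolding pq cbox_Pair_eq using le w(1,2) pos by (intro Sigma_mono) (auto intro: add_increasing2 order.trans)
  then have sub: "cbox p q \<subseteq> cbox a b" by simp
  have "w1\<^sup>2 + w2\<^sup>2 = w2\<^sup>2 * (1 + \<rho>\<^sup>2)" by (simp add: w(3) power_mult_distrib algebra_simps)
  then have "h = w2 * sqrt (1 + \<rho>\<^sup>2)" using pos by (simp add: w(4) real_sqrt_mult)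
  moreover have "0 < \<rho>" using pos w(3) by (simp add: zero_less_mult_iff)
  ultimately show thesis using that[of w2] pos sub w(3) by (simp add: pq algebra_simps)
qed

text \<open>
A function of the immersed space in rescaled form.  The chart replaces the inverse Frenet map of the
definition, with which it agrees on the element.
\<close>

lemma ife_space_scaled:
  assumes "frenet_element g L \<gamma> \<Gamma> \<epsilon> \<xi>s h \<xi>0 \<xi>1 p q"
    and "\<phi> \<in> ife_space g L \<epsilon> m \<beta>p \<beta>m \<xi>0 \<xi>1 \<Omega>p \<Omega>m (cbox p q)"
  obtains up um where "\<forall>i. degree (up i) \<le> m" "\<forall>i. degree (um i) \<le> m"
    "\<forall>x\<in>cbox p q \<inter> \<Omega>p. \<phi> x = scaled_poly m h \<xi>0 up (frenet_element.chart g L h \<xi>0 \<xi>1 x)"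
    "\<forall>x\<in>cbox p q \<inter> \<Omega>m. \<phi> x = scaled_poly m h \<xi>0 um (frenet_element.chart g L h \<xi>0 \<xi>1 x)"
    "transmission g m \<beta>p \<beta>m \<xi>0 \<xi>1 (scaled_poly m h \<xi>0 up) (scaled_poly m h \<xi>0 um)"
proof -
  interpret frenet_element g L \<gamma> \<Gamma> \<epsilon> \<xi>s h \<xi>0 \<xi>1 p q by (rule assms(1))
  let ?R = "frenet_inv g L \<epsilon> \<xi>0"
  obtain \<phi>h where \<phi>h: "\<phi>h \<in> ref_ife_space g m \<beta>p \<beta>m \<xi>0 \<xi>1 (?R ` (cbox p q \<inter> \<Omega>p)) (?R ` (cbox p q \<inter> \<Omega>m))"
    and \<phi>: "\<And>x. x \<in> cbox p q \<Longrightarrow> \<phi> x = \<phi>h (?R x)"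
    using assms(2) unfolding ife_space_def Let_def by blast
  obtain pp pm where "pp \<in> Q_poly m" "pm \<in> Q_poly m"
    and vals: "\<forall>z\<in>?R ` (cbox p q \<inter> \<Omega>p). \<phi>h z = pp z" "\<forall>z\<in>?R ` (cbox p q \<inter> \<Omega>m). \<phi>h z = pm z"
    and tr: "transmission g m \<beta>p \<beta>m \<xi>0 \<xi>1 pp pm"
    using \<phi>h unfolding ref_ife_space_def mem_Collect_eq transmission_def by blast
  have "h \<noteq> 0" using h(1) by simp
  obtain up where up: "\<And>i. degree (up i) \<le> m" "\<And>\<eta> \<xi>. pp (\<eta>, \<xi>) = (\<Sum>i\<le>m. (\<eta> / h) ^ i * poly (up i) ((\<xi> - \<xi>0) / h))"
    using Q_poly_scaled[OF \<open>pp \<in> Q_poly m\<close> \<open>h \<noteq> 0\<close>, of \<xi>0] by blast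
  obtain um where um: "\<And>i. degree (um i) \<le> m" "\<And>\<eta> \<xi>. pm (\<eta>, \<xi>) = (\<Sum>i\<le>m. (\<eta> / h) ^ i * poly (um i) ((\<xi> - \<xi>0) / h))"
    using Q_poly_scaled[OF \<open>pm \<in> Q_poly m\<close> \<open>h \<noteq> 0\<close>, of \<xi>0] by blast
  have eq: "pp = scaled_poly m h \<xi>0 up" "pm = scaled_poly m h \<xi>0 um"
    by (rule ext, simp add: up(2) um(2) scaled_poly_eq split_paired_all)+
  have "\<phi> x = pp (chart x)" if "x \<in> cbox p q \<inter> \<Omega>p" for x
    using vals(1) that \<phi>[of x] frenet_inv_eq_chart[of x] by (metis IntD1 imageI)
  moreover have "\<phi> x = pm (chart x)" if "x \<in> cbox p q \<inter> \<Omega>m" for x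
    using vals(2) that \<phi>[of x] frenet_inv_eq_chart[of x] by (metis IntD1 imageI)
  ultimately show thesis using up(1) um(1) tr unfolding eq by (intro that[of up um]) blast+
qed

text \<open>
Either lower bound suffices.  From the minus side, \<open>\<beta>p Sp\<close> is at most \<open>2 E \<beta>p Sm\<close>, and
\<open>\<beta>p Sm = (\<beta>p / \<surd>\<beta>m) \<surd>\<beta>m Sm\<close>.  From the plus side, \<open>\<beta>m Sm\<close> is at most \<open>2 E \<beta>p Sp\<close> by the extension estimate, and \<open>\<surd>\<beta>m \<le> \<surd>\<beta>p\<close>.
\<close>

lemma coefficient_bookkeeping:
  fixes \<beta>p \<beta>m Sp Sm E N c :: real
  assumes \<beta>: "0 < \<beta>m" "\<beta>m \<le> \<beta>p" and nn: "0 \<le> Sp" "0 \<le> Sm" "0 < E" "0 < c"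
    and ext: "Sm \<le> E * (1 + \<beta>p / \<beta>m) * Sp" "Sp \<le> E * (1 + \<beta>m / \<beta>p) * Sm"
    and low: "c * (sqrt \<beta>p * Sp) \<le> N \<or> c * (sqrt \<beta>m * Sm) \<le> N"
  shows "max (\<beta>p * Sp) (\<beta>m * Sm) \<le> (2 * E + 1) * (\<beta>p / sqrt \<beta>m) * (N / c)"
proof -
  have \<beta>p: "0 < \<beta>p" using \<beta> by linarith
  have key: "\<beta>p * S \<le> (\<beta>p / sqrt \<beta>m) * (N / c)" if "c * (sqrt \<beta>m * S) \<le> N" for S
  proof -
    have "sqrt \<beta>m * S \<le> N / c" using that nn(4) by (simp add: field_simps)
    then have "(\<beta>p / sqrt \<beta>m) * (sqrt \<beta>m * S) \<le> (\<beta>p / sqrt \<beta>m) * (N / c)"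
      using \<beta> \<beta>p by (intro mult_left_mono) auto
    then show ?thesis using \<beta>(1) by simp
  qed
  from low have "\<exists>S\<ge>0. c * (sqrt \<beta>m * S) \<le> N \<and> \<beta>p * Sp \<le> (2 * E + 1) * (\<beta>p * S) \<and> \<beta>m * Sm \<le> (2 * E + 1) * (\<beta>p * S)"
  proof
    assume l: "c * (sqrt \<beta>p * Sp) \<le> N"
    have "c * (sqrt \<beta>m * Sp) \<le> c * (sqrt \<beta>p * Sp)" using \<beta> nn by (intro mult_left_mono mult_right_mono) auto
    moreover have "\<beta>m * Sm \<le> (2 * E + 1) * (\<beta>p * Sp)"
    proof -
      have "\<beta>m * Sm \<le> \<beta>m * (E * (1 + \<beta>p / \<beta>m) * Sp)" using ext(1) \<beta>(1) by (intro mult_left_mono) auto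
      also have "\<dots> = E * ((\<beta>m + \<beta>p) * Sp)" using \<beta>(1) by (simp add: field_simps)
      also have "\<dots> \<le> E * ((\<beta>p + \<beta>p) * Sp)" using \<beta> nn by (intro mult_left_mono mult_right_mono) auto
      also have "\<dots> \<le> (2 * E + 1) * (\<beta>p * Sp)" using nn \<beta>p by (simp add: algebra_simps)
      finally show ?thesis .
    qed
    moreover have "\<beta>p * Sp \<le> (2 * E + 1) * (\<beta>p * Sp)" using nn \<beta>p by (simp add: algebra_simps)
    ultimately show ?thesis using l nn(1) by (intro exI[of _ Sp]) auto
  next
    assume l: "c * (sqrt \<beta>m * Sm) \<le> N"
    have "\<beta>m / \<beta>p \<le> 1" using \<beta> \<beta>p by simp
    then have "E * (1 + \<beta>m / \<beta>p) * Sm \<le> E * 2 * Sm" using nn by (intro mult_right_mono mult_left_mono) auto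
    with ext(2) have "Sp \<le> (2 * E + 1) * Sm" using nn by (simp add: algebra_simps)
    then have 1: "\<beta>p * Sp \<le> \<beta>p * ((2 * E + 1) * Sm)" using \<beta>p by (intro mult_left_mono) auto
    have "\<beta>m * Sm \<le> 1 * (\<beta>p * Sm)" using \<beta> nn by (simp add: mult_right_mono)
    also have "1 * (\<beta>p * Sm) \<le> (2 * E + 1) * (\<beta>p * Sm)" using nn \<beta>p by (intro mult_right_mono) auto
    finally have "\<beta>m * Sm \<le> (2 * E + 1) * (\<beta>p * Sm)" .
    with 1 show ?thesis using l nn(2) by (intro exI[of _ Sm]) (auto simp: mult_ac)
  qed
  then obtain S where S: "c * (sqrt \<beta>m * S) \<le> N" "\<beta>p * Sp \<le> (2 * E + 1) * (\<beta>p * S)" "\<beta>m * Sm \<le> (2 * E + 1) * (\<beta>p * S)" by blast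
  have "(2 * E + 1) * (\<beta>p * S) \<le> (2 * E + 1) * ((\<beta>p / sqrt \<beta>m) * (N / c))"
    using key[OF S(1)] nn(3) by (intro mult_left_mono) auto
  with S(2,3) show ?thesis by (simp add: mult.assoc)
qed

theorem theorem2:
  fixes g :: "real \<Rightarrow> plane" and \<xi>s \<xi>e \<epsilon> \<rho> c1 c2 :: real and m :: nat
  assumes "m \<ge> 1"
    and "regular_closed_curve (m + 1) g \<xi>s \<xi>e"
    and "\<epsilon> > 0" and "inj_on (frenet g) ({-\<epsilon><..<\<epsilon>} \<times> {\<xi>s..<\<xi>e})"
    and "\<rho> > 0" and "c1 > 0" and "c2 > 0"
  shows "\<exists>hstar>0. \<exists>C>0.
    \<forall>(a::plane) (b::plane) \<Omega>p \<Omega>m \<T> (h::real) (\<beta>p::real) (\<beta>m::real) (p::plane) (q::plane)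
       (\<xi>0::real) (\<xi>1::real) \<phi>.
      interface_splitting g \<xi>s \<xi>e a b \<Omega>p \<Omega>m \<longrightarrow>
      0 < \<beta>m \<longrightarrow> \<beta>m \<le> \<beta>p \<longrightarrow>
      uniform_mesh a b \<rho> h \<T> \<longrightarrow>
      h < \<epsilon> / 2 \<longrightarrow> (\<forall>t. h * \<bar>curvature g t\<bar> \<le> 1 / 2) \<longrightarrow> h < hstar \<longrightarrow>
      cbox p q \<in> \<T> \<longrightarrow> interior (cbox p q) \<inter> g ` {\<xi>s..\<xi>e} \<noteq> {} \<longrightarrow>
      cbox p q \<subseteq> frenet g ` ({-h..h} \<times> {\<xi>0..\<xi>1}) \<longrightarrow>
      c1 * h \<le> \<xi>1 - \<xi>0 \<longrightarrow> \<xi>1 - \<xi>0 \<le> c2 * h \<longrightarrow>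
      \<phi> \<in> ife_space g (\<xi>e - \<xi>s) \<epsilon> m \<beta>p \<beta>m \<xi>0 \<xi>1 \<Omega>p \<Omega>m (cbox p q) \<longrightarrow>
      L2_boundary_norm p q (\<lambda>x. piecewise_coeff \<Omega>p \<beta>p \<beta>m x *\<^sub>R grad \<phi> x)
        \<le> C * (\<beta>p / sqrt \<beta>m) * h powr (- 1 / 2) *
          L2_norm (cbox p q) (\<lambda>x. sqrt (piecewise_coeff \<Omega>p \<beta>p \<beta>m x) *\<^sub>R grad \<phi> x)"
proof -
  define L where "L = \<xi>e - \<xi>s"
  have \<xi>e: "\<xi>e = \<xi>s + L" by (simp add: L_def)
  obtain \<gamma> \<Gamma> where rc: "regular_curve g L \<gamma> \<Gamma>"
    unfolding L_def by (rule regular_closed_curve_imp[OF assms(2,1)])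
  interpret regular_curve g L \<gamma> \<Gamma> by (rule rc)
  \<comment> \<open>If \<open>c2 < c1\<close>, no element satisfies the length condition; the maximum covers this case without a distinction.\<close>
  define c2' where "c2' = max c1 c2"
  define T where "T = max 1 c2'"
  have c2': "c1 \<le> c2'" "c2 \<le> c2'" "0 < c2'" and T: "1 \<le> T" "c2' \<le> T" using assms(6) by (auto simp: c2'_def T_def)
  \<comment> \<open>The ratio of the shorter side of an element to its diameter.\<close>
  define \<omega> where "\<omega> = min \<rho> 1 / sqrt (1 + \<rho>\<^sup>2)"
  have sq: "1 \<le> sqrt (1 + \<rho>\<^sup>2)" "\<rho> \<le> sqrt (1 + \<rho>\<^sup>2)" by (auto intro: real_le_rsqrt)
  have \<omega>: "0 < \<omega>" "\<omega> \<le> 1"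
  proof -
    have s: "0 < sqrt (1 + \<rho>\<^sup>2)" "min \<rho> 1 \<le> 1 * sqrt (1 + \<rho>\<^sup>2)" "0 < min \<rho> 1" using sq(1) assms(5) by linarith+
    show "0 < \<omega>" unfolding \<omega>_def by (rule divide_pos_pos[OF s(3,1)])
    show "\<omega> \<le> 1" unfolding \<omega>_def pos_divide_le_eq[OF s(1)] by (rule s(2))
  qed
  define \<delta> where "\<delta> = \<omega> / (32 * (1 + 2 * \<Gamma>))"
  have "0 < 2 * \<delta>" "0 \<le> T" using \<omega>(1) \<Gamma>_pos T by (simp_all add: \<delta>_def)
  then obtain C0 where C0: "0 < C0" "\<And>u s0 t0 B. (\<forall>i. degree (u i) \<le> m) \<Longrightarrow> \<bar>s0\<bar> \<le> T \<Longrightarrow> \<bar>t0\<bar> \<le> T \<Longrightarrow>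
     (\<forall>s\<in>{s0..s0+2*\<delta>}. \<forall>t\<in>{t0..t0+2*\<delta>}. \<bar>dsum_s m u s t\<bar> \<le> B \<and> \<bar>dsum_t m u s t\<bar> \<le> B) \<Longrightarrow>
     grad_size m u \<le> C0 * B"
    using grad_size_le_sup[of "2 * \<delta>" T m] by blast
  define \<nu> where "\<nu> = min (\<omega> / (16 * (1 + 2 / \<gamma>))) (1 / (8 * C0 * ((real (m + 1))\<^sup>2 * T ^ m) * (1 + 2 / \<gamma>)))"
  have "0 < 1 + 2 / \<gamma>" using \<gamma>(1) by (simp add: add_pos_pos)
  have \<nu>: "0 < \<nu>"
    unfolding \<nu>_def using \<omega>(1) C0(1) T(1) \<open>0 < 1 + 2 / \<gamma>\<close> by (auto intro!: divide_pos_pos mult_pos_pos)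
  define \<Lambda> where "\<Lambda> = min 1 (1 / (2 * \<Gamma>)) / (4 * C0)"
  have \<Lambda>: "0 < \<Lambda>" using \<Gamma>_pos C0(1) by (simp add: \<Lambda>_def)
  define Cu where "Cu = (1 + 2 / \<gamma>) * (real (m + 1) * T ^ m)"
  have Cu: "0 < Cu" using T \<open>0 < 1 + 2 / \<gamma>\<close> by (simp add: Cu_def)
  obtain E where E: "0 < E" "extension_bound g m c1 c2' E"
  proof (cases "2 \<le> m")
    case True
    obtain w' k' B where *:
      "\<forall>\<xi>. ((\<lambda>t. 1 / norm (vderiv g t)) has_real_derivative w' \<xi>) (at \<xi>)"
      "\<forall>\<xi>. (curvature g has_real_derivative k' \<xi>) (at \<xi>)"
      "continuous_on UNIV w'" "continuous_on UNIV k'" "0 < B"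
      "\<forall>\<xi>. \<bar>curvature g \<xi>\<bar> \<le> B" "\<forall>\<xi>. 1 / norm (vderiv g \<xi>) \<le> B" "\<forall>\<xi>. \<bar>w' \<xi>\<bar> \<le> B" "\<forall>\<xi>. \<bar>k' \<xi>\<bar> \<le> B"
      by (rule curve_coefficients[OF assms(2) True])
    show thesis
      using ife_extension_bound[OF assms(6) c2'(1) less_imp_le[OF *(5)], where m = m and g = g and w' = w' and k' = k',
          OF *(1)[rule_format] *(2)[rule_format] *(3,4) *(6)[rule_format] *(7)[rule_format] *(8)[rule_format] *(9)[rule_format]]
        that by blast
  next
    case False
    then show thesis
      using ife_extension_bound[OF assms(6) c2'(1) order.refl, where m = m and g = g and w' = "\<lambda>_. 0" and k' = "\<lambda>_. 0"] that by blast
  qed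
  \<comment> \<open>The bound \<open>1\<close> serves the power count in \<open>h\<close>; the other one makes the parameter interval of an element, enlarged by \<open>h\<close>, shorter than a period.\<close>
  define hstar where "hstar = min 1 (L / (c2' + 1))"
  define C where "C = 2 * Cu * ((2 * E + 1) / (\<Lambda> * \<nu>))"
  have hstar: "0 < hstar" using L_def assms(2) c2'(3) by (simp add: hstar_def regular_closed_curve_def)
  have C: "0 < C" using Cu E(1) \<Lambda> \<nu> by (simp add: C_def)
  have main: "L2_boundary_norm p q (\<lambda>x. piecewise_coeff \<Omega>p \<beta>p \<beta>m x *\<^sub>R grad \<phi> x)
        \<le> C * (\<beta>p / sqrt \<beta>m) * h powr (- 1 / 2) *
          L2_norm (cbox p q) (\<lambda>x. sqrt (piecewise_coeff \<Omega>p \<beta>p \<beta>m x) *\<^sub>R grad \<phi> x)"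
    if split: "interface_splitting g \<xi>s \<xi>e a b \<Omega>p \<Omega>m" and \<beta>: "0 < \<beta>m" "\<beta>m \<le> \<beta>p"
      and mesh: "uniform_mesh a b \<rho> h \<T>" and hb: "h < \<epsilon> / 2" "\<forall>t. h * \<bar>curvature g t\<bar> \<le> 1 / 2" "h < hstar"
      and K: "cbox p q \<in> \<T>" "interior (cbox p q) \<inter> g ` {\<xi>s..\<xi>e} \<noteq> {}"
        "cbox p q \<subseteq> frenet g ` ({-h..h} \<times> {\<xi>0..\<xi>1})"
      and lb: "c1 * h \<le> \<xi>1 - \<xi>0" "\<xi>1 - \<xi>0 \<le> c2 * h"
      and \<phi>: "\<phi> \<in> ife_space g (\<xi>e - \<xi>s) \<epsilon> m \<beta>p \<beta>m \<xi>0 \<xi>1 \<Omega>p \<Omega>m (cbox p q)"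
    for a b :: plane and \<Omega>p \<Omega>m \<T> h \<beta>p \<beta>m p q \<xi>0 \<xi>1 \<phi>
  proof -
    have "interior (cbox p q) \<noteq> {}" using K(2) by blast
    then obtain w where w: "0 < w" "fst q - fst p = \<rho> * w" "snd q - snd p = w" "h = w * sqrt (1 + \<rho>\<^sup>2)" "cbox p q \<subseteq> cbox a b"
      using uniform_mesh_element[OF mesh K(1)] by metis
    have h0: "0 < h" unfolding w(4) using w(1) sq(1) by (intro mult_pos_pos) linarith+
    have h1: "h \<le> 1" "h * (c2' + 1) < L" using hb(3) c2'(3) by (simp_all add: hstar_def less_divide_eq)
    have len': "\<xi>1 - \<xi>0 \<le> c2' * h" using lb(2) mult_right_mono[OF c2'(2), of h] h0 by linarith
    have lenT: "\<xi>1 - \<xi>0 \<le> T * h" using len' mult_right_mono[OF T(2), of h] h0 by linarith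
    have "0 < c1 * h" using assms(6) h0 by simp
    have fe: "frenet_element g L \<gamma> \<Gamma> \<epsilon> \<xi>s h \<xi>0 \<xi>1 p q"
    proof (intro frenet_element.intro rc frenet_element_axioms.intro)
      show "inj_on (frenet g) ({- \<epsilon><..<\<epsilon>} \<times> {\<xi>s..<\<xi>s + L})" using assms(4) unfolding \<xi>e .
      show "\<xi>1 - \<xi>0 + h < L" using len' h1(2) by (simp add: algebra_simps)
      show "fst p < fst q" "snd p < snd q" using w(1-3) mult_pos_pos[OF assms(5) w(1)] by linarith+
    qed (use hb h0 lb K(3) \<open>0 < c1 * h\<close> in auto)
    interpret frenet_element g L \<gamma> \<Gamma> \<epsilon> \<xi>s h \<xi>0 \<xi>1 p q by (rule fe)
    obtain up um where deg: "\<forall>i. degree (up i) \<le> m" "\<forall>i. degree (um i) \<le> m"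
      and \<phi>p: "\<forall>x\<in>cbox p q \<inter> \<Omega>p. \<phi> x = scaled_poly m h \<xi>0 up (chart x)"
      and \<phi>m: "\<forall>x\<in>cbox p q \<inter> \<Omega>m. \<phi> x = scaled_poly m h \<xi>0 um (chart x)"
      and tr: "transmission g m \<beta>p \<beta>m \<xi>0 \<xi>1 (scaled_poly m h \<xi>0 up) (scaled_poly m h \<xi>0 um)"
      by (rule ife_space_scaled[OF fe \<phi>[folded L_def]])
    define Sp Sm where "Sp = grad_size m up" and "Sm = grad_size m um"
    have \<beta>p: "0 < \<beta>p" using \<beta> by linarith
    have ext: "Sm \<le> E * (1 + \<beta>p / \<beta>m) * Sp" "Sp \<le> E * (1 + \<beta>m / \<beta>p) * Sm"
      unfolding Sp_def Sm_def
      using E(2) h0 h1(1) lb(1) len' deg \<beta>p \<beta>(1) tr transmission_sym[OF tr]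
      unfolding extension_bound_def by blast+
    have Kab: "box p q \<subseteq> box a b" using interior_mono[OF w(5)] by simp
    have side: "x \<in> \<Omega>p" if "x \<in> box p q" "0 < fst (chart x)" for x
      using side_of_interface(1)[OF split[unfolded \<xi>e]] that Kab box_subset_cbox by blast
    have side': "x \<in> \<Omega>m" "x \<notin> \<Omega>p" if "x \<in> box p q" "fst (chart x) < 0" for x
    proof -
      show "x \<in> \<Omega>m" using side_of_interface(2)[OF split[unfolded \<xi>e]] that Kab box_subset_cbox by blast
      then show "x \<notin> \<Omega>p" using split by (auto simp: interface_splitting_def)
    qed
    have bd: "box p q \<subseteq> chart_dom" using K_chart_dom box_subset_cbox by blast
    have cfst: "continuous_on (box p q) (\<lambda>x. fst (chart x))"
      by (intro continuous_on_fst continuous_on_subset[OF continuous_on_chart] bd)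
    have gradp: "grad \<phi> x = chart_grad m up x" if x: "x \<in> box p q" "0 < fst (chart x)" for x
    proof (rule grad_eq_chart_grad)
      show "open (box p q \<inter> (\<lambda>x. fst (chart x)) -` {0<..})" by (intro continuous_open_preimage cfst) auto
      show "\<phi> y = scaled_poly m h \<xi>0 up (chart y)" if "y \<in> box p q \<inter> (\<lambda>x. fst (chart x)) -` {0<..}" for y
        using that side[of y] box_subset_cbox[of p q] by (intro bspec[OF \<phi>p]) auto
    qed (use x bd in auto)
    have gradm: "grad \<phi> x = chart_grad m um x" if x: "x \<in> box p q" "fst (chart x) < 0" for x
    proof (rule grad_eq_chart_grad)
      show "open (box p q \<inter> (\<lambda>x. fst (chart x)) -` {..<0})" by (intro continuous_open_preimage cfst) auto
      show "\<phi> y = scaled_poly m h \<xi>0 um (chart y)" if "y \<in> box p q \<inter> (\<lambda>x. fst (chart x)) -` {..<0}" for y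
        using that side'(1)[of y] box_subset_cbox[of p q] by (intro bspec[OF \<phi>m]) auto
    qed (use x bd in auto)
    have cg: "continuous_on chart_dom (\<lambda>x. k *\<^sub>R chart_grad m u x)" for k u
      by (intro continuous_on_scaleR continuous_on_const continuous_on_chart_grad)
    define N where "N = L2_norm (cbox p q) (\<lambda>x. sqrt (piecewise_coeff \<Omega>p \<beta>p \<beta>m x) *\<^sub>R grad \<phi> x)"
    have N0: "0 \<le> N" unfolding N_def L2_norm_def set_lebesgue_integral_def by (intro real_sqrt_ge_zero integral_nonneg_AE AE_I2) auto
    have sides: "\<omega> * h \<le> fst q - fst p" "\<omega> * h \<le> snd q - snd p" "fst q - fst p \<le> h" "snd q - snd p \<le> h"
    proof -
      have cancel: "a / W * (w * W) = a * w" if "W \<noteq> 0" for a W :: real using that by simp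
      have "\<omega> * h = min \<rho> 1 * w" unfolding \<omega>_def w(4) by (rule cancel) (use sq(1) in linarith)
      then show "\<omega> * h \<le> fst q - fst p" "\<omega> * h \<le> snd q - snd p" using w(1) unfolding w(2,3) by simp_all
      show "fst q - fst p \<le> h" "snd q - snd p \<le> h" unfolding w(2,3) w(4) using sq w(1) by (simp_all add: mult.commute[of w])
    qed
    have grad_low: "\<Lambda> * S / h \<le> norm (chart_grad m u y)"
      if y: "y \<in> cbox p q" and S: "0 \<le> S" and big: "large_slope m u (S / (4 * C0)) y" for y u S
    proof -
      have eq: "\<Lambda> * S / h = min 1 (1 / (2 * \<Gamma>)) * (S / (4 * C0) / h)" by (simp add: \<Lambda>_def)
      have pos: "0 \<le> S / (4 * C0) / h" using S C0(1) h0 by simp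
      from big show ?thesis unfolding large_slope_def
      proof
        assume *: "S / (4 * C0) \<le> \<bar>slope_s m u (chart y)\<bar>"
        have "\<Lambda> * S / h \<le> 1 * (S / (4 * C0) / h)" unfolding eq using pos by (intro mult_right_mono) auto
        also have "\<dots> \<le> \<bar>slope_s m u (chart y)\<bar> / h"
          using divide_right_mono[OF *, of h] h0 by simp
        also have "\<dots> \<le> norm (chart_grad m u y)" by (rule chart_grad_lower(1)[OF y])
        finally show ?thesis .
      next
        assume *: "S / (4 * C0) \<le> \<bar>slope_t m u (chart y)\<bar>"
        have "\<Lambda> * S / h \<le> (1 / (2 * \<Gamma>)) * (S / (4 * C0) / h)" unfolding eq using pos by (intro mult_right_mono) auto
        also have "\<dots> \<le> (1 / (2 * \<Gamma>)) * (\<bar>slope_t m u (chart y)\<bar> / h)"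
          using divide_right_mono[OF *, of h] h0 \<Gamma>_pos by (intro mult_left_mono) auto
        also have "\<dots> \<le> norm (chart_grad m u y)" using chart_grad_lower(2)[OF y, of m u] by (simp add: mult.commute)
        finally show ?thesis .
      qed
    qed
    obtain \<sigma> :: real where \<sigma>: "\<sigma> = 1 \<or> \<sigma> = -1"
      and big: "\<forall>u. (\<forall>i. degree (u i) \<le> m) \<longrightarrow> 0 < grad_size m u \<longrightarrow> (\<exists>x. ball x (\<nu> * h) \<subseteq> box p q \<and> (\<forall>y\<in>ball x (\<nu> * h). 0 < \<sigma> * fst (chart y) \<and>
        large_slope m u (grad_size m u / (4 * C0)) y))"
      unfolding \<nu>_def by (rule large_gradient_ball[OF \<omega> sides(1,2) T(1) lenT C0[unfolded \<delta>_def]])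
    have Fp: "sqrt (piecewise_coeff \<Omega>p \<beta>p \<beta>m y) *\<^sub>R grad \<phi> y = sqrt \<beta>p *\<^sub>R chart_grad m up y"
      "piecewise_coeff \<Omega>p \<beta>p \<beta>m y *\<^sub>R grad \<phi> y = \<beta>p *\<^sub>R chart_grad m up y"
      if "y \<in> box p q" "0 < fst (chart y)" for y
      using gradp[OF that] side[OF that] by (simp_all add: piecewise_coeff_def)
    have Fm: "sqrt (piecewise_coeff \<Omega>p \<beta>p \<beta>m y) *\<^sub>R grad \<phi> y = sqrt \<beta>m *\<^sub>R chart_grad m um y"
      "piecewise_coeff \<Omega>p \<beta>p \<beta>m y *\<^sub>R grad \<phi> y = \<beta>m *\<^sub>R chart_grad m um y"
      if "y \<in> box p q" "fst (chart y) < 0" for y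
      using gradm[OF that] side'(2)[OF that] by (simp_all add: piecewise_coeff_def)
    have one_sided: "(\<Lambda> * \<nu>) * (k * grad_size m u) \<le> N"
      if u: "\<forall>i. degree (u i) \<le> m" and k: "0 \<le> k"
        and eq: "\<And>y. 0 < \<sigma> * fst (chart y) \<Longrightarrow>
          0 < fst (chart y) \<and> k *\<^sub>R chart_grad m u y = sqrt \<beta>p *\<^sub>R chart_grad m up y \<or>
          fst (chart y) < 0 \<and> k *\<^sub>R chart_grad m u y = sqrt \<beta>m *\<^sub>R chart_grad m um y" for u k
    proof (cases "grad_size m u = 0")
      case False
      define S where "S = grad_size m u"
      have S: "0 < S" using False grad_size_nonneg[of m u] unfolding S_def by linarith
      from big[rule_format, OF u[rule_format] S[unfolded S_def]] obtain x where x: "ball x (\<nu> * h) \<subseteq> box p q"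
        and low: "\<And>y. y \<in> ball x (\<nu> * h) \<Longrightarrow> 0 < \<sigma> * fst (chart y) \<and>
          large_slope m u (S / (4 * C0)) y"
        unfolding S_def by blast
      have "k * (\<Lambda> * S / h) * (\<nu> * h) \<le> N" unfolding N_def
      proof (rule L2_norm_ge[OF Fp(1) Fm(1) cg cg x])
        show "0 \<le> \<nu> * h" "0 \<le> k * (\<Lambda> * S / h)" using \<nu> h0 \<Lambda> k S by simp_all
        fix y assume y: "y \<in> ball x (\<nu> * h)"
        then have "y \<in> cbox p q" using x box_subset_cbox by blast
        from mult_left_mono[OF grad_low[OF this less_imp_le[OF S] conjunct2[OF low[OF y]]] k]
        have "k * (\<Lambda> * S / h) \<le> norm (k *\<^sub>R chart_grad m u y)" unfolding norm_scaleR abs_of_nonneg[OF k] .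
        then show "0 < fst (chart y) \<and> k * (\<Lambda> * S / h) \<le> norm (sqrt \<beta>p *\<^sub>R chart_grad m up y) \<or>
            fst (chart y) < 0 \<and> k * (\<Lambda> * S / h) \<le> norm (sqrt \<beta>m *\<^sub>R chart_grad m um y)"
          using eq[OF conjunct1[OF low[OF y]]] by (elim disjE conjE) (simp_all only: simp_thms)
      qed
      then show ?thesis using h0 by (simp add: S_def mult_ac)
    qed (simp add: N0)
    have low: "(\<Lambda> * \<nu>) * (sqrt \<beta>p * Sp) \<le> N \<or> (\<Lambda> * \<nu>) * (sqrt \<beta>m * Sm) \<le> N"
      using \<sigma>
    proof
      assume "\<sigma> = 1"
      then have "(\<Lambda> * \<nu>) * (sqrt \<beta>p * Sp) \<le> N"
        unfolding Sp_def using \<beta>p by (intro one_sided deg) simp_all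
      then show ?thesis ..
    next
      assume "\<sigma> = -1"
      then have "(\<Lambda> * \<nu>) * (sqrt \<beta>m * Sm) \<le> N"
        unfolding Sm_def using \<beta> by (intro one_sided deg) simp_all
      then show ?thesis ..
    qed
    define M where "M = Cu / h * max (\<beta>p * Sp) (\<beta>m * Sm)"
    have Mk: "norm (k *\<^sub>R chart_grad m u y) \<le> Cu / h * (k * grad_size m u)"
      if "y \<in> cbox p q" "\<forall>i. degree (u i) \<le> m" "0 < k" for k u y
    proof -
      have "norm (chart_grad m u y) \<le> Cu * (grad_size m u / h)"
        unfolding Cu_def by (rule chart_grad_upper[OF that(1) that(2)[rule_format] T(1) lenT])
      then have "k * norm (chart_grad m u y) \<le> k * (Cu * (grad_size m u / h))" using that(3) by (intro mult_left_mono) auto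
      then show ?thesis using that(3) by (simp add: mult_ac)
    qed
    have "L2_boundary_norm p q (\<lambda>x. piecewise_coeff \<Omega>p \<beta>p \<beta>m x *\<^sub>R grad \<phi> x) \<le> 2 * sqrt h * M"
    proof (rule L2_boundary_norm_le[OF Fp(2) Fm(2) cg cg _ _ sides(3,4)])
      have Cuh: "0 \<le> Cu / h" using Cu h0 by simp
      have "Cu / h * (\<beta>p * Sp) \<le> M" "Cu / h * (\<beta>m * Sm) \<le> M"
        unfolding M_def by (rule mult_left_mono[OF max.cobounded1 Cuh], rule mult_left_mono[OF max.cobounded2 Cuh])
      then show "norm (\<beta>p *\<^sub>R chart_grad m up y) \<le> M" "norm (\<beta>m *\<^sub>R chart_grad m um y) \<le> M" if "y \<in> cbox p q" for y
        using Mk[OF that deg(1) \<beta>p] Mk[OF that deg(2) \<beta>(1)] unfolding Sp_def Sm_def by linarith+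
    qed
    also have "\<dots> = 2 * Cu * (sqrt h / h) * max (\<beta>p * Sp) (\<beta>m * Sm)" by (simp add: M_def)
    also have "sqrt h / h = h powr (- 1 / 2)"
      using h0 by (simp add: powr_minus_divide powr_half_sqrt real_div_sqrt field_simps)
    also have "2 * Cu * h powr (- 1 / 2) * max (\<beta>p * Sp) (\<beta>m * Sm)
        \<le> 2 * Cu * h powr (- 1 / 2) * ((2 * E + 1) * (\<beta>p / sqrt \<beta>m) * (N / (\<Lambda> * \<nu>)))"
      using coefficient_bookkeeping[OF \<beta> _ _ E(1) mult_pos_pos[OF \<Lambda> \<nu>] ext low] Cu
      by (intro mult_left_mono) (auto simp: Sp_def Sm_def)
    also have "\<dots> = C * (\<beta>p / sqrt \<beta>m) * h powr (- 1 / 2) * N" by (simp add: C_def mult_ac)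
    finally show ?thesis unfolding N_def .
  qed
  show ?thesis
    by (rule exI[of _ hstar], rule conjI[OF hstar], rule exI[of _ C], rule conjI[OF C], intro allI impI, rule main)
qed

end
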